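(* Let $M^2$ be a 2-dimensional Riemannian manifold with metric $g$ and with sign-preserving Gaussian curvature $K$. Then, on some open subset $U$ of $M^2$, there exists a unit totally geodesic vector field $\xi$ if and only if (a) the metric $g$ on $U$ is locally of the form $$ds^2=du^2+\sin^2\alpha(u)\,dv^2,$$ where $\alpha(u)$ solves the differential equation $$\frac{d\alpha}{du}=1-\frac{a+1}{\cos\alpha};$$ (b) the totally geodesic unit vector field $\xi$ is of the form $$\xi=\cos(av+\omega_0)\,\partial_u+\frac{\sin(av+\omega_0)}{\sin\alpha(u)}\,\partial_v,$$ where $a,\omega_0$ are constants (the constant $a$ being the same in (a) and (b)).
   Context: Sign-preserving Gaussian curvature means that $K$ is nonzero and does not change sign on $M^2$. The Sasaki metric on the tangent bundle $TM$ of a Riemannian manifold $(M,g)$ is the metric for which the squared length of the velocity of a curve $t\mapsto(x(t),X(t))$, $X(t)\in T_{x(t)}M$, is $g(x',x')+g(\nabla_{x'}X,\nabla_{x'}X)$, where $\nabla$ is the Levi-Civita connection. The unit tangent bundle $T_1M=\{(x,X):g(X,X)=1\}$ carries the induced metric. A unit vector field $\xi$ on a Riemannian manifold $M$ is regarded as a mapping $\xi:M\to T_1M$. It is called totally geodesic if the submanifold $\xi(M)\subset T_1M$ is totally geodesic in the unit tangent bundle with the Sasaki metric; for a field defined on an open subset $U$, this is applied to the Riemannian manifold $U$. *)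

theory Defs
  imports "HOL-Analysis.Analysis"
begin

section \<open>Smooth maps between open subsets of Euclidean spaces\<close>

text \<open>The set \<open>S\<close> is meant to be open; on an open set \<open>frechet_derivative\<close> only depends on
  the values of the map on \<open>S\<close>.\<close>

fun Ck_on :: "nat \<Rightarrow> 'a::euclidean_space set \<Rightarrow> ('a \<Rightarrow> 'b::real_normed_vector) \<Rightarrow> bool" where
  "Ck_on 0 S f \<longleftrightarrow> continuous_on S f"
| "Ck_on (Suc k) S f \<longleftrightarrow>
     (\<forall>x\<in>S. f differentiable (at x)) \<and>
     (\<forall>b\<in>Basis. Ck_on k S (\<lambda>x. frechet_derivative f (at x) b))"

definition smooth_on :: "'a::euclidean_space set \<Rightarrow> ('a \<Rightarrow> 'b::real_normed_vector) \<Rightarrow> bool" where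
  "smooth_on S f \<longleftrightarrow> (\<forall>k. Ck_on k S f)"


section \<open>Riemannian metrics on open subsets of a Euclidean space\<close>

text \<open>\<open>g x a b\<close> is the inner product at the point \<open>x\<close> of the tangent vectors \<open>a\<close> and \<open>b\<close>, all three
  given by their coordinates.\<close>

type_synonym 'a metric_field = "'a \<Rightarrow> 'a \<Rightarrow> 'a \<Rightarrow> real"

definition riemannian_metric_on :: "'a::euclidean_space set \<Rightarrow> 'a metric_field \<Rightarrow> bool" where
  "riemannian_metric_on S g \<longleftrightarrow>
     (\<forall>a b. smooth_on S (\<lambda>x. g x a b)) \<and>
     (\<forall>x\<in>S. bilinear (g x) \<and> (\<forall>a b. g x a b = g x b a) \<and> (\<forall>a. a \<noteq> 0 \<longrightarrow> g x a a > 0))"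

text \<open>The Christoffel symbols as a vector valued bilinear map,
  \<open>christoffel g x a b = (\<Sum>i j k. \<Gamma>\<^sup>k\<^sub>i\<^sub>j(x) a\<^sub>i b\<^sub>j e\<^sub>k)\<close>: this is the Koszul formula for the
  Levi-Civita connection of \<open>g\<close>, applied to constant fields. The covariant derivative of a field \<open>Y\<close>
  in direction \<open>a\<close> is \<open>D\<^sub>a Y + christoffel g x a Y\<close>.\<close>

definition christoffel :: "'a::euclidean_space metric_field \<Rightarrow> 'a \<Rightarrow> 'a \<Rightarrow> 'a \<Rightarrow> 'a" where
  "christoffel g x a b = (THE c. \<forall>w. g x c w =
     (frechet_derivative (\<lambda>z. g z b w) (at x) a
      + frechet_derivative (\<lambda>z. g z a w) (at x) b
      - frechet_derivative (\<lambda>z. g z a b) (at x) w) / 2)"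

text \<open>\<open>riemann_curvature g x a b w\<close> is \<open>R(a,b)w\<close> with
  \<open>R(X,Y)Z = \<nabla>\<^sub>X\<nabla>\<^sub>YZ - \<nabla>\<^sub>Y\<nabla>\<^sub>XZ - \<nabla>\<^bsub>[X,Y]\<^esub>Z\<close>.\<close>

definition riemann_curvature ::
    "'a::euclidean_space metric_field \<Rightarrow> 'a \<Rightarrow> 'a \<Rightarrow> 'a \<Rightarrow> 'a \<Rightarrow> 'a" where
  "riemann_curvature g x a b w =
     frechet_derivative (\<lambda>z. christoffel g z b w) (at x) a
     - frechet_derivative (\<lambda>z. christoffel g z a w) (at x) b
     + christoffel g x a (christoffel g x b w)
     - christoffel g x b (christoffel g x a w)"

definition pullback_metric ::
    "('a::euclidean_space \<Rightarrow> 'b::euclidean_space) \<Rightarrow> 'b metric_field \<Rightarrow> 'a metric_field" where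
  "pullback_metric f g x a b =
     g (f x) (frechet_derivative f (at x) a) (frechet_derivative f (at x) b)"

text \<open>\<open>f\<close> is an immersion of \<open>N\<close> into a space with metric \<open>h\<close>. The vector on the left-hand side of
  the last equation is the covariant derivative \<open>\<nabla>\<^bsub>df(a)\<^esub> df(b)\<close> along the immersion; that it is tangent
  for all \<open>a\<close> and \<open>b\<close> says that the second fundamental form of the image vanishes.\<close>

definition totally_geodesic_immersion ::
    "'a::euclidean_space set \<Rightarrow> ('a \<Rightarrow> 'b::euclidean_space) \<Rightarrow> 'b metric_field \<Rightarrow> bool" where
  "totally_geodesic_immersion N f h \<longleftrightarrow>
     smooth_on N f \<and> (\<forall>x\<in>N. inj (frechet_derivative f (at x))) \<and>
     (\<forall>x\<in>N. \<forall>a b. \<exists>c.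
        frechet_derivative (\<lambda>z. frechet_derivative f (at z) b) (at x) a
        + christoffel h (f x) (frechet_derivative f (at x) a) (frechet_derivative f (at x) b)
        = frechet_derivative f (at x) c)"


section \<open>The Sasaki metric and the unit tangent bundle in coordinates\<close>

text \<open>A point of the tangent bundle has the induced coordinates \<open>(x, y)\<close>, where \<open>y\<close> are the components
  of the vector. A curve with velocity \<open>(a, b)\<close> through \<open>(x, y)\<close> is a vector field along a curve in the
  base whose covariant derivative is \<open>b + christoffel g x a y\<close>. The definition is the polarization of the
  squared length \<open>g(a,a) + g(\<nabla>\<^sub>aY, \<nabla>\<^sub>aY)\<close>.\<close>

definition sasaki_metric :: "'a::euclidean_space metric_field \<Rightarrow> ('a \<times> 'a) metric_field" where
  "sasaki_metric g = (\<lambda>(x, y) (a, b) (a', b').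
     g x a a' + g x (b + christoffel g x a y) (b' + christoffel g x a' y))"

definition unit_tangent :: "'a::euclidean_space set \<Rightarrow> 'a metric_field \<Rightarrow> ('a \<times> 'a) set" where
  "unit_tangent S g = {(x, y). x \<in> S \<and> g x y y = 1}"

type_synonym plane = "real \<times> real"

type_synonym space3 = "real \<times> real \<times> real"

definition unit_tangent_param ::
    "plane set \<Rightarrow> plane metric_field \<Rightarrow> space3 set \<Rightarrow> (space3 \<Rightarrow> plane \<times> plane) \<Rightarrow> bool" where
  "unit_tangent_param S g W \<psi> \<longleftrightarrow>
     open W \<and> smooth_on W \<psi> \<and> (\<forall>z\<in>W. inj (frechet_derivative \<psi> (at z))) \<and>
     openin (top_of_set (unit_tangent S g)) (\<psi> ` W) \<and>
     (\<exists>\<psi>'. homeomorphism W (\<psi> ` W) \<psi> \<psi>')"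

text \<open>The map \<open>x \<mapsto> (x, \<xi> x)\<close>, read in a local parametrization of the unit tangent bundle with the
  metric induced from the Sasaki metric.\<close>

definition totally_geodesic_in_param ::
    "plane set \<Rightarrow> plane metric_field \<Rightarrow> (plane \<Rightarrow> plane) \<Rightarrow> bool" where
  "totally_geodesic_in_param S g \<xi> \<longleftrightarrow>
     (\<exists>W \<psi> f. unit_tangent_param S g W \<psi> \<and>
        (\<forall>x\<in>S. f x \<in> W \<and> \<psi> (f x) = (x, \<xi> x)) \<and>
        totally_geodesic_immersion S f (pullback_metric \<psi> (sasaki_metric g)))"

definition gauss_curvature :: "plane metric_field \<Rightarrow> plane \<Rightarrow> real" where
  "gauss_curvature g x =
     (let e = (1, 0); e' = (0, 1)
      in g x (riemann_curvature g x e e' e') e / (g x e e * g x e' e' - (g x e e')\<^sup>2))"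


section \<open>Riemannian surfaces\<close>

text \<open>A chart consists of its domain and the coordinate map, whose values outside the domain are
  irrelevant.\<close>

type_synonym 'p chart = "'p set \<times> ('p \<Rightarrow> plane)"

definition is_chart :: "'p topology \<Rightarrow> 'p chart \<Rightarrow> bool" where
  "is_chart X = (\<lambda>(D, \<phi>). openin X D \<and> open (\<phi> ` D) \<and>
     homeomorphic_map (subtopology X D) (top_of_set (\<phi> ` D)) \<phi>)"

definition chart_image :: "'p chart \<Rightarrow> 'p set \<Rightarrow> plane set" where
  "chart_image c U = snd c ` (fst c \<inter> U)"

definition transition :: "'p chart \<Rightarrow> 'p chart \<Rightarrow> plane \<Rightarrow> plane" where
  "transition c c' = snd c' \<circ> inv_into (fst c) (snd c)"

definition compatible_charts :: "'p chart \<Rightarrow> 'p chart \<Rightarrow> bool" where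
  "compatible_charts c c' \<longleftrightarrow>
     smooth_on (chart_image c (fst c')) (transition c c') \<and>
     smooth_on (chart_image c' (fst c)) (transition c' c)"

definition smooth_surface :: "'p topology \<Rightarrow> 'p chart set \<Rightarrow> bool" where
  "smooth_surface X A \<longleftrightarrow>
     Hausdorff_space X \<and> second_countable X \<and>
     (\<forall>c\<in>A. is_chart X c) \<and> (\<Union>c\<in>A. fst c) = topspace X \<and>
     (\<forall>c\<in>A. \<forall>c'\<in>A. compatible_charts c c')"

text \<open>The maximal atlas.\<close>

definition smooth_charts :: "'p topology \<Rightarrow> 'p chart set \<Rightarrow> 'p chart set" where
  "smooth_charts X A = {c. is_chart X c \<and> (\<forall>c'\<in>A. compatible_charts c c')}"

text \<open>Tensor fields on a surface are families of component functions, one for each chart of the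
  maximal atlas, that obey the transformation law.\<close>

type_synonym 'p surface_metric = "'p chart \<Rightarrow> plane metric_field"

type_synonym 'p surface_vector_field = "'p chart \<Rightarrow> plane \<Rightarrow> plane"

definition riemannian_surface ::
    "'p topology \<Rightarrow> 'p chart set \<Rightarrow> 'p surface_metric \<Rightarrow> bool" where
  "riemannian_surface X A g \<longleftrightarrow>
     smooth_surface X A \<and>
     (\<forall>c\<in>smooth_charts X A. riemannian_metric_on (chart_image c (topspace X)) (g c)) \<and>
     (\<forall>c\<in>smooth_charts X A. \<forall>c'\<in>smooth_charts X A. \<forall>x\<in>chart_image c (fst c'). \<forall>a b.
        g c x a b = pullback_metric (transition c c') (g c') x a b)"

definition sign_preserving_curvature ::
    "'p topology \<Rightarrow> 'p chart set \<Rightarrow> 'p surface_metric \<Rightarrow> bool" where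
  "sign_preserving_curvature X A g \<longleftrightarrow>
     (\<forall>c\<in>smooth_charts X A. \<forall>x\<in>chart_image c (topspace X). gauss_curvature (g c) x > 0) \<or>
     (\<forall>c\<in>smooth_charts X A. \<forall>x\<in>chart_image c (topspace X). gauss_curvature (g c) x < 0)"

definition unit_vector_field ::
    "'p topology \<Rightarrow> 'p chart set \<Rightarrow> 'p surface_metric \<Rightarrow> 'p set \<Rightarrow> 'p surface_vector_field \<Rightarrow> bool" where
  "unit_vector_field X A g U \<xi> \<longleftrightarrow>
     (\<forall>c\<in>smooth_charts X A. smooth_on (chart_image c U) (\<xi> c) \<and>
        (\<forall>x\<in>chart_image c U. g c x (\<xi> c x) (\<xi> c x) = 1)) \<and>
     (\<forall>c\<in>smooth_charts X A. \<forall>c'\<in>smooth_charts X A. \<forall>x\<in>chart_image c (fst c' \<inter> U).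
        \<xi> c' (transition c c' x) = frechet_derivative (transition c c') (at x) (\<xi> c x))"

text \<open>Vanishing of the second fundamental form depends neither on the chart nor on the
  parametrization of the unit tangent bundle, so it is tested in one of each near every point.\<close>

definition totally_geodesic_field ::
    "'p topology \<Rightarrow> 'p chart set \<Rightarrow> 'p surface_metric \<Rightarrow> 'p set \<Rightarrow> 'p surface_vector_field \<Rightarrow> bool" where
  "totally_geodesic_field X A g U \<xi> \<longleftrightarrow>
     (\<forall>p\<in>U. \<exists>c\<in>smooth_charts X A. p \<in> fst c \<and> fst c \<subseteq> U \<and>
        totally_geodesic_in_param (chart_image c U) (g c) (\<xi> c))"


section \<open>The normal form\<close>

definition metric_form ::
    "'p surface_metric \<Rightarrow> 'p chart \<Rightarrow> (real \<Rightarrow> real) \<Rightarrow> real \<Rightarrow> bool" where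
  "metric_form g c \<alpha> a \<longleftrightarrow>
     (\<forall>(u, v) \<in> snd c ` fst c.
        cos (\<alpha> u) \<noteq> 0 \<and>
        (\<alpha> has_real_derivative 1 - (a + 1) / cos (\<alpha> u)) (at u) \<and>
        (\<forall>X Y. g c (u, v) X Y = fst X * fst Y + (sin (\<alpha> u))\<^sup>2 * (snd X * snd Y)))"

definition field_form ::
    "'p surface_vector_field \<Rightarrow> 'p chart \<Rightarrow> (real \<Rightarrow> real) \<Rightarrow> real \<Rightarrow> real \<Rightarrow> bool" where
  "field_form \<xi> c \<alpha> a \<omega>\<^sub>0 \<longleftrightarrow>
     (\<forall>(u, v) \<in> snd c ` fst c.
        \<xi> c (u, v) = (cos (a * v + \<omega>\<^sub>0), sin (a * v + \<omega>\<^sub>0) / sin (\<alpha> u)))"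

text \<open>Conditions (a) and (b) on \<open>U\<close>, in the same local coordinates \<open>(u, v)\<close> and with the same
  \<open>a\<close> and \<open>\<alpha>\<close>.\<close>

definition normal_form_on ::
    "'p topology \<Rightarrow> 'p chart set \<Rightarrow> 'p surface_metric \<Rightarrow> 'p set \<Rightarrow> 'p surface_vector_field \<Rightarrow> bool" where
  "normal_form_on X A g U \<xi> \<longleftrightarrow>
     (\<exists>a \<omega>\<^sub>0. \<forall>p\<in>U. \<exists>c\<in>smooth_charts X A. \<exists>\<alpha>. p \<in> fst c \<and> fst c \<subseteq> U \<and>
        metric_form g c \<alpha> a \<and> field_form \<xi> c \<alpha> a \<omega>\<^sub>0)"

end

theory Submission
  imports Defs
begin

text \<open>Let \<open>\<zeta>\<close> complete the unit field \<open>\<xi>\<close> to an orthonormal frame and let \<open>\<eta>(a) = g(\<nabla>\<^sub>a\<xi>, \<zeta>)\<close>. If unit vectors are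
  measured by their angle \<open>s\<close> from \<open>\<xi>\<close>, the Sasaki metric becomes \<open>g + (ds + \<eta>)\<^sup>2\<close>, whose coefficients do
  not depend on \<open>s\<close>, and the field becomes the section \<open>s = 0\<close>. That this section is totally geodesic
  is a first order system for the components \<open>A\<close>, \<open>B\<close> of \<open>\<eta>\<close> in the dual coframe \<open>p\<close>, \<open>q\<close>.

  Since \<open>d\<eta>\<close> is \<open>- K\<close> times the area form and \<open>K\<close> has no zeros, \<open>r = |\<eta>|\<close> differs from \<open>0\<close> and \<open>1\<close> on a dense
  open set. There the system and the structure equations make \<open>(B p - A q) / r\<close> and
  \<open>- (1 + r\<^sup>2) \<eta> / (2 r\<^sup>2)\<close> closed; their potentials \<open>u\<close>, \<open>v\<close> are the coordinates of the normal form, with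
  \<open>\<alpha> = - 2 arctan r\<close>. The angle between \<open>\<xi>\<close> and \<open>\<partial>\<^sub>u\<close> has differential \<open>a dv\<close>, where \<open>a\<close> turns out to be
  both a function of \<open>u\<close> and a function of \<open>v\<close>, hence constant, and the definition of \<open>a\<close> is the
  differential equation of \<open>\<alpha>\<close>. Conversely, in the normal form \<open>\<eta> = (cos \<alpha> - 1) dv\<close>, which solves the
  system.\<close>

section \<open>Calculus of smooth maps\<close>

text \<open>For \<open>du\<^sup>2 + sin\<^sup>2 \<alpha> dv\<^sup>2\<close> the form dv has length 1
  / |sin \<alpha>|, so (cos \<alpha> - 1) dv has length |tan (\<alpha> / 2)|. This is the origin of
  the arctangent; at r = 0 and r = 1 the sine and the cosine of \<alpha> vanish. The unit frame
  along the coordinate lines has connection form cos \<alpha> \<alpha>' dv, so the angle from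
  \<open>\<partial>\<^sub>u\<close> to \<xi> has differential \<eta> - cos \<alpha> \<alpha>' dv =
  (cos \<alpha> (1 - \<alpha>') - 1) dv; naming the coefficient a gives the differential equation.
  As for the factor in dv, put m for the square of r. The system makes dm equal to - K (1 + m) r du,
  and \<phi>(m) \<eta> is then closed exactly when m (1 + m) \<phi>' + \<phi> = 0, that is, when
  \<phi> is a multiple of (1 + m) / m. The multiple - 1/2 fits the metric. An obstacle is the
  definition of a totally geodesic field: it supplies an unknown parametrization of the unit tangent
  bundle and an unknown map into it. The transformation law of the Christoffel symbols carries the
  condition over to the angle coordinates.\<close>

abbreviation deriv_at :: "('a::real_normed_vector \<Rightarrow> 'b::real_normed_vector) \<Rightarrow> 'a \<Rightarrow> 'a \<Rightarrow> 'b"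
  where "deriv_at f x \<equiv> frechet_derivative f (at x)"

lemma deriv_at_eqI: "(f has_derivative f') (at x) \<Longrightarrow> deriv_at f x = f'"
  by (metis frechet_derivative_at)

lemma has_deriv_at: "f differentiable (at x) \<Longrightarrow> (f has_derivative deriv_at f x) (at x)"
  by (simp add: frechet_derivative_works)

lemma linear_deriv_at: "f differentiable (at x) \<Longrightarrow> linear (deriv_at f x)"
  using has_deriv_at has_derivative_bounded_linear bounded_linear.linear by blast

lemma has_derivative_cong_open:
  assumes "open S" "x \<in> S" "\<And>z. z \<in> S \<Longrightarrow> f z = g z"
  shows "(f has_derivative f') (at x) \<longleftrightarrow> (g has_derivative f') (at x)"
proof
  show "(f has_derivative f') (at x) \<Longrightarrow> (g has_derivative f') (at x)"
    by (rule has_derivative_transform_within_open[of f f' x UNIV S g]) (use assms in auto)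
  show "(g has_derivative f') (at x) \<Longrightarrow> (f has_derivative f') (at x)"
    by (rule has_derivative_transform_within_open[of g f' x UNIV S f]) (use assms in auto)
qed

lemma differentiable_cong_open:
  assumes "open S" "x \<in> S" "\<And>z. z \<in> S \<Longrightarrow> f z = g z"
  shows "f differentiable (at x) \<longleftrightarrow> g differentiable (at x)"
  unfolding differentiable_def by (intro ex_cong1 has_derivative_cong_open[OF assms])

lemma deriv_at_cong_open:
  assumes "open S" "x \<in> S" "\<And>z. z \<in> S \<Longrightarrow> f z = g z"
  shows "deriv_at f x = deriv_at g x"
  unfolding frechet_derivative_def using has_derivative_cong_open[OF assms] by simp

lemma deriv_at_euclidean:
  fixes f :: "'a::euclidean_space \<Rightarrow> 'b::real_normed_vector"
  assumes "f differentiable (at x)"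
  shows "deriv_at f x a = (\<Sum>b\<in>Basis. (a \<bullet> b) *\<^sub>R deriv_at f x b)"
proof -
  interpret linear "deriv_at f x" by (rule linear_deriv_at[OF assms])
  show ?thesis by (subst (1) euclidean_representation[symmetric]) (simp add: sum scale)
qed

section \<open>Maps of class \<open>Ck_on\<close> for finite k\<close>

lemma Ck_on_cong:
  assumes "open S" "\<And>x. x \<in> S \<Longrightarrow> f x = g x"
  shows "Ck_on k S f \<longleftrightarrow> Ck_on k S g"
  using assms(2)
proof (induction k arbitrary: f g)
  case 0
  show ?case unfolding Ck_on.simps by (rule continuous_on_cong[OF refl 0])
next
  case (Suc k)
  have "Ck_on k S (\<lambda>x. deriv_at f x b) \<longleftrightarrow> Ck_on k S (\<lambda>x. deriv_at g x b)" for b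
    by (rule Suc.IH, rule fun_cong[OF deriv_at_cong_open[OF assms(1)]]) (use Suc.prems in auto)
  moreover have "(\<forall>x\<in>S. f differentiable (at x)) \<longleftrightarrow> (\<forall>x\<in>S. g differentiable (at x))"
    by (intro ball_cong refl differentiable_cong_open[OF assms(1)]) (use Suc.prems in auto)
  ultimately show ?case by simp
qed

lemma Ck_on_mono: "Ck_on k S f \<Longrightarrow> T \<subseteq> S \<Longrightarrow> Ck_on k T f"
  by (induction k arbitrary: f) (auto intro: continuous_on_subset)

lemma Ck_on_SucD: "Ck_on (Suc k) S f \<Longrightarrow> Ck_on k S f"
proof (induction k arbitrary: f)
  case 0
  then show ?case
    by (auto intro!: continuous_at_imp_continuous_on differentiable_imp_continuous_within)
next
  case (Suc k)
  then show ?case by (metis Ck_on.simps(2))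
qed

lemma Ck_on_local:
  assumes "\<And>x. x \<in> S \<Longrightarrow> \<exists>T. open T \<and> x \<in> T \<and> Ck_on k T f"
  shows "Ck_on k S f"
  using assms
proof (induction k arbitrary: f)
  case 0
  show ?case
    unfolding Ck_on.simps
  proof (rule continuous_at_imp_continuous_on, safe)
    fix x assume "x \<in> S"
    then obtain T where "open T" "x \<in> T" "continuous_on T f" using 0 by auto
    then show "isCont f x" by (simp add: continuous_on_eq_continuous_at)
  qed
next
  case (Suc k)
  show ?case
    unfolding Ck_on.simps
  proof safe
    fix x assume "x \<in> S"
    then show "f differentiable (at x)" using Suc.prems by fastforce
  next
    fix b :: 'a assume b: "b \<in> Basis"
    show "Ck_on k S (\<lambda>x. deriv_at f x b)"
    proof (rule Suc.IH)
      fix x assume "x \<in> S"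
      then obtain T where "open T" "x \<in> T" "Ck_on (Suc k) T f" using Suc.prems by blast
      then show "\<exists>T. open T \<and> x \<in> T \<and> Ck_on k T (\<lambda>x. deriv_at f x b)" using b by auto
    qed
  qed
qed

text \<open>On an open set the derivative is unique, so any explicitly computed \<open>f'\<close>
  may replace \<open>frechet_derivative\<close> in the recursive definition.\<close>

lemma Ck_on_SucI:
  assumes "open S" "\<And>x. x \<in> S \<Longrightarrow> (f has_derivative f' x) (at x)"
    and "\<And>b. b \<in> Basis \<Longrightarrow> Ck_on k S (\<lambda>x. f' x b)"
  shows "Ck_on (Suc k) S f"
  unfolding Ck_on.simps
proof safe
  fix b :: 'a assume "b \<in> Basis"
  then show "Ck_on k S (\<lambda>x. deriv_at f x b)"
    by (subst Ck_on_cong[OF assms(1), of _ "\<lambda>x. f' x b"])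
      (use assms(3) in \<open>auto simp: deriv_at_eqI[OF assms(2)]\<close>)
qed (use assms(2) differentiable_def in blast)

lemma Ck_on_SucE:
  assumes "Ck_on (Suc k) S f"
  shows "\<And>x. x \<in> S \<Longrightarrow> (f has_derivative deriv_at f x) (at x)"
    and "\<And>b. b \<in> Basis \<Longrightarrow> Ck_on k S (\<lambda>x. deriv_at f x b)"
  using assms has_deriv_at by auto

lemma Ck_on_const: "Ck_on k S (\<lambda>x. c)"
  by (induction k arbitrary: c) auto

lemma Ck_on_bounded_linear:
  assumes "bounded_linear L" "open S" "Ck_on k S f"
  shows "Ck_on k S (\<lambda>x. L (f x))"
  using assms(3)
proof (induction k arbitrary: f)
  case 0
  then show ?case
    using assms(1) by (auto intro: bounded_linear.continuous_on)
next
  case (Suc k)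
  show ?case
    by (rule Ck_on_SucI[OF assms(2) bounded_linear.has_derivative[OF assms(1)]])
      (use Ck_on_SucE[OF Suc.prems] Suc.IH in auto)
qed

lemma Ck_on_add:
  assumes "open S" "Ck_on k S f" "Ck_on k S g"
  shows "Ck_on k S (\<lambda>x. f x + g x)"
  using assms(2,3)
proof (induction k arbitrary: f g)
  case 0
  then show ?case by (auto intro: continuous_on_add)
next
  case (Suc k)
  show ?case
    by (rule Ck_on_SucI[OF assms(1) has_derivative_add])
      (use Ck_on_SucE[OF Suc.prems(1)] Ck_on_SucE[OF Suc.prems(2)] Suc.IH in auto)
qed

lemma Ck_on_sum:
  assumes "open S" "\<And>i. i \<in> I \<Longrightarrow> Ck_on k S (f i)"
  shows "Ck_on k S (\<lambda>x. \<Sum>i\<in>I. f i x)"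
  using assms(2)
proof (induction I rule: infinite_finite_induct)
  case (insert i I)
  then show ?case by (auto intro!: Ck_on_add assms(1))
qed (simp_all add: Ck_on_const)

lemma Ck_on_bilinear:
  fixes f :: "'a::euclidean_space \<Rightarrow> 'b::real_normed_vector"
  assumes "bounded_bilinear pr" "open S" "Ck_on k S f" "Ck_on k S g"
  shows "Ck_on k S (\<lambda>x. pr (f x) (g x))"
  using assms(3,4)
proof (induction k arbitrary: f g)
  case 0
  then show ?case using bounded_bilinear.continuous_on[OF assms(1)] by auto
next
  case (Suc k)
  show ?case
  proof (rule Ck_on_SucI[OF assms(2) bounded_bilinear.FDERIV[OF assms(1)]])
    fix b :: 'a assume "b \<in> Basis"
    then show "Ck_on k S (\<lambda>x. pr (f x) (deriv_at g x b) + pr (deriv_at f x b) (g x))"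
      using Ck_on_SucE[OF Suc.prems(1)] Ck_on_SucE[OF Suc.prems(2)] Suc.IH
        Ck_on_SucD[OF Suc.prems(1)] Ck_on_SucD[OF Suc.prems(2)]
      by (intro Ck_on_add assms(2)) auto
  qed (use Ck_on_SucE[OF Suc.prems(1)] Ck_on_SucE[OF Suc.prems(2)] in auto)
qed

lemma Ck_on_compose:
  fixes f :: "'a::euclidean_space \<Rightarrow> 'b::euclidean_space"
  assumes "open S" "open T" "f ` S \<subseteq> T" "Ck_on k S f" "Ck_on k T g"
  shows "Ck_on k S (\<lambda>x. g (f x))"
  using assms(4,5)
proof (induction k arbitrary: g)
  case 0
  then show ?case using assms(3) by (auto intro: continuous_on_compose2)
next
  case (Suc k)
  note f = Ck_on_SucE[OF Suc.prems(1)] and g = Ck_on_SucE[OF Suc.prems(2)]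
  \<comment> \<open>The chain rule is spelled out in the basis of the middle space: the induction
    hypothesis covers derivatives of \<open>g\<close> in fixed directions only, while the direction
    \<open>deriv_at f x h\<close> varies with \<open>x\<close>.\<close>
  have "((\<lambda>x. g (f x)) has_derivative
      (\<lambda>h. \<Sum>b\<in>Basis. (deriv_at f x h \<bullet> b) *\<^sub>R deriv_at g (f x) b)) (at x)"
    if "x \<in> S" for x
  proof -
    have gx: "(g has_derivative deriv_at g (f x)) (at (f x))"
      using g(1) assms(3) that by blast
    then have "g differentiable (at (f x))" using differentiable_def by blast
    then show ?thesis
      using has_derivative_compose[OF f(1)[OF that] gx] by (simp flip: deriv_at_euclidean)
  qed
  then show ?case
  proof (rule Ck_on_SucI[OF assms(1)])
    fix b :: 'a assume b: "b \<in> Basis"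
    show "Ck_on k S (\<lambda>x. \<Sum>i\<in>Basis. (deriv_at f x b \<bullet> i) *\<^sub>R deriv_at g (f x) i)"
    proof (intro Ck_on_sum Ck_on_bilinear[OF bounded_bilinear_scaleR] assms(1))
      fix i :: 'b assume i: "i \<in> Basis"
      show "Ck_on k S (\<lambda>x. deriv_at f x b \<bullet> i)"
        by (rule Ck_on_bounded_linear[OF bounded_linear_inner_left assms(1) f(2)[OF b]])
      show "Ck_on k S (\<lambda>x. deriv_at g (f x) i)"
        by (rule Suc.IH[OF Ck_on_SucD[OF Suc.prems(1)] g(2)[OF i]])
    qed
  qed
qed

section \<open>Smooth maps and their closure properties\<close>

lemma smooth_on_subset: "smooth_on S f \<Longrightarrow> T \<subseteq> S \<Longrightarrow> smooth_on T f"
  unfolding smooth_on_def using Ck_on_mono by blast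

lemma smooth_on_cong:
  assumes "open S" "\<And>x. x \<in> S \<Longrightarrow> f x = g x"
  shows "smooth_on S f \<longleftrightarrow> smooth_on S g"
  unfolding smooth_on_def by (intro all_cong1 Ck_on_cong[OF assms])

lemma smooth_on_local:
  assumes "\<And>x. x \<in> S \<Longrightarrow> \<exists>T. open T \<and> x \<in> T \<and> smooth_on T f"
  shows "smooth_on S f"
  unfolding smooth_on_def by (intro allI Ck_on_local) (use assms smooth_on_def in blast)

lemma smooth_on_differentiable: "smooth_on S f \<Longrightarrow> x \<in> S \<Longrightarrow> f differentiable (at x)"
  unfolding smooth_on_def using Ck_on.simps(2) by blast

lemma smooth_on_has_deriv:
  "smooth_on S f \<Longrightarrow> x \<in> S \<Longrightarrow> (f has_derivative deriv_at f x) (at x)"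
  by (rule has_deriv_at[OF smooth_on_differentiable])

lemma smooth_on_continuous: "smooth_on S f \<Longrightarrow> continuous_on S f"
  unfolding smooth_on_def by (metis Ck_on.simps(1))

lemma smooth_onI_deriv:
  assumes "open S" "\<And>x. x \<in> S \<Longrightarrow> (f has_derivative f' x) (at x)"
    and "\<And>b. b \<in> Basis \<Longrightarrow> smooth_on S (\<lambda>x. f' x b)"
  shows "smooth_on S f"
  unfolding smooth_on_def
proof
  fix k
  have "Ck_on (Suc k) S f"
    by (rule Ck_on_SucI[OF assms(1,2)]) (use assms(3) in \<open>auto simp: smooth_on_def\<close>)
  then show "Ck_on k S f" by (rule Ck_on_SucD)
qed

lemma smooth_on_const [simp]: "smooth_on S (\<lambda>x. c)"
  by (simp add: smooth_on_def Ck_on_const)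

lemma smooth_on_ident: "open S \<Longrightarrow> smooth_on S (\<lambda>x. x)"
  by (rule smooth_onI_deriv) (auto intro: derivative_intros)

lemma smooth_on_bounded_linear:
  "bounded_linear L \<Longrightarrow> open S \<Longrightarrow> smooth_on S f \<Longrightarrow> smooth_on S (\<lambda>x. L (f x))"
  by (simp add: smooth_on_def Ck_on_bounded_linear)

lemma smooth_on_bilinear:
  "bounded_bilinear pr \<Longrightarrow> open S \<Longrightarrow> smooth_on S f \<Longrightarrow> smooth_on S g \<Longrightarrow>
    smooth_on S (\<lambda>x. pr (f x) (g x))"
  by (simp add: smooth_on_def Ck_on_bilinear)

lemma smooth_on_compose:
  fixes f :: "'a::euclidean_space \<Rightarrow> 'b::euclidean_space"
  shows "open S \<Longrightarrow> open T \<Longrightarrow> f ` S \<subseteq> T \<Longrightarrow> smooth_on S f \<Longrightarrow> smooth_on T g \<Longrightarrow>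
    smooth_on S (\<lambda>x. g (f x))"
  unfolding smooth_on_def by (auto intro: Ck_on_compose)

lemma smooth_on_add: "open S \<Longrightarrow> smooth_on S f \<Longrightarrow> smooth_on S g \<Longrightarrow> smooth_on S (\<lambda>x. f x + g x)"
  by (simp add: smooth_on_def Ck_on_add)

lemma smooth_on_minus: "open S \<Longrightarrow> smooth_on S f \<Longrightarrow> smooth_on S (\<lambda>x. - f x)"
  by (rule smooth_on_bounded_linear) (auto intro: bounded_linear_minus bounded_linear_ident)

lemma smooth_on_diff: "open S \<Longrightarrow> smooth_on S f \<Longrightarrow> smooth_on S g \<Longrightarrow> smooth_on S (\<lambda>x. f x - g x)"
  using smooth_on_add[of S f "\<lambda>x. - g x"] smooth_on_minus by auto

lemma smooth_on_mult:
  fixes f g :: "'a::euclidean_space \<Rightarrow> real"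
  shows "open S \<Longrightarrow> smooth_on S f \<Longrightarrow> smooth_on S g \<Longrightarrow> smooth_on S (\<lambda>x. f x * g x)"
  by (rule smooth_on_bilinear[OF bounded_bilinear_mult])

lemma smooth_on_power:
  fixes f :: "'a::euclidean_space \<Rightarrow> real"
  shows "open S \<Longrightarrow> smooth_on S f \<Longrightarrow> smooth_on S (\<lambda>x. f x ^ n)"
  by (induction n) (auto intro: smooth_on_mult)

lemma smooth_on_scaleR:
  "open S \<Longrightarrow> smooth_on S f \<Longrightarrow> smooth_on S g \<Longrightarrow> smooth_on S (\<lambda>x. f x *\<^sub>R g x)"
  by (rule smooth_on_bilinear[OF bounded_bilinear_scaleR])

lemma smooth_on_sum:
  "open S \<Longrightarrow> (\<And>i. i \<in> I \<Longrightarrow> smooth_on S (f i)) \<Longrightarrow> smooth_on S (\<lambda>x. \<Sum>i\<in>I. f i x)"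
  by (simp add: smooth_on_def Ck_on_sum)

lemma smooth_on_fst: "open S \<Longrightarrow> smooth_on S f \<Longrightarrow> smooth_on S (\<lambda>x. fst (f x))"
  by (rule smooth_on_bounded_linear[OF bounded_linear_fst])

lemma smooth_on_snd: "open S \<Longrightarrow> smooth_on S f \<Longrightarrow> smooth_on S (\<lambda>x. snd (f x))"
  by (rule smooth_on_bounded_linear[OF bounded_linear_snd])

lemma smooth_on_inner_left: "open S \<Longrightarrow> smooth_on S f \<Longrightarrow> smooth_on S (\<lambda>x. f x \<bullet> b)"
  by (rule smooth_on_bounded_linear[OF bounded_linear_inner_left])

lemma smooth_on_Pair:
  assumes "open S" "smooth_on S f" "smooth_on S g"
  shows "smooth_on S (\<lambda>x. (f x, g x))"
proof -
  have "smooth_on S (\<lambda>x. (f x, 0) + (0, g x))"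
    by (intro smooth_on_add smooth_on_bounded_linear[of "\<lambda>z. (z, 0)"]
        smooth_on_bounded_linear[of "\<lambda>z. (0, z)"] assms
        bounded_linear_Pair bounded_linear_ident bounded_linear_zero)
  then show ?thesis by simp
qed

lemma smooth_on_deriv_at:
  assumes "open S" "smooth_on S f"
  shows "smooth_on S (\<lambda>x. deriv_at f x a)"
proof -
  have "smooth_on S (\<lambda>x. deriv_at f x b)" if "b \<in> Basis" for b
    unfolding smooth_on_def using assms(2) that Ck_on.simps(2) unfolding smooth_on_def by blast
  then have "smooth_on S (\<lambda>x. \<Sum>b\<in>Basis. (a \<bullet> b) *\<^sub>R deriv_at f x b)"
    by (intro smooth_on_sum smooth_on_scaleR assms(1)) auto
  then show ?thesis
    by (rule iffD1[OF smooth_on_cong[OF assms(1)], rotated])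
      (rule deriv_at_euclidean[symmetric], rule smooth_on_differentiable[OF assms(2)])
qed

text \<open>Bootstrapping: if the derivative is an expression in the function itself, each order of
  differentiability of \<open>h\<close> passes to \<open>h'\<close> and so raises the order of
  \<open>h\<close> by one.\<close>

lemma smooth_on_real_fun:
  fixes h :: "real \<Rightarrow> real"
  assumes "open T" "\<And>k. Ck_on k T h \<Longrightarrow> Ck_on k T h'"
    and "\<And>x. x \<in> T \<Longrightarrow> (h has_real_derivative h' x) (at x)"
  shows "smooth_on T h"
  unfolding smooth_on_def
proof
  fix k
  show "Ck_on k T h"
  proof (induction k)
    case 0
    then show ?case
      using assms(3) DERIV_isCont by (auto intro!: continuous_at_imp_continuous_on)
  next
    case (Suc k)
    show ?case
      by (rule Ck_on_SucI[OF assms(1), of h "\<lambda>x y. h' x * y"])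
        (use assms(2)[OF Suc] assms(3) in \<open>auto simp: has_field_derivative_def\<close>)
  qed
qed

lemma Ck_on_of_smooth: "smooth_on S f \<Longrightarrow> Ck_on k S f"
  by (simp add: smooth_on_def)

lemmas Ck_on_mult_real = Ck_on_bilinear[OF bounded_bilinear_mult]

lemma smooth_on_inverse_real: "smooth_on (- {0}) (inverse :: real \<Rightarrow> real)"
proof (rule smooth_on_real_fun)
  fix k assume k: "Ck_on k (- {0}) (inverse :: real \<Rightarrow> real)"
  show "Ck_on k (- {0}) (\<lambda>x::real. (-1) * (inverse x * inverse x))"
    by (intro Ck_on_mult_real Ck_on_const k) auto
qed (auto intro!: derivative_eq_intros simp: power2_eq_square)

lemma smooth_on_inverse:
  fixes f :: "'a::euclidean_space \<Rightarrow> real"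
  assumes "open S" "smooth_on S f" "\<And>x. x \<in> S \<Longrightarrow> f x \<noteq> 0"
  shows "smooth_on S (\<lambda>x. inverse (f x))"
  by (rule smooth_on_compose[OF assms(1) _ _ assms(2) smooth_on_inverse_real]) (use assms in auto)

lemma smooth_on_divide:
  fixes f g :: "'a::euclidean_space \<Rightarrow> real"
  assumes "open S" "smooth_on S f" "smooth_on S g" "\<And>x. x \<in> S \<Longrightarrow> g x \<noteq> 0"
  shows "smooth_on S (\<lambda>x. f x / g x)"
  unfolding divide_inverse by (intro smooth_on_mult smooth_on_inverse assms)

lemma smooth_on_sqrt_real: "smooth_on {0<..} sqrt"
proof (rule smooth_on_real_fun)
  fix k assume k: "Ck_on k {0<..} sqrt"
  show "Ck_on k {0<..} (\<lambda>x. (1/2) * inverse (sqrt x))"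
    by (intro Ck_on_mult_real Ck_on_const Ck_on_compose[of _ "- {0}", OF _ _ _ k]
        Ck_on_of_smooth[OF smooth_on_inverse_real]) auto
qed (auto intro!: derivative_eq_intros)

lemma smooth_on_sqrt:
  fixes f :: "'a::euclidean_space \<Rightarrow> real"
  assumes "open S" "smooth_on S f" "\<And>x. x \<in> S \<Longrightarrow> f x > 0"
  shows "smooth_on S (\<lambda>x. sqrt (f x))"
  by (rule smooth_on_compose[OF assms(1) _ _ assms(2) smooth_on_sqrt_real]) (use assms in auto)

lemma smooth_on_sin_cos_real: "smooth_on UNIV (sin :: real \<Rightarrow> real)" "smooth_on UNIV (cos :: real \<Rightarrow> real)"
proof -
  have "Ck_on k UNIV (sin :: real \<Rightarrow> real) \<and> Ck_on k UNIV (cos :: real \<Rightarrow> real)" for k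
  proof (induction k)
    case 0
    then show ?case by (auto intro: continuous_intros)
  next
    case (Suc k)
    have "Ck_on (Suc k) UNIV (sin :: real \<Rightarrow> real)"
      by (rule Ck_on_SucI[of _ _ "\<lambda>x h. cos x * h"])
        (use Suc in \<open>auto intro!: derivative_eq_intros\<close>)
    moreover have "Ck_on k UNIV (\<lambda>x::real. - sin x)"
      by (rule Ck_on_bounded_linear[of uminus])
        (use Suc in \<open>auto intro: bounded_linear_minus bounded_linear_ident\<close>)
    then have "Ck_on (Suc k) UNIV (cos :: real \<Rightarrow> real)"
      by (intro Ck_on_SucI[of _ _ "\<lambda>x h. - sin x * h"]) (auto intro!: derivative_eq_intros)
    ultimately show ?case by blast
  qed
  then show "smooth_on UNIV (sin :: real \<Rightarrow> real)" "smooth_on UNIV (cos :: real \<Rightarrow> real)"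
    by (auto simp: smooth_on_def)
qed

lemma smooth_on_sin:
  fixes f :: "'a::euclidean_space \<Rightarrow> real"
  shows "open S \<Longrightarrow> smooth_on S f \<Longrightarrow> smooth_on S (\<lambda>x. sin (f x))"
  by (rule smooth_on_compose[OF _ open_UNIV _ _ smooth_on_sin_cos_real(1)]) auto

lemma smooth_on_cos:
  fixes f :: "'a::euclidean_space \<Rightarrow> real"
  shows "open S \<Longrightarrow> smooth_on S f \<Longrightarrow> smooth_on S (\<lambda>x. cos (f x))"
  by (rule smooth_on_compose[OF _ open_UNIV _ _ smooth_on_sin_cos_real(2)]) auto

lemma smooth_on_arcsin:
  fixes f :: "'a::euclidean_space \<Rightarrow> real"
  assumes "open S" "smooth_on S f" "\<And>x. x \<in> S \<Longrightarrow> \<bar>f x\<bar> < 1"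
  shows "smooth_on S (\<lambda>x. arcsin (f x))"
proof -
  have "smooth_on {-1<..<1} arcsin"
  proof (rule smooth_on_real_fun)
    show "Ck_on k {-1<..<1} (\<lambda>x. inverse (sqrt (1 - x\<^sup>2)))" for k
      by (intro Ck_on_of_smooth smooth_on_inverse smooth_on_sqrt smooth_on_diff smooth_on_power
          smooth_on_ident) (auto simp: abs_square_less_1 abs_less_iff power2_eq_1_iff)
  qed (auto intro!: derivative_eq_intros)
  from smooth_on_compose[OF assms(1) _ _ assms(2) this] show ?thesis
    using assms(3) by (fastforce simp: abs_less_iff)
qed

lemmas smooth_intros = smooth_on_const smooth_on_add smooth_on_minus smooth_on_diff smooth_on_mult
  smooth_on_power smooth_on_scaleR smooth_on_sum smooth_on_fst smooth_on_snd smooth_on_inner_left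
  smooth_on_Pair smooth_on_inverse smooth_on_divide smooth_on_sqrt smooth_on_sin smooth_on_cos
  smooth_on_arcsin smooth_on_deriv_at

section \<open>Symmetry of second derivatives\<close>

lemma has_vector_derivative_along:
  assumes "f differentiable (at (y + s *\<^sub>R a))"
  shows "((\<lambda>s. f (y + s *\<^sub>R a)) has_vector_derivative deriv_at f (y + s *\<^sub>R a) a) (at s)"
proof -
  have "((\<lambda>s. y + s *\<^sub>R a) has_derivative (\<lambda>t. t *\<^sub>R a)) (at s)"
    by (auto intro!: derivative_eq_intros)
  from has_derivative_compose[OF this has_deriv_at[OF assms]] show ?thesis
    using linear_deriv_at[OF assms] by (simp add: has_vector_derivative_def linear_cmul)
qed

text \<open>The mean value theorem is applied twice, first along \<open>a\<close> to the increment
  in direction \<open>b\<close>, then along \<open>b\<close> to the derivative in direction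
  \<open>a\<close>. The left-hand side is symmetric in \<open>a\<close> and \<open>b\<close>, the
  order of differentiation on the right is not.\<close>

lemma second_difference:
  fixes f :: "'a::euclidean_space \<Rightarrow> real"
  assumes "open S" "smooth_on S f" "h > 0"
    and S: "\<And>s t. 0 \<le> s \<Longrightarrow> s \<le> h \<Longrightarrow> 0 \<le> t \<Longrightarrow> t \<le> h \<Longrightarrow> x + s *\<^sub>R a + t *\<^sub>R b \<in> S"
  shows "\<exists>s t. 0 < s \<and> s < h \<and> 0 < t \<and> t < h \<and>
    f (x + h *\<^sub>R a + h *\<^sub>R b) - f (x + h *\<^sub>R a) - f (x + h *\<^sub>R b) + f x =
    h * (h * deriv_at (\<lambda>z. deriv_at f z a) (x + s *\<^sub>R a + t *\<^sub>R b) b)"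
proof -
  have d: "f differentiable (at z)" "(\<lambda>z. deriv_at f z a) differentiable (at z)" if "z \<in> S" for z
    using assms(1,2) that by (auto intro!: smooth_on_differentiable[of S] smooth_on_deriv_at)
  define G where "G s = f (x + h *\<^sub>R b + s *\<^sub>R a) - f (x + s *\<^sub>R a)" for s
  have "DERIV G s :> deriv_at f (x + h *\<^sub>R b + s *\<^sub>R a) a - deriv_at f (x + s *\<^sub>R a) a"
    if "0 \<le> s" "s \<le> h" for s
    unfolding G_def has_real_derivative_iff_has_vector_derivative
    using S[of s h] S[of s 0] that \<open>h > 0\<close>
    by (intro has_vector_derivative_diff has_vector_derivative_along d) (auto simp: add_ac)
  from MVT2[OF \<open>h > 0\<close> this] obtain s where s: "0 < s" "s < h" and
    Gs: "G h - G 0 = h * (deriv_at f (x + h *\<^sub>R b + s *\<^sub>R a) a - deriv_at f (x + s *\<^sub>R a) a)"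
    by auto
  have "DERIV (\<lambda>t. deriv_at f (x + s *\<^sub>R a + t *\<^sub>R b) a) t :>
      deriv_at (\<lambda>z. deriv_at f z a) (x + s *\<^sub>R a + t *\<^sub>R b) b" if "0 \<le> t" "t \<le> h" for t
    unfolding has_real_derivative_iff_has_vector_derivative
    using S[of s t] s that
    by (intro has_vector_derivative_along[of "\<lambda>z. deriv_at f z a"] d) auto
  from MVT2[OF \<open>h > 0\<close> this] obtain t where t: "0 < t" "t < h" and
    "deriv_at f (x + s *\<^sub>R a + h *\<^sub>R b) a - deriv_at f (x + s *\<^sub>R a) a =
      h * deriv_at (\<lambda>z. deriv_at f z a) (x + s *\<^sub>R a + t *\<^sub>R b) b"
    by auto
  with Gs s t show ?thesis
    by (intro exI[of _ s] exI[of _ t]) (auto simp: G_def add_ac)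
qed

text \<open>Both mixed derivatives express the same second difference, so arbitrarily close to
  \<open>x\<close> they share a value, taken at possibly different points; continuity at
  \<open>x\<close> then excludes a gap.\<close>

lemma second_deriv_symmetric_real:
  fixes f :: "'a::euclidean_space \<Rightarrow> real"
  assumes "open S" "smooth_on S f" "x \<in> S"
  shows "deriv_at (\<lambda>z. deriv_at f z a) x b = deriv_at (\<lambda>z. deriv_at f z b) x a" (is "?P x = ?Q x")
proof (rule ccontr)
  assume ne: "?P x \<noteq> ?Q x"
  define e where "e = \<bar>?P x - ?Q x\<bar> / 2"
  have "e > 0" using ne by (simp add: e_def)
  have "smooth_on S ?P" "smooth_on S ?Q" by (intro smooth_on_deriv_at assms(1,2))+
  then have "isCont ?P x" "isCont ?Q x"
    using assms(1,3) by (auto dest!: smooth_on_continuous simp: continuous_on_eq_continuous_at)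
  then have "\<exists>d>0. \<forall>z. dist z x < d \<longrightarrow> dist (?P z) (?P x) < e" "\<exists>d>0. \<forall>z. dist z x < d \<longrightarrow> dist (?Q z) (?Q x) < e"
    unfolding continuous_at_eps_delta using \<open>e > 0\<close> by blast+
  then obtain d1 d2 where d: "d1 > 0" "d2 > 0"
    "\<And>z. dist z x < d1 \<Longrightarrow> dist (?P z) (?P x) < e" "\<And>z. dist z x < d2 \<Longrightarrow> dist (?Q z) (?Q x) < e"
    by blast
  obtain d3 where d3: "d3 > 0" "ball x d3 \<subseteq> S" using assms(1,3) openE by blast
  define r where "r = min d1 (min d2 d3)"
  \<comment> \<open>The scale keeps the whole parallelogram spanned by \<open>h a\<close> and
    \<open>h b\<close> within distance r / 2 of \<open>x\<close>; the summand 1 covers the case that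
    both vectors vanish.\<close>
  define h where "h = r / 2 / (1 + norm a + norm b)"
  have pos: "1 + norm a + norm b > 0" "1 + norm a + norm b \<noteq> 0"
    using norm_ge_zero[of a] norm_ge_zero[of b] by linarith+
  have "r > 0" "h > 0" using d d3 pos by (auto simp: r_def h_def)
  have near: "dist (x + s *\<^sub>R a + t *\<^sub>R b) x < r" if "0 \<le> s" "s \<le> h" "0 \<le> t" "t \<le> h" for s t
  proof -
    have "dist (x + s *\<^sub>R a + t *\<^sub>R b) x = norm (s *\<^sub>R a + t *\<^sub>R b)"
      by (simp add: dist_norm add.assoc)
    also have "\<dots> \<le> s * norm a + t * norm b"
      using norm_triangle_ineq[of "s *\<^sub>R a" "t *\<^sub>R b"] that by simp
    also have "\<dots> \<le> h * norm a + h * norm b"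
      using that by (intro add_mono mult_right_mono) auto
    also have "\<dots> \<le> h * (1 + norm a + norm b)" using \<open>h > 0\<close> by (simp add: algebra_simps)
    also have "\<dots> = r / 2" unfolding h_def by (rule nonzero_eq_divide_eq[OF pos(2), THEN iffD1]) (rule refl)
    finally show ?thesis using \<open>r > 0\<close> by simp
  qed
  have "x + s *\<^sub>R a + t *\<^sub>R b \<in> S" "x + s *\<^sub>R b + t *\<^sub>R a \<in> S"
    if "0 \<le> s" "s \<le> h" "0 \<le> t" "t \<le> h" for s t
    using near[of s t] near[of t s] that d3(2) by (auto simp: r_def dist_commute add_ac subset_eq)
  then obtain s t s' t' where st: "0 < s" "s < h" "0 < t" "t < h" "0 < s'" "s' < h" "0 < t'" "t' < h"
    and eq1: "f (x + h *\<^sub>R a + h *\<^sub>R b) - f (x + h *\<^sub>R a) - f (x + h *\<^sub>R b) + f x =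
      h * (h * ?P (x + s *\<^sub>R a + t *\<^sub>R b))"
    and eq2: "f (x + h *\<^sub>R b + h *\<^sub>R a) - f (x + h *\<^sub>R b) - f (x + h *\<^sub>R a) + f x =
      h * (h * ?Q (x + s' *\<^sub>R b + t' *\<^sub>R a))"
    using second_difference[OF assms(1,2) \<open>h > 0\<close>, of x a b]
      second_difference[OF assms(1,2) \<open>h > 0\<close>, of x b a] by blast
  have "h * (h * ?P (x + s *\<^sub>R a + t *\<^sub>R b)) = h * (h * ?Q (x + s' *\<^sub>R b + t' *\<^sub>R a))"
    unfolding eq1[symmetric] eq2[symmetric] by (simp add: add_ac)
  then have "?P (x + s *\<^sub>R a + t *\<^sub>R b) = ?Q (x + s' *\<^sub>R b + t' *\<^sub>R a)"
    using \<open>h > 0\<close> by simp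
  moreover have "dist (?P (x + s *\<^sub>R a + t *\<^sub>R b)) (?P x) < e"
    using near[of s t] st by (intro d) (auto simp: r_def)
  moreover have "dist (?Q (x + s' *\<^sub>R b + t' *\<^sub>R a)) (?Q x) < e"
    using near[of t' s'] st by (intro d) (auto simp: r_def add_ac)
  ultimately show False by (simp add: e_def dist_real_def abs_if split: if_splits)
qed

lemma deriv_at_inner_left:
  "f differentiable (at x) \<Longrightarrow> deriv_at (\<lambda>z. f z \<bullet> c) x h = deriv_at f x h \<bullet> c"
  by (subst deriv_at_eqI[OF bounded_linear.has_derivative[OF bounded_linear_inner_left has_deriv_at]]) auto

lemma second_deriv_symmetric:
  fixes f :: "'a::euclidean_space \<Rightarrow> 'b::euclidean_space"
  assumes "open S" "smooth_on S f" "x \<in> S"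
  shows "deriv_at (\<lambda>z. deriv_at f z a) x b = deriv_at (\<lambda>z. deriv_at f z b) x a"
proof (rule euclidean_eqI)
  fix c :: 'b assume "c \<in> Basis"
  have *: "deriv_at (\<lambda>z. deriv_at f z a) x b \<bullet> c = deriv_at (\<lambda>z. deriv_at (\<lambda>z. f z \<bullet> c) z a) x b" for a b
  proof -
    have "deriv_at (\<lambda>z. deriv_at f z a) x b \<bullet> c = deriv_at (\<lambda>z. deriv_at f z a \<bullet> c) x b"
      by (rule deriv_at_inner_left[symmetric])
        (rule smooth_on_differentiable[OF smooth_on_deriv_at[OF assms(1,2)] assms(3)])
    also have "\<dots> = deriv_at (\<lambda>z. deriv_at (\<lambda>z. f z \<bullet> c) z a) x b"
      by (rule fun_cong[OF deriv_at_cong_open[OF assms(1,3)]])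
        (simp add: deriv_at_inner_left smooth_on_differentiable[OF assms(2)])
    finally show ?thesis .
  qed
  show "deriv_at (\<lambda>z. deriv_at f z a) x b \<bullet> c = deriv_at (\<lambda>z. deriv_at f z b) x a \<bullet> c"
    unfolding * by (rule second_deriv_symmetric_real[OF assms(1) _ assms(3)])
      (intro smooth_on_inner_left assms)
qed

section \<open>Fields of bilinear maps\<close>

lemma bilinear_expand:
  fixes B :: "'a::euclidean_space \<Rightarrow> 'b::euclidean_space \<Rightarrow> 'c::real_vector"
  assumes "bilinear B"
  shows "B u v = (\<Sum>i\<in>Basis. \<Sum>j\<in>Basis. ((u \<bullet> i) * (v \<bullet> j)) *\<^sub>R B i j)"
proof -
  have l: "linear (B z)" and r: "linear (\<lambda>z. B z w)" for z w
    using assms by (auto simp: bilinear_def)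
  have "B u v = B (\<Sum>i\<in>Basis. (u \<bullet> i) *\<^sub>R i) v" by (simp add: euclidean_representation)
  also have "\<dots> = (\<Sum>i\<in>Basis. (u \<bullet> i) *\<^sub>R B i v)"
    by (simp add: linear_sum[OF r] linear_cmul[OF r])
  also have "\<dots> = (\<Sum>i\<in>Basis. (u \<bullet> i) *\<^sub>R (\<Sum>j\<in>Basis. (v \<bullet> j) *\<^sub>R B i j))"
    by (subst euclidean_representation[of v, symmetric], subst linear_sum[OF l])
      (simp add: linear_cmul[OF l])
  finally show ?thesis by (simp add: scaleR_sum_right)
qed

text \<open>A product rule in which the first term differentiates the field with frozen arguments.
  Expansion in the two bases reduces it to the finitely many coefficient functions
  \<open>\<lambda>z. B z i j\<close>, which are all that is assumed differentiable.\<close>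

lemma has_derivative_bilinear_field:
  fixes B :: "'x::real_normed_vector \<Rightarrow> 'a::euclidean_space \<Rightarrow> 'b::euclidean_space \<Rightarrow> 'c::real_normed_vector"
  assumes "open S" "x \<in> S" and B: "\<And>z. z \<in> S \<Longrightarrow> bilinear (B z)"
    and dB: "\<And>i j. (\<lambda>z. B z i j) differentiable (at x)"
    and u: "(u has_derivative u') (at x)" and v: "(v has_derivative v') (at x)"
  shows "((\<lambda>z. B z (u z) (v z)) has_derivative
    (\<lambda>h. deriv_at (\<lambda>z. B z (u x) (v x)) x h + B x (u' h) (v x) + B x (u x) (v' h))) (at x)"
proof -
  have *: "((\<lambda>z. B z (u z) (v z)) has_derivative
    (\<lambda>h. (\<Sum>i\<in>Basis. \<Sum>j\<in>Basis. ((u x \<bullet> i) * (v x \<bullet> j)) *\<^sub>R deriv_at (\<lambda>z. B z i j) x h)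
      + B x (u' h) (v x) + B x (u x) (v' h))) (at x)"
    if u: "(u has_derivative u') (at x)" and v: "(v has_derivative v') (at x)" for u u' v v'
  proof -
    have "((\<lambda>z. \<Sum>i\<in>Basis. \<Sum>j\<in>Basis. ((u z \<bullet> i) * (v z \<bullet> j)) *\<^sub>R B z i j) has_derivative
      (\<lambda>h. \<Sum>i\<in>Basis. \<Sum>j\<in>Basis. ((u x \<bullet> i) * (v x \<bullet> j)) *\<^sub>R deriv_at (\<lambda>z. B z i j) x h
        + ((u x \<bullet> i) * (v' h \<bullet> j) + (u' h \<bullet> i) * (v x \<bullet> j)) *\<^sub>R B x i j)) (at x)"
      by (intro has_derivative_sum has_derivative_scaleR has_derivative_mult
          has_derivative_inner_left u v has_deriv_at dB)
    moreover have "(\<Sum>i\<in>Basis. \<Sum>j\<in>Basis. ((u x \<bullet> i) * (v x \<bullet> j)) *\<^sub>R deriv_at (\<lambda>z. B z i j) x h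
        + ((u x \<bullet> i) * (v' h \<bullet> j) + (u' h \<bullet> i) * (v x \<bullet> j)) *\<^sub>R B x i j) =
      (\<Sum>i\<in>Basis. \<Sum>j\<in>Basis. ((u x \<bullet> i) * (v x \<bullet> j)) *\<^sub>R deriv_at (\<lambda>z. B z i j) x h)
      + B x (u' h) (v x) + B x (u x) (v' h)" for h
      unfolding bilinear_expand[OF B[OF \<open>x \<in> S\<close>], of "u' h"] bilinear_expand[OF B[OF \<open>x \<in> S\<close>], of "u x"]
      by (simp add: sum.distrib scaleR_add_left)
    ultimately have "((\<lambda>z. \<Sum>i\<in>Basis. \<Sum>j\<in>Basis. ((u z \<bullet> i) * (v z \<bullet> j)) *\<^sub>R B z i j) has_derivative
      (\<lambda>h. (\<Sum>i\<in>Basis. \<Sum>j\<in>Basis. ((u x \<bullet> i) * (v x \<bullet> j)) *\<^sub>R deriv_at (\<lambda>z. B z i j) x h)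
      + B x (u' h) (v x) + B x (u x) (v' h))) (at x)"
      by simp
    then show ?thesis
      by (rule iffD1[OF has_derivative_cong_open[OF assms(1,2)], rotated])
        (simp add: bilinear_expand[OF B])
  qed
  have zero: "B x 0 w = 0" "B x w' 0 = 0" for w w'
    using B[OF \<open>x \<in> S\<close>] by (auto simp: bilinear_lzero bilinear_rzero)
  \<comment> \<open>For constant arguments the formula just proved identifies the double sum as the
    derivative of the field with frozen arguments.\<close>
  from *[OF has_derivative_const has_derivative_const, of "u x" "v x"]
  have "deriv_at (\<lambda>z. B z (u x) (v x)) x =
    (\<lambda>h. \<Sum>i\<in>Basis. \<Sum>j\<in>Basis. ((u x \<bullet> i) * (v x \<bullet> j)) *\<^sub>R deriv_at (\<lambda>z. B z i j) x h)"
    by (intro deriv_at_eqI) (simp add: zero)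
  with *[OF u v] show ?thesis by simp
qed

lemma smooth_on_bilinear_field:
  fixes B :: "'x::euclidean_space \<Rightarrow> 'a::euclidean_space \<Rightarrow> 'b::euclidean_space \<Rightarrow> 'c::real_normed_vector"
  assumes "open S" and B: "\<And>z. z \<in> S \<Longrightarrow> bilinear (B z)"
    and dB: "\<And>i j. smooth_on S (\<lambda>z. B z i j)"
    and u: "smooth_on S u" and v: "smooth_on S v"
  shows "smooth_on S (\<lambda>z. B z (u z) (v z))"
proof -
  have "smooth_on S (\<lambda>z. \<Sum>i\<in>Basis. \<Sum>j\<in>Basis. ((u z \<bullet> i) * (v z \<bullet> j)) *\<^sub>R B z i j)"
    by (intro smooth_intros dB u v assms(1))
  then show ?thesis
    by (rule iffD1[OF smooth_on_cong[OF assms(1)], rotated]) (simp add: bilinear_expand[OF B])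
qed

section \<open>The Koszul formula\<close>

text \<open>The covector that \<open>christoffel\<close> turns into a vector by means of the metric.
  Identities are proved for it first, where no definite description is involved.\<close>

definition koszul :: "'a::euclidean_space metric_field \<Rightarrow> 'a \<Rightarrow> 'a \<Rightarrow> 'a \<Rightarrow> 'a \<Rightarrow> real" where
  "koszul g x a b w =
     (deriv_at (\<lambda>z. g z b w) x a + deriv_at (\<lambda>z. g z a w) x b - deriv_at (\<lambda>z. g z a b) x w) / 2"

lemma christoffel_eqI:
  assumes "bilinear (g x)" "\<And>a. a \<noteq> 0 \<Longrightarrow> g x a a \<noteq> 0" "\<And>w. g x c w = koszul g x a b w"
  shows "christoffel g x a b = c"
  unfolding christoffel_def koszul_def[symmetric]
proof (rule the_equality)
  fix c' assume c': "\<forall>w. g x c' w = koszul g x a b w"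
  then have "g x (c' - c) (c' - c) = 0"
    using assms(1,3) by (simp add: bilinear_lsub)
  then show "c' = c" using assms(2)[of "c' - c"] by auto
qed (use assms(3) in blast)

lemma koszul_cong_open:
  assumes "open S" "x \<in> S" "\<And>z a b. z \<in> S \<Longrightarrow> g z a b = g' z a b"
  shows "koszul g x a b w = koszul g' x a b w"
proof -
  have "deriv_at (\<lambda>z. g z a b) x = deriv_at (\<lambda>z. g' z a b) x" for a b
    by (rule deriv_at_cong_open[OF assms(1,2)]) (use assms(3) in auto)
  then show ?thesis unfolding koszul_def by simp
qed

text \<open>The transformation law of the Christoffel symbols, in covector form. The product rule
  yields six terms with second derivatives of \<open>\<tau>\<close>; by the symmetry of these and of
  \<open>H\<close>, four cancel and two agree.\<close>

lemma koszul_pullback: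
  fixes \<tau> :: "'a::euclidean_space \<Rightarrow> 'b::euclidean_space"
  assumes W: "open W" "smooth_on W \<tau>" "x \<in> W" and T: "open T" "\<tau> ` W \<subseteq> T"
    and H: "\<And>z. z \<in> T \<Longrightarrow> bilinear (H z)" "\<And>z a b. z \<in> T \<Longrightarrow> H z a b = H z b a"
    and dH: "\<And>a b. (\<lambda>z. H z a b) differentiable (at (\<tau> x))"
  shows "koszul (pullback_metric \<tau> H) x a b w =
    H (\<tau> x) (deriv_at (\<lambda>z. deriv_at \<tau> z b) x a) (deriv_at \<tau> x w)
    + koszul H (\<tau> x) (deriv_at \<tau> x a) (deriv_at \<tau> x b) (deriv_at \<tau> x w)"
proof -
  have Tx: "\<tau> x \<in> T" using W T by auto
  have chain: "((\<lambda>z. H (\<tau> z) i j) has_derivative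
      (\<lambda>h. deriv_at (\<lambda>z. H z i j) (\<tau> x) (deriv_at \<tau> x h))) (at x)" for i j
    by (rule has_derivative_compose[OF smooth_on_has_deriv[OF W(2,3)] has_deriv_at[OF dH]])
  have d: "((\<lambda>z. deriv_at \<tau> z b) has_derivative deriv_at (\<lambda>z. deriv_at \<tau> z b) x) (at x)" for b
    by (rule smooth_on_has_deriv[OF smooth_on_deriv_at[OF W(1,2)] W(3)])
  have *: "deriv_at (\<lambda>z. pullback_metric \<tau> H z b c) x h =
      deriv_at (\<lambda>z. H z (deriv_at \<tau> x b) (deriv_at \<tau> x c)) (\<tau> x) (deriv_at \<tau> x h)
      + H (\<tau> x) (deriv_at (\<lambda>z. deriv_at \<tau> z b) x h) (deriv_at \<tau> x c)
      + H (\<tau> x) (deriv_at \<tau> x b) (deriv_at (\<lambda>z. deriv_at \<tau> z c) x h)" for b c h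
  proof -
    have "((\<lambda>z. H (\<tau> z) (deriv_at \<tau> z b) (deriv_at \<tau> z c)) has_derivative
      (\<lambda>h. deriv_at (\<lambda>z. H (\<tau> z) (deriv_at \<tau> x b) (deriv_at \<tau> x c)) x h
      + H (\<tau> x) (deriv_at (\<lambda>z. deriv_at \<tau> z b) x h) (deriv_at \<tau> x c)
      + H (\<tau> x) (deriv_at \<tau> x b) (deriv_at (\<lambda>z. deriv_at \<tau> z c) x h))) (at x)"
      by (rule has_derivative_bilinear_field[OF W(1,3), of "\<lambda>z. H (\<tau> z)", OF _ _ d d])
        (use H T differentiableI[OF chain] in auto)
    from deriv_at_eqI[OF this] show ?thesis
      unfolding pullback_metric_def by (simp add: deriv_at_eqI[OF chain])
  qed
  have sym: "deriv_at (\<lambda>z. deriv_at \<tau> z u) x v = deriv_at (\<lambda>z. deriv_at \<tau> z v) x u" for u v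
    by (rule second_deriv_symmetric[OF W])
  show ?thesis
    unfolding koszul_def * sym[of b a] sym[of w] using H(2)[OF Tx]
    by (simp add: field_simps)
qed

section \<open>Orthonormal frames on plane domains\<close>

text \<open>Total geodesy is kept out of the assumptions, so that the same frame calculus serves the
  unknown field, its restrictions to smaller domains and the explicit field of the normal
  form.\<close>

locale orthonormal_frame =
  fixes S :: "plane set" and g :: "plane metric_field" and \<xi> \<zeta> :: "plane \<Rightarrow> plane"
  assumes open_S: "open S" and metric: "riemannian_metric_on S g"
    and smooth_\<xi>: "smooth_on S \<xi>" and smooth_\<zeta>: "smooth_on S \<zeta>"
    and g_\<xi>\<xi>: "x \<in> S \<Longrightarrow> g x (\<xi> x) (\<xi> x) = 1"
    and g_\<zeta>\<zeta>: "x \<in> S \<Longrightarrow> g x (\<zeta> x) (\<zeta> x) = 1"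
    and g_\<xi>\<zeta>: "x \<in> S \<Longrightarrow> g x (\<xi> x) (\<zeta> x) = 0"
begin

lemma smooth_g: "smooth_on S (\<lambda>x. g x a b)"
  using metric unfolding riemannian_metric_on_def by blast

lemma bilinear_g: "x \<in> S \<Longrightarrow> bilinear (g x)"
  and g_sym: "x \<in> S \<Longrightarrow> g x a b = g x b a"
  and g_pos: "x \<in> S \<Longrightarrow> a \<noteq> 0 \<Longrightarrow> g x a a > 0"
  using metric unfolding riemannian_metric_on_def by blast+

lemma linear_g: "x \<in> S \<Longrightarrow> linear (g x a)" "x \<in> S \<Longrightarrow> linear (\<lambda>a. g x a b)"
  using bilinear_g unfolding bilinear_def by blast+

lemma g_simps:
  assumes "x \<in> S"
  shows "g x (a + b) c = g x a c + g x b c" "g x c (a + b) = g x c a + g x c b"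
    "g x (a - b) c = g x a c - g x b c" "g x c (a - b) = g x c a - g x c b"
    "g x (- a) c = - g x a c" "g x c (- a) = - g x c a"
    "g x (r *\<^sub>R a) c = r * g x a c" "g x c (r *\<^sub>R a) = r * g x c a"
    "g x 0 c = 0" "g x c 0 = 0"
  using linear_add[OF linear_g(1)[OF assms]] linear_add[OF linear_g(2)[OF assms]]
    linear_diff[OF linear_g(1)[OF assms]] linear_diff[OF linear_g(2)[OF assms]]
    linear_neg[OF linear_g(1)[OF assms]] linear_neg[OF linear_g(2)[OF assms]]
    linear_cmul[OF linear_g(1)[OF assms]] linear_cmul[OF linear_g(2)[OF assms]]
    linear_0[OF linear_g(1)[OF assms]] linear_0[OF linear_g(2)[OF assms]]
  by simp_all

lemma g_\<zeta>\<xi>: "x \<in> S \<Longrightarrow> g x (\<zeta> x) (\<xi> x) = 0"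
  using g_\<xi>\<zeta> g_sym by metis

lemmas frame_simps = g_\<xi>\<xi> g_\<zeta>\<zeta> g_\<xi>\<zeta> g_\<zeta>\<xi>

lemma frame_expand:
  assumes x: "x \<in> S"
  shows "v = g x v (\<xi> x) *\<^sub>R \<xi> x + g x v (\<zeta> x) *\<^sub>R \<zeta> x"
proof -
  have ne: "\<xi> x \<noteq> \<zeta> x" using frame_simps[OF x] by (metis zero_neq_one)
  have nz: "\<xi> x \<noteq> 0" "\<zeta> x \<noteq> 0" using frame_simps[OF x] g_simps(9)[OF x] by (metis zero_neq_one)+
  have "independent {\<xi> x, \<zeta> x}"
  proof (rule ccontr)
    assume "\<not> independent {\<xi> x, \<zeta> x}"
    then have "\<xi> x \<in> span {\<zeta> x}" using ne nz by (simp add: independent_insert)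
    then obtain k where "\<xi> x = k *\<^sub>R \<zeta> x" by (auto simp: span_singleton)
    then have "g x (\<xi> x) (\<xi> x) = k * g x (\<zeta> x) (\<xi> x)" by (metis g_simps(7)[OF x])
    then show False using frame_simps[OF x] by simp
  qed
  then have "dim {\<xi> x, \<zeta> x} = DIM(plane)"
    using ne by (simp add: dim_eq_card_independent)
  then have "span {\<xi> x, \<zeta> x} = UNIV"
    by (simp only: dim_eq_full)
  then have "v \<in> span {\<xi> x, \<zeta> x}" by simp
  then obtain k l where "v = k *\<^sub>R \<xi> x + l *\<^sub>R \<zeta> x"
    by (auto simp: span_insert span_singleton algebra_simps)
  then show ?thesis by (simp add: g_simps[OF x] frame_simps[OF x])
qed

lemma g_eqI:
  assumes x: "x \<in> S" and "g x a (\<xi> x) = g x b (\<xi> x)" "g x a (\<zeta> x) = g x b (\<zeta> x)"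
  shows "a = b"
  by (subst frame_expand[OF x, of a], subst frame_expand[OF x, of b]) (simp add: assms)

lemma g_expand:
  assumes x: "x \<in> S"
  shows "g x a b = g x a (\<xi> x) * g x b (\<xi> x) + g x a (\<zeta> x) * g x b (\<zeta> x)"
  by (subst frame_expand[OF x, of b]) (simp add: g_simps[OF x])

lemma has_derivative_g:
  "x \<in> S \<Longrightarrow> ((\<lambda>z. g z a b) has_derivative deriv_at (\<lambda>z. g z a b) x) (at x)"
  by (rule smooth_on_has_deriv[OF smooth_g])

lemma deriv_g_simps:
  assumes x: "x \<in> S"
  shows "deriv_at (\<lambda>z. g z (a + a') b) x h = deriv_at (\<lambda>z. g z a b) x h + deriv_at (\<lambda>z. g z a' b) x h"
    "deriv_at (\<lambda>z. g z b (a + a')) x h = deriv_at (\<lambda>z. g z b a) x h + deriv_at (\<lambda>z. g z b a') x h"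
    "deriv_at (\<lambda>z. g z (r *\<^sub>R a) b) x h = r * deriv_at (\<lambda>z. g z a b) x h"
    "deriv_at (\<lambda>z. g z b (r *\<^sub>R a)) x h = r * deriv_at (\<lambda>z. g z b a) x h"
    "deriv_at (\<lambda>z. g z a b) x (h + h') = deriv_at (\<lambda>z. g z a b) x h + deriv_at (\<lambda>z. g z a b) x h'"
    "deriv_at (\<lambda>z. g z a b) x (r *\<^sub>R h) = r * deriv_at (\<lambda>z. g z a b) x h"
proof -
  note c = fun_cong[OF deriv_at_cong_open[OF open_S x]]
  note d = fun_cong[OF deriv_at_eqI]
  show "deriv_at (\<lambda>z. g z (a + a') b) x h = deriv_at (\<lambda>z. g z a b) x h + deriv_at (\<lambda>z. g z a' b) x h"
    by (subst c[of _ "\<lambda>z. g z a b + g z a' b"])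
      (auto simp: g_simps intro!: d has_derivative_add has_derivative_g x)
  show "deriv_at (\<lambda>z. g z b (a + a')) x h = deriv_at (\<lambda>z. g z b a) x h + deriv_at (\<lambda>z. g z b a') x h"
    by (subst c[of _ "\<lambda>z. g z b a + g z b a'"])
      (auto simp: g_simps intro!: d has_derivative_add has_derivative_g x)
  show "deriv_at (\<lambda>z. g z (r *\<^sub>R a) b) x h = r * deriv_at (\<lambda>z. g z a b) x h"
    by (subst c[of _ "\<lambda>z. r * g z a b"])
      (auto simp: g_simps intro!: d has_derivative_mult_right has_derivative_g x)
  show "deriv_at (\<lambda>z. g z b (r *\<^sub>R a)) x h = r * deriv_at (\<lambda>z. g z b a) x h"
    by (subst c[of _ "\<lambda>z. r * g z b a"])
      (auto simp: g_simps intro!: d has_derivative_mult_right has_derivative_g x)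
  have "linear (deriv_at (\<lambda>z. g z a b) x)"
    by (rule linear_deriv_at[OF smooth_on_differentiable[OF smooth_g x]])
  then show "deriv_at (\<lambda>z. g z a b) x (h + h') = deriv_at (\<lambda>z. g z a b) x h + deriv_at (\<lambda>z. g z a b) x h'"
    "deriv_at (\<lambda>z. g z a b) x (r *\<^sub>R h) = r * deriv_at (\<lambda>z. g z a b) x h"
    by (simp_all add: linear_add linear_cmul)
qed

lemma deriv_g_sym: "x \<in> S \<Longrightarrow> deriv_at (\<lambda>z. g z a b) x h = deriv_at (\<lambda>z. g z b a) x h"
  by (rule fun_cong[OF deriv_at_cong_open[OF open_S]]) (auto simp: g_sym)

lemma koszul_simps:
  assumes x: "x \<in> S"
  shows "koszul g x (a + a') b w = koszul g x a b w + koszul g x a' b w"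
    "koszul g x a (b + b') w = koszul g x a b w + koszul g x a b' w"
    "koszul g x a b (w + w') = koszul g x a b w + koszul g x a b w'"
    "koszul g x (r *\<^sub>R a) b w = r * koszul g x a b w"
    "koszul g x a (r *\<^sub>R b) w = r * koszul g x a b w"
    "koszul g x a b (r *\<^sub>R w) = r * koszul g x a b w"
  unfolding koszul_def deriv_g_simps[OF x] by (simp_all add: field_simps)

lemma koszul_expand:
  assumes x: "x \<in> S"
  shows "koszul g x a b w = g x w (\<xi> x) * koszul g x a b (\<xi> x) + g x w (\<zeta> x) * koszul g x a b (\<zeta> x)"
  by (subst frame_expand[OF x, of w]) (simp only: koszul_simps[OF x])

text \<open>In an orthonormal frame a vector is recovered from its inner products, which the Koszul
  formula prescribes. This supplies the existence behind the definite description in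
  \<open>christoffel\<close>.\<close>

lemma christoffel_frame:
  assumes x: "x \<in> S"
  shows "christoffel g x a b = koszul g x a b (\<xi> x) *\<^sub>R \<xi> x + koszul g x a b (\<zeta> x) *\<^sub>R \<zeta> x"
proof (rule christoffel_eqI)
  fix w
  show "g x (koszul g x a b (\<xi> x) *\<^sub>R \<xi> x + koszul g x a b (\<zeta> x) *\<^sub>R \<zeta> x) w = koszul g x a b w"
    unfolding koszul_expand[OF x, of a b w] by (simp add: g_simps[OF x] g_sym[OF x, of _ w])
qed (use bilinear_g[OF x] g_pos[OF x] in \<open>auto simp: less_imp_neq[symmetric]\<close>)

lemma g_christoffel:
  assumes x: "x \<in> S"
  shows "g x (christoffel g x a b) w = koszul g x a b w"
  unfolding christoffel_frame[OF x] koszul_expand[OF x, of a b w]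
  by (simp add: g_simps[OF x] g_sym[OF x, of _ w])

lemma christoffel_simps:
  assumes x: "x \<in> S"
  shows "christoffel g x (a + a') b = christoffel g x a b + christoffel g x a' b"
    "christoffel g x a (b + b') = christoffel g x a b + christoffel g x a b'"
    "christoffel g x (r *\<^sub>R a) b = r *\<^sub>R christoffel g x a b"
    "christoffel g x a (r *\<^sub>R b) = r *\<^sub>R christoffel g x a b"
  unfolding christoffel_frame[OF x] koszul_simps[OF x] by (simp_all add: algebra_simps)

lemma bilinear_christoffel: "x \<in> S \<Longrightarrow> bilinear (christoffel g x)"
  by (simp add: bilinear_def linear_iff christoffel_simps)

lemma christoffel_sym: "x \<in> S \<Longrightarrow> christoffel g x a b = christoffel g x b a"
  unfolding christoffel_frame koszul_def by (simp add: deriv_g_sym[of x a b] add.commute)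

lemma smooth_koszul: "smooth_on S (\<lambda>z. koszul g z a b w)"
  unfolding koszul_def by (intro smooth_intros smooth_g open_S) auto

lemma smooth_christoffel: "smooth_on S (\<lambda>z. christoffel g z a b)"
proof -
  \<comment> \<open>The factor 1 turns a field of linear forms into a field of bilinear maps on
    reals and vectors, so that the lemma on bilinear fields applies to a varying last
    argument.\<close>
  have "smooth_on S (\<lambda>z. 1 * koszul g z a b (u z))" if "smooth_on S u" for u
    by (rule smooth_on_bilinear_field[OF open_S, of "\<lambda>z r w. r * koszul g z a b w"])
      (auto intro!: smooth_intros open_S smooth_koszul that
        simp: bilinear_def linear_iff koszul_simps algebra_simps)
  then have "smooth_on S (\<lambda>z. koszul g z a b (\<xi> z) *\<^sub>R \<xi> z + koszul g z a b (\<zeta> z) *\<^sub>R \<zeta> z)"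
    by (intro smooth_intros open_S smooth_\<xi> smooth_\<zeta>) (simp_all add: smooth_\<xi> smooth_\<zeta>)
  then show ?thesis
    by (rule iffD1[OF smooth_on_cong[OF open_S], rotated]) (simp add: christoffel_frame)
qed

section \<open>The Levi-Civita connection and the connection form of the frame\<close>

definition cov :: "(plane \<Rightarrow> plane) \<Rightarrow> plane \<Rightarrow> plane \<Rightarrow> plane" where
  "cov u x a = deriv_at u x a + christoffel g x a (u x)"

text \<open>Compatibility of the connection with the metric, for constant fields: in the sum of the
  two Koszul expressions all derivatives cancel except the one in direction
  \<open>a\<close>.\<close>

lemma deriv_g_const:
  assumes x: "x \<in> S"
  shows "deriv_at (\<lambda>z. g z u v) x a = g x (christoffel g x a u) v + g x u (christoffel g x a v)"
  unfolding g_christoffel[OF x] g_sym[OF x, of u] koszul_def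
  by (simp add: deriv_g_sym[OF x, of v] field_simps)

lemma has_derivative_g_fields:
  assumes x: "x \<in> S" and "smooth_on S u" "smooth_on S v"
  shows "((\<lambda>z. g z (u z) (v z)) has_derivative
    (\<lambda>a. g x (cov u x a) (v x) + g x (u x) (cov v x a))) (at x)"
proof -
  have "((\<lambda>z. g z (u z) (v z)) has_derivative
    (\<lambda>h. deriv_at (\<lambda>z. g z (u x) (v x)) x h + g x (deriv_at u x h) (v x) + g x (u x) (deriv_at v x h))) (at x)"
    by (rule has_derivative_bilinear_field[OF open_S x])
      (use assms smooth_g in \<open>auto intro!: bilinear_g smooth_on_has_deriv smooth_on_differentiable\<close>)
  then show ?thesis
    by (simp add: cov_def deriv_g_const[OF x] g_simps[OF x] algebra_simps)
qed

definition \<eta> :: "plane \<Rightarrow> plane \<Rightarrow> real" where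
  "\<eta> x a = g x (cov \<xi> x a) (\<zeta> x)"

text \<open>The inner products of the frame fields are constant, so differentiating them makes the
  connection matrix skew; in dimension two it has the single entry \<open>\<eta>\<close>.\<close>

lemma cov_frame:
  assumes x: "x \<in> S"
  shows "cov \<xi> x a = \<eta> x a *\<^sub>R \<zeta> x" "cov \<zeta> x a = - \<eta> x a *\<^sub>R \<xi> x"
proof -
  have const: "g x (cov u x a) (v x) + g x (u x) (cov v x a) = 0"
    if "smooth_on S u" "smooth_on S v" "\<And>z. z \<in> S \<Longrightarrow> g z (u z) (v z) = c" for u v c
  proof -
    have "((\<lambda>z. g z (u z) (v z)) has_derivative (\<lambda>h. 0)) (at x)"
      by (rule iffD2[OF has_derivative_cong_open[OF open_S x]]) (use that(3) in auto)
    with has_derivative_g_fields[OF x that(1,2)] show ?thesis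
      using has_derivative_unique by metis
  qed
  from const[OF smooth_\<xi> smooth_\<xi> g_\<xi>\<xi>] have 1: "g x (cov \<xi> x a) (\<xi> x) = 0"
    using g_sym[OF x, of "\<xi> x"] by simp
  from const[OF smooth_\<zeta> smooth_\<zeta> g_\<zeta>\<zeta>] have 2: "g x (cov \<zeta> x a) (\<zeta> x) = 0"
    using g_sym[OF x, of "\<zeta> x"] by simp
  from const[OF smooth_\<xi> smooth_\<zeta> g_\<xi>\<zeta>] have 3: "g x (cov \<zeta> x a) (\<xi> x) = - \<eta> x a"
    using g_sym[OF x, of "\<xi> x"] by (simp add: \<eta>_def)
  show "cov \<xi> x a = \<eta> x a *\<^sub>R \<zeta> x" "cov \<zeta> x a = - \<eta> x a *\<^sub>R \<xi> x"
    by (rule g_eqI[OF x]; simp add: 1 2 3 g_simps[OF x] frame_simps[OF x]; simp add: \<eta>_def)+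
qed

lemma deriv_frame:
  assumes x: "x \<in> S"
  shows "deriv_at \<xi> x a = \<eta> x a *\<^sub>R \<zeta> x - christoffel g x a (\<xi> x)"
    "deriv_at \<zeta> x a = - \<eta> x a *\<^sub>R \<xi> x - christoffel g x a (\<zeta> x)"
  using cov_frame[OF x, of a] by (simp_all add: cov_def algebra_simps)

lemma \<eta>_simps:
  assumes x: "x \<in> S"
  shows "\<eta> x (a + b) = \<eta> x a + \<eta> x b" "\<eta> x (r *\<^sub>R a) = r * \<eta> x a"
    "\<eta> x 0 = 0" "\<eta> x (a - b) = \<eta> x a - \<eta> x b" "\<eta> x (- a) = - \<eta> x a"
proof -
  have "linear (deriv_at \<xi> x)"
    by (rule linear_deriv_at[OF smooth_on_differentiable[OF smooth_\<xi> x]])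
  then have l: "linear (\<eta> x)"
    by (simp add: linear_iff \<eta>_def cov_def g_simps[OF x] christoffel_simps[OF x] algebra_simps)
  show "\<eta> x (a + b) = \<eta> x a + \<eta> x b" "\<eta> x (r *\<^sub>R a) = r * \<eta> x a"
    "\<eta> x 0 = 0" "\<eta> x (a - b) = \<eta> x a - \<eta> x b" "\<eta> x (- a) = - \<eta> x a"
    using l by (simp_all add: linear_add linear_cmul linear_0 linear_diff linear_neg)
qed

lemma \<eta>_frame:
  assumes x: "x \<in> S"
  shows "\<eta> x a = \<eta> x (\<xi> x) * g x a (\<xi> x) + \<eta> x (\<zeta> x) * g x a (\<zeta> x)"
  by (subst frame_expand[OF x, of a]) (simp only: \<eta>_simps[OF x] mult.commute)

lemma smooth_g_fields:
  "smooth_on S u \<Longrightarrow> smooth_on S v \<Longrightarrow> smooth_on S (\<lambda>z. g z (u z) (v z))"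
  by (rule smooth_on_bilinear_field[OF open_S bilinear_g smooth_g])

lemma smooth_christoffel_fields:
  "smooth_on S u \<Longrightarrow> smooth_on S v \<Longrightarrow> smooth_on S (\<lambda>z. christoffel g z (u z) (v z))"
  by (rule smooth_on_bilinear_field[OF open_S bilinear_christoffel smooth_christoffel])

lemma smooth_\<eta>: "smooth_on S (\<lambda>z. \<eta> z a)"
  unfolding \<eta>_def cov_def
  by (intro smooth_g_fields smooth_on_add smooth_on_deriv_at smooth_christoffel_fields
      open_S smooth_\<xi> smooth_\<zeta> smooth_on_const)

lemma smooth_\<eta>_field:
  assumes "smooth_on S u"
  shows "smooth_on S (\<lambda>z. \<eta> z (u z))"
proof -
  have "smooth_on S (\<lambda>z. 1 * \<eta> z (u z))"
    by (rule smooth_on_bilinear_field[OF open_S, of "\<lambda>z r w. r * \<eta> z w"])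
      (auto intro!: smooth_intros open_S smooth_\<eta> assms
        simp: bilinear_def linear_iff \<eta>_simps algebra_simps)
  then show ?thesis by simp
qed

lemma has_derivative_\<eta>:
  "x \<in> S \<Longrightarrow> ((\<lambda>z. \<eta> z a) has_derivative deriv_at (\<lambda>z. \<eta> z a) x) (at x)"
  by (rule smooth_on_has_deriv[OF smooth_\<eta>])

text \<open>The exterior derivative of \<open>\<eta>\<close>, evaluated on constant fields, whose
  Lie bracket vanishes.\<close>

definition d\<eta> :: "plane \<Rightarrow> plane \<Rightarrow> plane \<Rightarrow> real" where
  "d\<eta> x a b = deriv_at (\<lambda>z. \<eta> z b) x a - deriv_at (\<lambda>z. \<eta> z a) x b"

end

declare split_paired_All [simp del] split_paired_Ex [simp del]

section \<open>The unit tangent bundle in an orthonormal frame\<close>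

text \<open>In the nested type \<open>space3\<close> the base point is not a component of the triple
  and has to be reassembled.\<close>

definition base :: "space3 \<Rightarrow> plane" where "base z = (fst z, fst (snd z))"

definition height :: "space3 \<Rightarrow> real" where "height z = snd (snd z)"

definition lift3 :: "plane \<Rightarrow> real \<Rightarrow> space3" where "lift3 a r = (fst a, snd a, r)"

lemma lift3_simps [simp]: "base (lift3 a r) = a" "height (lift3 a r) = r" "lift3 (base z) (height z) = z"
  by (simp_all add: base_def height_def lift3_def)

lemma bounded_linear_base: "bounded_linear base"
  unfolding base_def
  by (intro bounded_linear_Pair bounded_linear_fst bounded_linear_compose[OF bounded_linear_fst bounded_linear_snd])

lemma bounded_linear_height: "bounded_linear height"
  unfolding height_def by (intro bounded_linear_compose[OF bounded_linear_snd bounded_linear_snd])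

lemma base_height_linear [simp]:
  "base (a + b) = base a + base b" "base (r *\<^sub>R a) = r *\<^sub>R base a" "base 0 = 0"
  "height (a + b) = height a + height b" "height (r *\<^sub>R a) = r * height a" "height 0 = 0"
  by (simp_all add: base_def height_def zero_prod_def)

lemma base_height_eqI: "base a = base b \<Longrightarrow> height a = height b \<Longrightarrow> a = b"
  by (metis lift3_simps(3))

lemma bounded_linear_lift3: "bounded_linear (\<lambda>a. lift3 a 0)"
  unfolding lift3_def
  by (intro bounded_linear_Pair bounded_linear_fst bounded_linear_snd bounded_linear_zero)

lemma smooth_on_lift3:
  "open S \<Longrightarrow> smooth_on S u \<Longrightarrow> smooth_on S v \<Longrightarrow> smooth_on S (\<lambda>x. lift3 (u x) (v x))"
  unfolding lift3_def by (intro smooth_intros)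

text \<open>The map \<open>T\<close> lists the values of \<open>B c\<close> on the basis. It is
  injective since \<open>B c\<close> = 0 implies \<open>B c c\<close> = 0, hence surjective by
  dimension. This provides Christoffel vectors for a metric read in an arbitrary parametrization,
  where no frame is at hand.\<close>

lemma riesz_bilinear:
  fixes B :: "'a::euclidean_space \<Rightarrow> 'a \<Rightarrow> real"
  assumes B: "bilinear B" and nz: "\<And>a. a \<noteq> 0 \<Longrightarrow> B a a \<noteq> 0" and L: "linear L"
  shows "\<exists>c. \<forall>w. B c w = L w"
proof -
  have lB: "linear (B z)" "linear (\<lambda>z. B z w)" for z w
    using B by (auto simp: bilinear_def)
  define T where "T c = (\<Sum>i\<in>Basis. B c i *\<^sub>R i)" for c
  have T: "T c \<bullet> i = B c i" if "i \<in> Basis" for c i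
    using that by (simp add: T_def)
  have "linear T"
    by (rule linearI; rule euclidean_eqI) (simp_all add: T inner_add_left linear_add[OF lB(2)] linear_cmul[OF lB(2)])
  have ext: "f = h" if "linear f" "linear h" "\<And>i. i \<in> Basis \<Longrightarrow> f i = h i" for f h :: "'a \<Rightarrow> real"
    by (rule linear_eq_stdbasis) (use that in auto)
  have "inj T"
    unfolding linear_injective_0[OF \<open>linear T\<close>]
  proof safe
    fix c assume "T c = 0"
    then have "B c = (\<lambda>w. 0)"
      by (intro ext lB(1)) (auto simp: linear_iff simp flip: T)
    then show "c = 0" using nz by metis
  qed
  then have "surj T" by (rule linear_injective_imp_surjective[OF \<open>linear T\<close>]) simp
  then obtain c where c: "T c = (\<Sum>i\<in>Basis. L i *\<^sub>R i)" by (metis surjD)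
  have "B c = L"
    by (intro ext lB(1) L) (simp add: c flip: T)
  then show ?thesis by auto
qed

context orthonormal_frame
begin

definition frame_domain :: "space3 set" where "frame_domain = base -` S"

definition frame_param :: "space3 \<Rightarrow> plane \<times> plane" where
  "frame_param z = (base z,
     cos (height z) *\<^sub>R \<xi> (base z) + sin (height z) *\<^sub>R \<zeta> (base z))"

definition frame_metric :: "space3 metric_field" where
  "frame_metric z a b = g (base z) (base a) (base b)
     + (height a + \<eta> (base z) (base a)) * (height b + \<eta> (base z) (base b))"

text \<open>A left inverse of \<open>frame_param\<close> for angles strictly between - pi / 2 and pi
  / 2. The formula makes sense off the unit bundle too, which allows smoothness to be stated on an
  open set of tangent vectors.\<close>

definition frame_coords :: "plane \<times> plane \<Rightarrow> space3" where
  "frame_coords p = lift3 (fst p) (arcsin (g (fst p) (snd p) (\<zeta> (fst p))))"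

lemma open_frame_domain: "open frame_domain"
  unfolding frame_domain_def
  by (intro open_vimage open_S linear_continuous_on bounded_linear_base)

lemma smooth_base: "smooth_on frame_domain base"
  and smooth_height: "smooth_on frame_domain height"
  using smooth_on_bounded_linear[OF bounded_linear_base open_frame_domain smooth_on_ident]
    smooth_on_bounded_linear[OF bounded_linear_height open_frame_domain smooth_on_ident]
    open_frame_domain by auto

lemma smooth_on_base: "smooth_on S u \<Longrightarrow> smooth_on frame_domain (\<lambda>z. u (base z))"
  by (rule smooth_on_compose[OF open_frame_domain open_S _ smooth_base]) (auto simp: frame_domain_def)

lemma smooth_frame_param: "smooth_on frame_domain frame_param"
  unfolding frame_param_def
  by (intro smooth_intros open_frame_domain smooth_base smooth_height smooth_on_base smooth_\<xi> smooth_\<zeta>)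

lemma deriv_frame_param:
  assumes "z \<in> frame_domain"
  shows "deriv_at frame_param z = (\<lambda>h. (base h, cos (height z) *\<^sub>R deriv_at \<xi> (base z) (base h)
    + sin (height z) *\<^sub>R deriv_at \<zeta> (base z) (base h)
    + height h *\<^sub>R (cos (height z) *\<^sub>R \<zeta> (base z) - sin (height z) *\<^sub>R \<xi> (base z))))"
proof (rule deriv_at_eqI)
  have x: "base z \<in> S" using assms by (simp add: frame_domain_def)
  have b: "(base has_derivative base) (at z)" and h: "(height has_derivative height) (at z)"
    by (simp_all add: bounded_linear_imp_has_derivative bounded_linear_base bounded_linear_height)
  have c: "((\<lambda>z. cos (height z)) has_derivative (\<lambda>k. - sin (height z) * height k)) (at z)"
    and s: "((\<lambda>z. sin (height z)) has_derivative (\<lambda>k. cos (height z) * height k)) (at z)"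
    using h by (auto intro!: derivative_eq_intros)
  note \<xi>' = has_derivative_compose[OF b smooth_on_has_deriv[OF smooth_\<xi> x]]
    and \<zeta>' = has_derivative_compose[OF b smooth_on_has_deriv[OF smooth_\<zeta> x]]
  show "(frame_param has_derivative (\<lambda>h. (base h, cos (height z) *\<^sub>R deriv_at \<xi> (base z) (base h)
    + sin (height z) *\<^sub>R deriv_at \<zeta> (base z) (base h)
    + height h *\<^sub>R (cos (height z) *\<^sub>R \<zeta> (base z) - sin (height z) *\<^sub>R \<xi> (base z))))) (at z)"
    unfolding frame_param_def
    using has_derivative_Pair[OF b has_derivative_add[OF has_derivative_scaleR[OF c \<xi>'] has_derivative_scaleR[OF s \<zeta>']]]
    by (simp add: algebra_simps)
qed

text \<open>The left-hand side is the covariant derivative that enters the Sasaki metric, for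
  velocity \<open>(a, r)\<close> in the base and angle. It is a multiple of a unit vector, and its
  length is the source of the summand \<open>(ds + \<eta>)\<^sup>2\<close>.\<close>

lemma frame_vertical:
  assumes "x \<in> S"
  shows "(cos t *\<^sub>R deriv_at \<xi> x a + sin t *\<^sub>R deriv_at \<zeta> x a + r *\<^sub>R (cos t *\<^sub>R \<zeta> x - sin t *\<^sub>R \<xi> x))
      + christoffel g x a (cos t *\<^sub>R \<xi> x + sin t *\<^sub>R \<zeta> x)
    = (r + \<eta> x a) *\<^sub>R (cos t *\<^sub>R \<zeta> x - sin t *\<^sub>R \<xi> x)"
  unfolding deriv_frame[OF assms] christoffel_simps[OF assms] by (simp add: algebra_simps)

lemma frame_vertical_unit:
  assumes "x \<in> S"
  shows "g x (cos t *\<^sub>R \<zeta> x - sin t *\<^sub>R \<xi> x) (cos t *\<^sub>R \<zeta> x - sin t *\<^sub>R \<xi> x) = 1"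
  using sin_cos_squared_add[of t]
  by (simp add: g_simps[OF assms] frame_simps[OF assms] power2_eq_square algebra_simps)

lemma pullback_frame_param:
  assumes "z \<in> frame_domain"
  shows "pullback_metric frame_param (sasaki_metric g) z a b = frame_metric z a b"
proof -
  have x: "base z \<in> S" using assms by (simp add: frame_domain_def)
  show ?thesis
    unfolding pullback_metric_def deriv_frame_param[OF assms] frame_param_def sasaki_metric_def
      prod.case frame_vertical[OF x] frame_metric_def
    by (simp add: g_simps(7,8)[OF x] frame_vertical_unit[OF x])
qed

lemma inj_deriv_frame_param:
  assumes "z \<in> frame_domain"
  shows "inj (deriv_at frame_param z)"
proof -
  have x: "base z \<in> S" using assms by (simp add: frame_domain_def)
  have l: "linear (deriv_at frame_param z)"
    by (rule linear_deriv_at[OF smooth_on_differentiable[OF smooth_frame_param assms]])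
  have l\<xi>: "linear (deriv_at \<xi> (base z))" "linear (deriv_at \<zeta> (base z))"
    using smooth_on_differentiable[OF smooth_\<xi> x] smooth_on_differentiable[OF smooth_\<zeta> x]
    by (auto intro: linear_deriv_at)
  have "h = 0" if "deriv_at frame_param z h = 0" for h
  proof -
    have b: "base h = 0" using that unfolding deriv_frame_param[OF assms] by (simp add: zero_prod_def)
    then have "height h *\<^sub>R (cos (height z) *\<^sub>R \<zeta> (base z) - sin (height z) *\<^sub>R \<xi> (base z)) = 0"
      using arg_cong[OF that, of snd] unfolding deriv_frame_param[OF assms] b
      by (simp add: linear_0[OF l\<xi>(1)] linear_0[OF l\<xi>(2)])
    then have "height h = 0"
      using frame_vertical_unit[OF x, of "height z"] g_simps(9)[OF x] by (metis scaleR_eq_0_iff zero_neq_one)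
    with b show "h = 0" by (intro base_height_eqI) simp_all
  qed
  then show ?thesis unfolding linear_injective_0[OF l] by blast
qed

lemma bilinear_frame_metric: "z \<in> frame_domain \<Longrightarrow> bilinear (frame_metric z)"
  by (simp add: bilinear_def linear_iff frame_metric_def g_simps \<eta>_simps frame_domain_def algebra_simps)

lemma frame_metric_sym: "z \<in> frame_domain \<Longrightarrow> frame_metric z a b = frame_metric z b a"
  by (simp add: frame_metric_def frame_domain_def g_sym[of "base z" "base a"] mult.commute)

lemma frame_metric_definite:
  assumes "z \<in> frame_domain" "a \<noteq> 0"
  shows "frame_metric z a a \<noteq> 0"
proof
  have x: "base z \<in> S" using assms by (simp add: frame_domain_def)
  assume *: "frame_metric z a a = 0"
  have "g (base z) (base a) (base a) \<ge> 0"
    using g_pos[OF x, of "base a"] g_simps(9)[OF x] by (cases "base a = 0") auto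
  with * have z: "g (base z) (base a) (base a) = 0" "height a + \<eta> (base z) (base a) = 0"
    unfolding frame_metric_def
    by (metis add_nonneg_eq_0_iff zero_le_square)
       (metis * \<open>0 \<le> g (base z) (base a) (base a)\<close> add_nonneg_eq_0_iff frame_metric_def mult_eq_0_iff zero_le_square)
  then have "base a = 0" using g_pos[OF x, of "base a"] by force
  with z have "a = 0" by (intro base_height_eqI) (simp_all add: \<eta>_simps[OF x])
  with assms show False by simp
qed

lemma has_derivative_frame_metric:
  assumes "z \<in> frame_domain"
  shows "((\<lambda>z. frame_metric z a b) has_derivative (\<lambda>h.
    deriv_at (\<lambda>x. g x (base a) (base b)) (base z) (base h)
    + ((height a + \<eta> (base z) (base a)) * deriv_at (\<lambda>x. \<eta> x (base b)) (base z) (base h)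
      + deriv_at (\<lambda>x. \<eta> x (base a)) (base z) (base h) * (height b + \<eta> (base z) (base b))))) (at z)"
proof -
  have x: "base z \<in> S" using assms by (simp add: frame_domain_def)
  have b: "(base has_derivative base) (at z)"
    by (simp add: bounded_linear_imp_has_derivative bounded_linear_base)
  have e: "((\<lambda>z. r + \<eta> (base z) c) has_derivative
      (\<lambda>h. deriv_at (\<lambda>x. \<eta> x c) (base z) (base h))) (at z)" for r c
    using has_derivative_add[OF has_derivative_const has_derivative_compose[OF b has_derivative_\<eta>[OF x]]]
    by simp
  show ?thesis
    unfolding frame_metric_def
    by (intro has_derivative_add has_derivative_mult e has_derivative_compose[OF b has_derivative_g[OF x]])
qed

text \<open>For \<theta> = ds + \<eta> the product rule applied to \<theta> \<otimes> \<theta>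
  groups into the symmetrized derivative of \<eta> times \<theta>(w) and two exterior derivatives.
  The angle \<open>t\<close> is absent because the coefficients do not depend on it.\<close>

lemma koszul_frame_metric:
  assumes "x \<in> S"
  shows "koszul frame_metric (lift3 x t) (lift3 a 0) (lift3 b 0) w =
    koszul g x a b (base w)
    + ((deriv_at (\<lambda>z. \<eta> z b) x a + deriv_at (\<lambda>z. \<eta> z a) x b) * (height w + \<eta> x (base w))
      + \<eta> x b * d\<eta> x a (base w) + \<eta> x a * d\<eta> x b (base w)) / 2"
proof -
  have "lift3 x t \<in> frame_domain" using assms by (simp add: frame_domain_def)
  note d = deriv_at_eqI[OF has_derivative_frame_metric[OF this]]
  show ?thesis
    unfolding koszul_def d d\<eta>_def by (simp add: field_simps)
qed

lemma deriv_\<eta>_simps: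
  assumes x: "x \<in> S"
  shows "deriv_at (\<lambda>z. \<eta> z (a + a')) x h = deriv_at (\<lambda>z. \<eta> z a) x h + deriv_at (\<lambda>z. \<eta> z a') x h"
    "deriv_at (\<lambda>z. \<eta> z (r *\<^sub>R a)) x h = r * deriv_at (\<lambda>z. \<eta> z a) x h"
    "deriv_at (\<lambda>z. \<eta> z a) x (h + h') = deriv_at (\<lambda>z. \<eta> z a) x h + deriv_at (\<lambda>z. \<eta> z a) x h'"
    "deriv_at (\<lambda>z. \<eta> z a) x (r *\<^sub>R h) = r * deriv_at (\<lambda>z. \<eta> z a) x h"
proof -
  note c = fun_cong[OF deriv_at_cong_open[OF open_S x]]
  note d = fun_cong[OF deriv_at_eqI]
  show "deriv_at (\<lambda>z. \<eta> z (a + a')) x h = deriv_at (\<lambda>z. \<eta> z a) x h + deriv_at (\<lambda>z. \<eta> z a') x h"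
    by (subst c[of _ "\<lambda>z. \<eta> z a + \<eta> z a'"])
      (auto simp: \<eta>_simps intro!: d has_derivative_add has_derivative_\<eta> x)
  show "deriv_at (\<lambda>z. \<eta> z (r *\<^sub>R a)) x h = r * deriv_at (\<lambda>z. \<eta> z a) x h"
    by (subst c[of _ "\<lambda>z. r * \<eta> z a"])
      (auto simp: \<eta>_simps intro!: d has_derivative_mult_right has_derivative_\<eta> x)
  have "linear (deriv_at (\<lambda>z. \<eta> z a) x)"
    by (rule linear_deriv_at[OF smooth_on_differentiable[OF smooth_\<eta> x]])
  then show "deriv_at (\<lambda>z. \<eta> z a) x (h + h') = deriv_at (\<lambda>z. \<eta> z a) x h + deriv_at (\<lambda>z. \<eta> z a) x h'"
    "deriv_at (\<lambda>z. \<eta> z a) x (r *\<^sub>R h) = r * deriv_at (\<lambda>z. \<eta> z a) x h"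
    by (simp_all add: linear_add linear_cmul)
qed

lemma d\<eta>_simps:
  assumes x: "x \<in> S"
  shows "d\<eta> x (a + b) c = d\<eta> x a c + d\<eta> x b c" "d\<eta> x c (a + b) = d\<eta> x c a + d\<eta> x c b"
    "d\<eta> x (r *\<^sub>R a) c = r * d\<eta> x a c" "d\<eta> x c (r *\<^sub>R a) = r * d\<eta> x c a"
    "d\<eta> x a a = 0"
  by (simp_all add: d\<eta>_def deriv_\<eta>_simps[OF x] algebra_simps)

lemma d\<eta>_antisym: "d\<eta> x a b = - d\<eta> x b a"
  by (simp add: d\<eta>_def)

text \<open>The second condition says that \<open>c\<close> is the Christoffel vector of \<open>g + \<eta> \<otimes> \<eta>\<close>, the metric that
  \<open>frame_metric\<close> induces on the section \<open>height = 0\<close>; the first one is the equation of the vertical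
  component.\<close>

definition geodesic_coeff :: "plane \<Rightarrow> plane \<Rightarrow> plane \<Rightarrow> plane \<Rightarrow> bool" where
  "geodesic_coeff x a b c \<longleftrightarrow>
     \<eta> x c = (deriv_at (\<lambda>z. \<eta> z b) x a + deriv_at (\<lambda>z. \<eta> z a) x b) / 2 \<and>
     (\<forall>w. g x c w = koszul g x a b w + (\<eta> x b * d\<eta> x a w + \<eta> x a * d\<eta> x b w) / 2)"

lemma geodesic_coeff_iff:
  assumes "x \<in> S"
  shows "geodesic_coeff x a b c \<longleftrightarrow>
    (\<forall>w. koszul frame_metric (lift3 x 0) (lift3 a 0) (lift3 b 0) w = frame_metric (lift3 x 0) (lift3 c 0) w)"
    (is "_ \<longleftrightarrow> ?R")
proof
  assume "geodesic_coeff x a b c"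
  then have e: "\<eta> x c = (deriv_at (\<lambda>z. \<eta> z b) x a + deriv_at (\<lambda>z. \<eta> z a) x b) / 2"
    and G: "\<And>w. g x c w = koszul g x a b w + (\<eta> x b * d\<eta> x a w + \<eta> x a * d\<eta> x b w) / 2"
    unfolding geodesic_coeff_def by blast+
  show ?R
    unfolding koszul_frame_metric[OF assms] frame_metric_def lift3_simps e G
    by (simp add: field_simps)
next
  assume R: ?R
  have D: "d\<eta> x a 0 = 0" for a
    using d\<eta>_simps(4)[OF assms, of a 0 0] by simp
  have K: "koszul g x a b 0 = 0"
    using koszul_simps(6)[OF assms, of a b 0 0] by simp
  \<comment> \<open>The vertical test vector kills every term that comes from the base.\<close>
  have e: "\<eta> x c = (deriv_at (\<lambda>z. \<eta> z b) x a + deriv_at (\<lambda>z. \<eta> z a) x b) / 2"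
    using R[rule_format, of "lift3 0 1"] unfolding koszul_frame_metric[OF assms]
    by (simp add: frame_metric_def D K g_simps[OF assms] \<eta>_simps[OF assms])
  \<comment> \<open>The test vector is the lift of \<open>w\<close> to the kernel of ds + \<eta>, so
    the term just determined drops out.\<close>
  moreover have "g x c w = koszul g x a b w + (\<eta> x b * d\<eta> x a w + \<eta> x a * d\<eta> x b w) / 2" for w
    using R[rule_format, of "lift3 w (- \<eta> x w)"] unfolding koszul_frame_metric[OF assms]
    by (simp add: frame_metric_def)
  ultimately show "geodesic_coeff x a b c" by (simp add: geodesic_coeff_def)
qed


section \<open>Angle coordinates as a parametrization of the unit tangent bundle\<close>

lemma smooth_on_product_fst:
  assumes "open T" "smooth_on S u" "\<And>p. p \<in> T \<Longrightarrow> fst p \<in> S"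
  shows "smooth_on T (\<lambda>p :: plane \<times> plane. u (fst p))"
  by (rule smooth_on_compose[OF assms(1) open_S _ _ assms(2)])
    (use assms smooth_on_fst[OF assms(1) smooth_on_ident[OF assms(1)]] in auto)

lemma smooth_on_product_g:
  fixes T :: "(plane \<times> plane) set"
  assumes "open T" "smooth_on S u" "\<And>p. p \<in> T \<Longrightarrow> fst p \<in> S"
  shows "smooth_on T (\<lambda>p. g (fst p) (snd p) (u (fst p)))"
  by (rule smooth_on_bilinear_field[OF assms(1) bilinear_g])
    (use assms smooth_on_snd[OF assms(1) smooth_on_ident[OF assms(1)]] in
      \<open>auto intro: smooth_on_product_fst smooth_g\<close>)

text \<open>On unit vectors the condition says that the angle from \<open>\<xi>\<close> has positive
  cosine, the range in which the arcsine recovers it.\<close>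

definition half_bundle :: "(plane \<times> plane) set" where
  "half_bundle = {p \<in> S \<times> UNIV. 0 < g (fst p) (snd p) (\<xi> (fst p))}"

text \<open>Off the unit bundle the component along \<open>\<zeta>\<close> is unbounded; the extra
  condition keeps it inside the interval where the arcsine is smooth.\<close>

definition coords_domain :: "(plane \<times> plane) set" where
  "coords_domain = {p \<in> half_bundle. \<bar>g (fst p) (snd p) (\<zeta> (fst p))\<bar> < 1}"

lemma open_half_bundle: "open half_bundle"
proof -
  have "open (S \<times> (UNIV :: plane set))" by (intro open_Times open_S open_UNIV)
  moreover from this have "continuous_on (S \<times> UNIV) (\<lambda>p. g (fst p) (snd p) (\<xi> (fst p)))"
    by (intro smooth_on_continuous smooth_on_product_g smooth_\<xi>) auto
  ultimately have "open ((S \<times> UNIV) \<inter> (\<lambda>p. g (fst p) (snd p) (\<xi> (fst p))) -` {0<..})"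
    by (intro continuous_open_preimage) auto
  also have "(S \<times> UNIV) \<inter> (\<lambda>p. g (fst p) (snd p) (\<xi> (fst p))) -` {0<..} = half_bundle"
    by (auto simp: half_bundle_def)
  finally show ?thesis .
qed

lemma open_coords_domain: "open coords_domain"
proof -
  have "continuous_on half_bundle (\<lambda>p. g (fst p) (snd p) (\<zeta> (fst p)))"
    by (intro smooth_on_continuous smooth_on_product_g smooth_\<zeta> open_half_bundle)
      (auto simp: half_bundle_def)
  then have "open (half_bundle \<inter> (\<lambda>p. g (fst p) (snd p) (\<zeta> (fst p))) -` {-1<..<1})"
    by (intro continuous_open_preimage open_half_bundle) auto
  also have "half_bundle \<inter> (\<lambda>p. g (fst p) (snd p) (\<zeta> (fst p))) -` {-1<..<1} = coords_domain"
    by (auto simp: coords_domain_def)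
  finally show ?thesis .
qed

lemma smooth_frame_coords: "smooth_on coords_domain frame_coords"
  unfolding frame_coords_def
  by (intro smooth_on_lift3 smooth_on_arcsin smooth_on_product_g smooth_on_fst smooth_on_ident
      open_coords_domain smooth_\<zeta>) (auto simp: coords_domain_def half_bundle_def)

lemma frame_coords_bundle:
  assumes "p \<in> unit_tangent S g" "p \<in> half_bundle"
  shows "p \<in> coords_domain" "base (frame_coords p) = fst p"
    "\<bar>height (frame_coords p)\<bar> < pi / 2" "frame_param (frame_coords p) = p"
proof -
  define x y where xy: "x = fst p" "y = snd p"
  define k l where kl: "k = g x y (\<xi> x)" "l = g x y (\<zeta> x)"
  have x: "x \<in> S" and u: "g x y y = 1" and k: "k > 0"
    using assms by (auto simp: unit_tangent_def half_bundle_def xy kl)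
  have kl1: "k\<^sup>2 + l\<^sup>2 = 1"
    using g_expand[OF x, of y y] u by (simp add: kl power2_eq_square)
  then have "l\<^sup>2 < 1" using k by (smt (verit) zero_less_power)
  then have l: "\<bar>l\<bar> < 1" by (simp add: abs_square_less_1)
  then show "p \<in> coords_domain" using assms(2) by (simp add: coords_domain_def kl xy)
  show "base (frame_coords p) = fst p" by (simp add: frame_coords_def)
  have h: "height (frame_coords p) = arcsin l" by (simp add: frame_coords_def kl xy)
  have "- (pi / 2) < arcsin l" "arcsin l < pi / 2"
    using arcsin_lt_bounded[of l] l by auto
  then show "\<bar>height (frame_coords p)\<bar> < pi / 2" unfolding h by linarith
  have "cos (arcsin l) = sqrt (1 - l\<^sup>2)" using l by (intro cos_arcsin) auto
  also have "1 - l\<^sup>2 = k\<^sup>2" using kl1 by simp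
  \<comment> \<open>Membership in \<open>half_bundle\<close> selects the positive square
    root.\<close>
  finally have c: "cos (arcsin l) = k" using k by simp
  have s: "sin (arcsin l) = l" using l by simp
  have "y = k *\<^sub>R \<xi> x + l *\<^sub>R \<zeta> x" unfolding kl by (rule frame_expand[OF x])
  then show "frame_param (frame_coords p) = p"
    unfolding frame_param_def h by (simp add: frame_coords_def c s prod_eq_iff flip: xy)
qed

lemma frame_param_bundle:
  assumes "z \<in> frame_domain" "\<bar>height z\<bar> < pi / 2"
  shows "frame_param z \<in> unit_tangent S g" "frame_param z \<in> half_bundle"
    "frame_coords (frame_param z) = z"
proof -
  have x: "base z \<in> S" using assms by (simp add: frame_domain_def)
  note simps = g_simps[OF x] frame_simps[OF x]
  show "frame_param z \<in> unit_tangent S g"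
    using x sin_cos_squared_add[of "height z"]
    by (simp add: unit_tangent_def frame_param_def simps power2_eq_square algebra_simps)
  have "cos (height z) > 0" using assms(2) by (intro cos_gt_zero_pi) auto
  then show "frame_param z \<in> half_bundle"
    using x by (simp add: half_bundle_def frame_param_def simps)
  have "arcsin (sin (height z)) = height z" using assms(2) by (intro arcsin_sin) auto
  then show "frame_coords (frame_param z) = z"
    by (simp add: frame_coords_def frame_param_def simps)
qed

lemma frame_param_section: "x \<in> S \<Longrightarrow> frame_param (lift3 x 0) = (x, \<xi> x)"
  by (simp add: frame_param_def)

lemma unit_tangent_param_frame:
  "unit_tangent_param S g {z \<in> frame_domain. \<bar>height z\<bar> < pi / 2} frame_param"
    (is "unit_tangent_param S g ?W _")
  unfolding unit_tangent_param_def
proof (intro conjI)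
  have W: "?W = frame_domain \<inter> height -` {- (pi / 2) <..< pi / 2}"
    by auto
  show "open ?W"
    unfolding W by (intro open_Int open_frame_domain open_vimage linear_continuous_on
        bounded_linear_height open_greaterThanLessThan)
  show "smooth_on ?W frame_param" by (rule smooth_on_subset[OF smooth_frame_param]) auto
  show "\<forall>z\<in>?W. inj (deriv_at frame_param z)" using inj_deriv_frame_param by auto
  \<comment> \<open>The image is the trace of an open set of tangent vectors on the unit bundle,
    which makes it relatively open.\<close>
  have image: "frame_param ` ?W = unit_tangent S g \<inter> half_bundle"
  proof (intro equalityI subsetI)
    fix p assume "p \<in> unit_tangent S g \<inter> half_bundle"
    then have p: "p \<in> unit_tangent S g" "p \<in> half_bundle" by auto
    have "frame_coords p \<in> ?W"
      using frame_coords_bundle[OF p] p by (auto simp: frame_domain_def unit_tangent_def)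
    then show "p \<in> frame_param ` ?W"
      by (intro image_eqI[of _ _ "frame_coords p"]) (simp_all only: frame_coords_bundle(4)[OF p])
  next
    fix p assume "p \<in> frame_param ` ?W"
    then show "p \<in> unit_tangent S g \<inter> half_bundle"
      using frame_param_bundle by blast
  qed
  show "openin (top_of_set (unit_tangent S g)) (frame_param ` ?W)"
    unfolding image using open_half_bundle by (rule openin_open_Int)
  have "homeomorphism ?W (frame_param ` ?W) frame_param frame_coords"
  proof (rule homeomorphismI)
    show "continuous_on ?W frame_param"
      by (rule continuous_on_subset[OF smooth_on_continuous[OF smooth_frame_param]]) auto
    show "continuous_on (frame_param ` ?W) frame_coords"
      by (rule continuous_on_subset[OF smooth_on_continuous[OF smooth_frame_coords]])
        (use frame_coords_bundle(1) frame_param_bundle in blast)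
  qed (use frame_param_bundle in auto)
  then show "\<exists>\<psi>'. homeomorphism ?W (frame_param ` ?W) frame_param \<psi>'" by blast
qed

lemma deriv_lift3: "deriv_at (\<lambda>x. lift3 x 0) x = (\<lambda>a. lift3 a 0)"
  by (rule deriv_at_eqI[OF bounded_linear_imp_has_derivative[OF bounded_linear_lift3]])

text \<open>In angle coordinates the field is the linear map \<open>\<lambda>x. lift3 x 0\<close>.
  Its second derivatives vanish, so it only remains that the Christoffel vector of two tangent
  vectors is tangent, and \<open>geodesic_coeff\<close> names that vector.\<close>

lemma totally_geodesic_in_param_if:
  assumes "\<And>x a b. x \<in> S \<Longrightarrow> \<exists>c. geodesic_coeff x a b c"
  shows "totally_geodesic_in_param S g \<xi>"
  unfolding totally_geodesic_in_param_def
proof (intro exI conjI)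
  let ?W = "{z \<in> frame_domain. \<bar>height z\<bar> < pi / 2}"
  let ?h = "pullback_metric frame_param (sasaki_metric g)"
  show "unit_tangent_param S g ?W frame_param" by (rule unit_tangent_param_frame)
  show "\<forall>x\<in>S. lift3 x 0 \<in> ?W \<and> frame_param (lift3 x 0) = (x, \<xi> x)"
    by (simp add: frame_domain_def frame_param_section)
  show "totally_geodesic_immersion S (\<lambda>x. lift3 x 0) ?h"
    unfolding totally_geodesic_immersion_def deriv_lift3
  proof (intro conjI ballI allI)
    show "smooth_on S (\<lambda>x. lift3 x 0)"
      by (intro smooth_on_lift3 open_S smooth_on_ident smooth_on_const)
    show "inj (\<lambda>a. lift3 a 0)" by (rule injI) (metis lift3_simps(1))
  next
    fix x a b assume x: "x \<in> S"
    then have X: "lift3 x 0 \<in> frame_domain" by (simp add: frame_domain_def)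
    obtain c where "geodesic_coeff x a b c" using assms[OF x] by blast
    then have c: "koszul frame_metric (lift3 x 0) (lift3 a 0) (lift3 b 0) w =
      frame_metric (lift3 x 0) (lift3 c 0) w" for w
      using geodesic_coeff_iff[OF x] by blast
    have "christoffel ?h (lift3 x 0) (lift3 a 0) (lift3 b 0) = lift3 c 0"
    proof (rule christoffel_eqI)
      have h: "?h (lift3 x 0) = frame_metric (lift3 x 0)"
        using pullback_frame_param[OF X] by (intro ext)
      show "bilinear (?h (lift3 x 0))" unfolding h by (rule bilinear_frame_metric[OF X])
      show "\<And>a. a \<noteq> 0 \<Longrightarrow> ?h (lift3 x 0) a a \<noteq> 0" unfolding h by (rule frame_metric_definite[OF X])
      show "?h (lift3 x 0) (lift3 c 0) w = koszul ?h (lift3 x 0) (lift3 a 0) (lift3 b 0) w" for w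
        unfolding h c[symmetric]
        by (rule koszul_cong_open[OF open_frame_domain X]) (simp add: pullback_frame_param)
    qed
    then show "\<exists>c. deriv_at (\<lambda>z. lift3 b 0) x a + christoffel ?h (lift3 x 0) (lift3 a 0) (lift3 b 0) = lift3 c 0"
      by (intro exI[of _ c]) simp
  qed
qed

end

context orthonormal_frame
begin

lemma linear_koszul_frame_metric:
  assumes "x \<in> S"
  shows "linear (koszul frame_metric (lift3 x t) (lift3 a 0) (lift3 b 0))"
  unfolding linear_iff koszul_frame_metric[OF assms]
  by (simp add: koszul_simps[OF assms] d\<eta>_simps[OF assms] \<eta>_simps[OF assms] field_simps)

text \<open>The given parametrization is compared with the angle coordinates by a local
  diffeomorphism \<open>\<tau>\<close> that pulls \<open>frame_metric\<close> back to the given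
  metric and flattens the given map to the section of height 0. The second derivatives of
  \<open>\<tau>\<close> enter twice and cancel.\<close>

lemma totally_geodesic_in_paramD:
  assumes "totally_geodesic_in_param S g \<xi>" and x: "x \<in> S"
  shows "\<exists>c. geodesic_coeff x a b c"
proof -
  obtain W \<psi> f where par: "unit_tangent_param S g W \<psi>"
    and f: "\<And>x. x \<in> S \<Longrightarrow> f x \<in> W" "\<And>x. x \<in> S \<Longrightarrow> \<psi> (f x) = (x, \<xi> x)"
    and tg: "totally_geodesic_immersion S f (pullback_metric \<psi> (sasaki_metric g))"
    using assms(1) unfolding totally_geodesic_in_param_def by blast
  have W: "open W" and \<psi>: "smooth_on W \<psi>" and inj\<psi>: "\<And>z. z \<in> W \<Longrightarrow> inj (deriv_at \<psi> z)"
    and \<psi>W: "\<psi> ` W \<subseteq> unit_tangent S g"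
    using par unfolding unit_tangent_param_def by (auto dest: openin_imp_subset)
  define h where "h = pullback_metric \<psi> (sasaki_metric g)"
  define V where "V = W \<inter> \<psi> -` half_bundle"
  \<comment> \<open>Change from the given parameters to angle coordinates, available on the part
    \<open>V\<close> that \<open>\<psi>\<close> maps into the half bundle; the image of
    \<open>f\<close> lies in \<open>V\<close> because \<open>\<xi>\<close> has angle 0.\<close>
  define \<tau> where "\<tau> = (\<lambda>w. frame_coords (\<psi> w))"
  have V: "open V"
    unfolding V_def by (intro continuous_open_preimage smooth_on_continuous \<psi> W open_half_bundle)
  have \<psi>V: "\<psi> w \<in> unit_tangent S g" "\<psi> w \<in> half_bundle" if "w \<in> V" for w
    using that \<psi>W by (auto simp: V_def)
  note \<tau>V = frame_coords_bundle[OF \<psi>V]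
  have \<tau>: "smooth_on V \<tau>"
    unfolding \<tau>_def
    by (rule smooth_on_compose[OF V open_coords_domain _ smooth_on_subset[OF \<psi>] smooth_frame_coords])
      (use \<tau>V(1) in blast, simp add: V_def)
  have dom: "\<tau> w \<in> frame_domain" if "w \<in> V" for w
    using \<psi>V[OF that] \<tau>V(2)[OF that that] by (auto simp: \<tau>_def frame_domain_def half_bundle_def)
  have d\<psi>: "deriv_at \<psi> w = (\<lambda>a. deriv_at frame_param (\<tau> w) (deriv_at \<tau> w a))" if "w \<in> V" for w
  proof -
    have "deriv_at \<psi> w = deriv_at (\<lambda>z. frame_param (\<tau> z)) w"
      by (rule deriv_at_cong_open[OF V that]) (simp add: \<tau>_def \<tau>V(4))
    also have "\<dots> = (\<lambda>a. deriv_at frame_param (\<tau> w) (deriv_at \<tau> w a))"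
      by (rule deriv_at_eqI[OF has_derivative_compose[OF smooth_on_has_deriv[OF \<tau> that]
            smooth_on_has_deriv[OF smooth_frame_param dom[OF that]]]])
    finally show ?thesis .
  qed
  have h_eq: "h w a b = pullback_metric \<tau> frame_metric w a b" if "w \<in> V" for w a b
  proof -
    have "h w a b = pullback_metric frame_param (sasaki_metric g) (\<tau> w) (deriv_at \<tau> w a) (deriv_at \<tau> w b)"
      using \<tau>V(4)[OF that that] by (simp add: h_def pullback_metric_def d\<psi>[OF that] \<tau>_def)
    then show ?thesis
      unfolding pullback_frame_param[OF dom[OF that]] by (simp add: pullback_metric_def)
  qed
  have fV: "f x \<in> V" if "x \<in> S" for x
    using f[OF that] that by (auto simp: V_def half_bundle_def g_\<xi>\<xi>)
  have \<tau>f: "\<tau> (f x) = lift3 x 0" if "x \<in> S" for x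
    using f(2)[OF that] that by (simp add: \<tau>_def frame_coords_def g_\<xi>\<zeta>)
  have fS: "smooth_on S f" using tg by (simp add: totally_geodesic_immersion_def)
  have df: "deriv_at \<tau> (f z) (deriv_at f z a) = lift3 a 0" if "z \<in> S" for z a
  proof -
    have "deriv_at (\<lambda>y. \<tau> (f y)) z = deriv_at (\<lambda>y. lift3 y 0) z"
      by (rule deriv_at_cong_open[OF open_S that]) (rule \<tau>f)
    moreover have "deriv_at (\<lambda>y. \<tau> (f y)) z = (\<lambda>a. deriv_at \<tau> (f z) (deriv_at f z a))"
      by (rule deriv_at_eqI[OF has_derivative_compose[OF smooth_on_has_deriv[OF fS that]
            smooth_on_has_deriv[OF \<tau> fV[OF that]]]])
    ultimately show ?thesis by (metis deriv_lift3)
  qed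
  have lin\<tau>: "linear (deriv_at \<tau> w)" if "w \<in> V" for w
    by (rule linear_deriv_at[OF smooth_on_differentiable[OF \<tau> that]])
  have inj\<tau>: "inj (deriv_at \<tau> w)" if "w \<in> V" for w
    using inj\<psi>[of w] that unfolding d\<psi>[OF that] V_def by (auto simp: inj_def)
  \<comment> \<open>Domain and target both have dimension three. Surjectivity is needed in order to
    test with arbitrary vectors at the end.\<close>
  have surj\<tau>: "surj (deriv_at \<tau> w)" if "w \<in> V" for w
    by (rule linear_injective_imp_surjective[OF lin\<tau>[OF that] inj\<tau>[OF that]]) simp
  let ?A = "deriv_at f x a" and ?B = "deriv_at f x b"
  define C where "C = deriv_at (\<lambda>w. deriv_at \<tau> w ?B) (f x) ?A"
  \<comment> \<open>The composite of \<open>\<tau>\<close> and \<open>f\<close> is linear, so its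
    second derivative vanishes; the product rule splits that derivative into the two terms
    shown.\<close>
  have second: "C + deriv_at \<tau> (f x) (deriv_at (\<lambda>z. deriv_at f z b) x a) = 0"
  proof -
    have b: "((\<lambda>z. deriv_at f z b) has_derivative deriv_at (\<lambda>z. deriv_at f z b) x) (at x)"
      by (rule smooth_on_has_deriv[OF smooth_on_deriv_at[OF open_S fS] x])
    have c: "((\<lambda>z. deriv_at \<tau> (f z) v) has_derivative
        (\<lambda>h. deriv_at (\<lambda>w. deriv_at \<tau> w v) (f x) (deriv_at f x h))) (at x)" for v
      by (rule has_derivative_compose[OF smooth_on_has_deriv[OF fS x]
            smooth_on_has_deriv[OF smooth_on_deriv_at[OF V \<tau>] fV[OF x]]])
    have "((\<lambda>z. (1::real) *\<^sub>R deriv_at \<tau> (f z) (deriv_at f z b)) has_derivative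
      (\<lambda>h. deriv_at (\<lambda>z. (1::real) *\<^sub>R deriv_at \<tau> (f z) ?B) x h + (0::real) *\<^sub>R deriv_at \<tau> (f x) ?B
        + (1::real) *\<^sub>R deriv_at \<tau> (f x) (deriv_at (\<lambda>z. deriv_at f z b) x h))) (at x)"
      by (rule has_derivative_bilinear_field[OF open_S x, of "\<lambda>z r v. r *\<^sub>R deriv_at \<tau> (f z) v", OF _ _ has_derivative_const b])
        (use linear_add[OF lin\<tau>[OF fV]] linear_cmul[OF lin\<tau>[OF fV]] differentiableI[OF c] in
          \<open>auto simp: bilinear_def linear_iff algebra_simps intro!: differentiable_scaleR\<close>)
    moreover have "((\<lambda>z. (1::real) *\<^sub>R deriv_at \<tau> (f z) (deriv_at f z b)) has_derivative (\<lambda>h. 0)) (at x)"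
      by (rule iffD2[OF has_derivative_cong_open[OF open_S x]]) (auto simp: df)
    ultimately have "(\<lambda>h. deriv_at (\<lambda>z. (1::real) *\<^sub>R deriv_at \<tau> (f z) ?B) x h + (0::real) *\<^sub>R deriv_at \<tau> (f x) ?B
        + (1::real) *\<^sub>R deriv_at \<tau> (f x) (deriv_at (\<lambda>z. deriv_at f z b) x h)) = (\<lambda>h. 0)"
      by (rule has_derivative_unique)
    from fun_cong[OF this, of a] show ?thesis
      by (simp add: deriv_at_eqI[OF c] C_def)
  qed
  have kos: "koszul h (f x) ?A ?B w = frame_metric (lift3 x 0) C (deriv_at \<tau> (f x) w)
      + koszul frame_metric (lift3 x 0) (lift3 a 0) (lift3 b 0) (deriv_at \<tau> (f x) w)" for w
  proof -
    have "koszul h (f x) ?A ?B w = koszul (pullback_metric \<tau> frame_metric) (f x) ?A ?B w"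
      by (rule koszul_cong_open[OF V fV[OF x]]) (rule h_eq)
    also have "\<dots> = frame_metric (\<tau> (f x)) C (deriv_at \<tau> (f x) w) + koszul frame_metric (\<tau> (f x))
        (deriv_at \<tau> (f x) ?A) (deriv_at \<tau> (f x) ?B) (deriv_at \<tau> (f x) w)"
      unfolding C_def
      by (rule koszul_pullback[OF V \<tau> fV[OF x] open_frame_domain])
        (use dom dom[OF fV[OF x]] in \<open>auto intro: bilinear_frame_metric frame_metric_sym
            differentiableI[OF has_derivative_frame_metric]\<close>)
    finally show ?thesis unfolding \<tau>f[OF x] df[OF x] .
  qed
  have X: "lift3 x 0 \<in> frame_domain" using x by (simp add: frame_domain_def)
  note H = bilinear_frame_metric[OF X]
  have lH: "linear (frame_metric (lift3 x 0) z)" "linear (\<lambda>z. frame_metric (lift3 x 0) z w)" for z w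
    using H unfolding bilinear_def by blast+
  have hx: "h (f x) u v = frame_metric (lift3 x 0) (deriv_at \<tau> (f x) u) (deriv_at \<tau> (f x) v)" for u v
    unfolding h_eq[OF fV[OF x]] pullback_metric_def \<tau>f[OF x] ..
  note l = lin\<tau>[OF fV[OF x]]
  have bil: "bilinear (h (f x))"
    unfolding bilinear_def linear_iff hx
    by (simp add: linear_add[OF l] linear_cmul[OF l] bilinear_ladd[OF H] bilinear_radd[OF H]
        bilinear_lmul[OF H] bilinear_rmul[OF H])
  have nz: "h (f x) u u \<noteq> 0" if "u \<noteq> 0" for u
    unfolding hx using that inj\<tau>[OF fV[OF x]] by (intro frame_metric_definite[OF X])
      (auto simp: linear_injective_0[OF l])
  have "linear (koszul h (f x) ?A ?B)"
    unfolding kos linear_iff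
    by (simp add: linear_add[OF l] linear_cmul[OF l] linear_add[OF lH(1)] linear_cmul[OF lH(1)]
        linear_add[OF linear_koszul_frame_metric[OF x]] linear_cmul[OF linear_koszul_frame_metric[OF x]]
        algebra_simps)
  \<comment> \<open>The vector \<open>D\<close> represents the Koszul covector, which gives the
    definite description in \<open>christoffel\<close> a value.\<close>
  from riesz_bilinear[OF bil nz this] obtain D
    where D: "\<And>w. h (f x) D w = koszul h (f x) ?A ?B w" by blast
  have "christoffel h (f x) ?A ?B = D"
    by (rule christoffel_eqI[OF bil nz D])
  moreover obtain c where "deriv_at (\<lambda>z. deriv_at f z b) x a + christoffel h (f x) ?A ?B = deriv_at f x c"
    using tg x unfolding totally_geodesic_immersion_def h_def by blast
  ultimately have "deriv_at (\<lambda>z. deriv_at f z b) x a + D = deriv_at f x c" by simp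
  from arg_cong[OF this, of "deriv_at \<tau> (f x)"]
  have "deriv_at \<tau> (f x) D + deriv_at \<tau> (f x) (deriv_at (\<lambda>z. deriv_at f z b) x a) = lift3 c 0"
    by (simp add: linear_add[OF l] df[OF x] add.commute)
  \<comment> \<open>The correction \<open>C\<close> also occurs in the transformation law
    \<open>kos\<close>, so it cancels and leaves the equation of
    \<open>geodesic_coeff_iff\<close>.\<close>
  then have TD: "deriv_at \<tau> (f x) D = lift3 c 0 + C"
    using second by (simp add: add_eq_0_iff eq_diff_eq[symmetric])
  have "koszul frame_metric (lift3 x 0) (lift3 a 0) (lift3 b 0) w = frame_metric (lift3 x 0) (lift3 c 0) w" for w
  proof -
    obtain v where "w = deriv_at \<tau> (f x) v" using surjD[OF surj\<tau>[OF fV[OF x]]] by blast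
    with D[of v] show ?thesis unfolding kos hx TD by (simp add: linear_add[OF lH(2)])
  qed
  then show ?thesis using geodesic_coeff_iff[OF x] by blast
qed

end

context orthonormal_frame
begin

section \<open>Curvature and the structure equations\<close>

lemma has_derivative_christoffel:
  "x \<in> S \<Longrightarrow> ((\<lambda>z. christoffel g z a b) has_derivative deriv_at (\<lambda>z. christoffel g z a b) x) (at x)"
  by (rule smooth_on_has_deriv[OF smooth_christoffel])

lemma has_derivative_\<eta>_field:
  assumes x: "x \<in> S" and u: "smooth_on S u"
  shows "((\<lambda>z. \<eta> z (u z)) has_derivative
    (\<lambda>h. deriv_at (\<lambda>z. \<eta> z (u x)) x h + \<eta> x (deriv_at u x h))) (at x)"
proof -
  have "((\<lambda>z. (1::real) *\<^sub>R \<eta> z (u z)) has_derivative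
    (\<lambda>h. deriv_at (\<lambda>z. (1::real) *\<^sub>R \<eta> z (u x)) x h + (0::real) *\<^sub>R \<eta> x (u x)
      + (1::real) *\<^sub>R \<eta> x (deriv_at u x h))) (at x)"
    by (rule has_derivative_bilinear_field[OF open_S x, of "\<lambda>z r v. r *\<^sub>R \<eta> z v",
          OF _ _ has_derivative_const smooth_on_has_deriv[OF u x]])
      (use smooth_on_differentiable[OF smooth_\<eta> x] in
        \<open>auto simp: bilinear_def linear_iff \<eta>_simps algebra_simps\<close>)
  then show ?thesis by simp
qed

text \<open>Differentiating \<open>du\<close> once more and using the symmetry of second derivatives
  of \<open>u\<close> isolates the curvature. With a single connection form the quadratic terms in
  \<open>\<eta>\<close> cancel and \<open>d\<eta>\<close> remains.\<close>

lemma curvature_frame_aux: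
  assumes x: "x \<in> S" and u: "smooth_on S u" and v: "smooth_on S v"
    and du: "\<And>z a. z \<in> S \<Longrightarrow> deriv_at u z a = \<eta> z a *\<^sub>R v z - christoffel g z a (u z)"
    and dv: "\<And>z a. z \<in> S \<Longrightarrow> deriv_at v z a = - \<eta> z a *\<^sub>R u z - christoffel g z a (v z)"
  shows "riemann_curvature g x a b (u x) = d\<eta> x a b *\<^sub>R v x"
proof -
  have *: "deriv_at (\<lambda>z. deriv_at u z b) x a =
      (\<eta> x b *\<^sub>R deriv_at v x a + deriv_at (\<lambda>z. \<eta> z b) x a *\<^sub>R v x)
      - (deriv_at (\<lambda>z. christoffel g z b (u x)) x a + christoffel g x b (deriv_at u x a))" for a b
  proof -
    have G: "((\<lambda>z. christoffel g z b (u z)) has_derivative (\<lambda>h.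
      deriv_at (\<lambda>z. christoffel g z b (u x)) x h + christoffel g x 0 (u x)
      + christoffel g x b (deriv_at u x h))) (at x)"
      by (rule has_derivative_bilinear_field[OF open_S x bilinear_christoffel _ has_derivative_const
            smooth_on_has_deriv[OF u x]])
        (assumption, rule smooth_on_differentiable[OF smooth_christoffel x])
    have "christoffel g x 0 (u x) = 0"
      using christoffel_simps(3)[OF x, of 0 0] by simp
    note D = has_derivative_diff[OF has_derivative_scaleR[OF has_derivative_\<eta>[OF x]
          smooth_on_has_deriv[OF v x]] G, unfolded this add_0_right]
    have "deriv_at (\<lambda>z. deriv_at u z b) x = deriv_at (\<lambda>z. \<eta> z b *\<^sub>R v z - christoffel g z b (u z)) x"
      by (rule deriv_at_cong_open[OF open_S x]) (rule du)
    then show ?thesis unfolding deriv_at_eqI[OF D] by simp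
  qed
  have "deriv_at (\<lambda>z. deriv_at u z b) x a = deriv_at (\<lambda>z. deriv_at u z a) x b"
    by (rule second_deriv_symmetric[OF open_S u x])
  then have eq: "deriv_at (\<lambda>z. christoffel g z b (u x)) x a - deriv_at (\<lambda>z. christoffel g z a (u x)) x b =
      \<eta> x b *\<^sub>R deriv_at v x a - \<eta> x a *\<^sub>R deriv_at v x b + d\<eta> x a b *\<^sub>R v x
      - christoffel g x b (deriv_at u x a) + christoffel g x a (deriv_at u x b)"
    unfolding * d\<eta>_def by (simp add: algebra_simps)
  have Gd: "christoffel g x a (b - c) = christoffel g x a b - christoffel g x a c" for a b c
    using christoffel_simps(2)[OF x, of a "b - c" c] by simp
  show ?thesis
    unfolding riemann_curvature_def eq
    by (simp add: du[OF x] dv[OF x] Gd christoffel_simps[OF x] algebra_simps)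
qed

lemma curvature_frame:
  assumes x: "x \<in> S"
  shows "riemann_curvature g x a b (\<xi> x) = d\<eta> x a b *\<^sub>R \<zeta> x"
    "riemann_curvature g x a b (\<zeta> x) = - d\<eta> x a b *\<^sub>R \<xi> x"
proof -
  show "riemann_curvature g x a b (\<xi> x) = d\<eta> x a b *\<^sub>R \<zeta> x"
    by (rule curvature_frame_aux[OF x smooth_\<xi> smooth_\<zeta>]) (simp_all add: deriv_frame)
  have n: "deriv_at (\<lambda>z. - \<xi> z) z a = - deriv_at \<xi> z a" if "z \<in> S" for z a
    using deriv_at_eqI[OF has_derivative_minus[OF smooth_on_has_deriv[OF smooth_\<xi> that]]] by simp
  have "christoffel g z a (- b) = - christoffel g z a b" if "z \<in> S" for z a b
    using christoffel_simps(4)[OF that, of a "-1" b] by simp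
  \<comment> \<open>The pair of \<open>\<zeta>\<close> and - \<open>\<xi>\<close> satisfies the same
    two equations with the same \<open>\<eta>\<close>.\<close>
  then have "riemann_curvature g x a b (\<zeta> x) = d\<eta> x a b *\<^sub>R (- \<xi> x)"
    by (intro curvature_frame_aux[OF x smooth_\<zeta> smooth_on_minus[OF open_S smooth_\<xi>]])
      (simp_all add: n deriv_frame)
  then show "riemann_curvature g x a b (\<zeta> x) = - d\<eta> x a b *\<^sub>R \<xi> x" by simp
qed

lemma riemann_curvature_linear:
  assumes x: "x \<in> S"
  shows "riemann_curvature g x a b (v + w) = riemann_curvature g x a b v + riemann_curvature g x a b w"
    "riemann_curvature g x a b (r *\<^sub>R v) = r *\<^sub>R riemann_curvature g x a b v"
proof -
  have d: "deriv_at (\<lambda>z. christoffel g z b (v + w)) x h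
      = deriv_at (\<lambda>z. christoffel g z b v) x h + deriv_at (\<lambda>z. christoffel g z b w) x h" for b h
    by (subst fun_cong[OF deriv_at_cong_open[OF open_S x, of _ "\<lambda>z. christoffel g z b v + christoffel g z b w"]])
      (auto simp: christoffel_simps x intro!: fun_cong[OF deriv_at_eqI]
        has_derivative_add has_derivative_christoffel)
  have e: "deriv_at (\<lambda>z. christoffel g z b (r *\<^sub>R v)) x h = r *\<^sub>R deriv_at (\<lambda>z. christoffel g z b v) x h" for b h
    by (subst fun_cong[OF deriv_at_cong_open[OF open_S x, of _ "\<lambda>z. r *\<^sub>R christoffel g z b v"]])
      (auto simp: christoffel_simps x intro!: fun_cong[OF deriv_at_eqI]
        has_derivative_scaleR_right has_derivative_christoffel)
  show "riemann_curvature g x a b (v + w) = riemann_curvature g x a b v + riemann_curvature g x a b w"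
    "riemann_curvature g x a b (r *\<^sub>R v) = r *\<^sub>R riemann_curvature g x a b v"
    by (simp_all add: riemann_curvature_def d e christoffel_simps[OF x] algebra_simps)
qed

text \<open>Geometrically the negative of the Gaussian curvature. The comparison of zeros in
  \<open>gauss_curvature_eq_0\<close> is the link to the curvature hypothesis.\<close>

definition \<kappa> :: "plane \<Rightarrow> real" where "\<kappa> x = d\<eta> x (\<xi> x) (\<zeta> x)"

lemma d\<eta>_frame:
  assumes x: "x \<in> S"
  shows "d\<eta> x a b = \<kappa> x * (g x a (\<xi> x) * g x b (\<zeta> x) - g x b (\<xi> x) * g x a (\<zeta> x))"
  by (subst frame_expand[OF x, of a], subst frame_expand[OF x, of b])
    (simp add: d\<eta>_simps[OF x] d\<eta>_antisym[of x "\<zeta> x" "\<xi> x"] \<kappa>_def algebra_simps)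

lemma gauss_curvature_eq_0:
  assumes x: "x \<in> S" and "\<kappa> x = 0"
  shows "gauss_curvature g x = 0"
proof -
  have "riemann_curvature g x a b w = 0" for a b w
    by (subst frame_expand[OF x, of w])
      (simp add: riemann_curvature_linear[OF x] curvature_frame[OF x] d\<eta>_frame[OF x] assms(2))
  then show ?thesis by (simp add: gauss_curvature_def g_simps[OF x])
qed

text \<open>Antisymmetrized in \<open>a\<close> and \<open>b\<close>, the symmetric Christoffel
  terms disappear and Cartan's first structure equations are left: dp = \<eta> \<and> q and dq = -
  \<eta> \<and> p.\<close>

lemma deriv_coframe:
  assumes x: "x \<in> S"
  shows "((\<lambda>z. g z b (\<xi> z)) has_derivative
      (\<lambda>a. g x (christoffel g x a b) (\<xi> x) + \<eta> x a * g x b (\<zeta> x))) (at x)"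
    "((\<lambda>z. g z b (\<zeta> z)) has_derivative
      (\<lambda>a. g x (christoffel g x a b) (\<zeta> x) - \<eta> x a * g x b (\<xi> x))) (at x)"
proof -
  have c: "cov (\<lambda>z. b) x a = christoffel g x a b" for a by (simp add: cov_def)
  show "((\<lambda>z. g z b (\<xi> z)) has_derivative
      (\<lambda>a. g x (christoffel g x a b) (\<xi> x) + \<eta> x a * g x b (\<zeta> x))) (at x)"
    "((\<lambda>z. g z b (\<zeta> z)) has_derivative
      (\<lambda>a. g x (christoffel g x a b) (\<zeta> x) - \<eta> x a * g x b (\<xi> x))) (at x)"
    using has_derivative_g_fields[OF x smooth_on_const smooth_\<xi>, of b]
      has_derivative_g_fields[OF x smooth_on_const smooth_\<zeta>, of b]
    unfolding cov_frame[OF x] c by (simp_all add: g_simps[OF x])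
qed

section \<open>Totally geodesic fields\<close>

abbreviation A where "A x \<equiv> \<eta> x (\<xi> x)"
abbreviation B where "B x \<equiv> \<eta> x (\<zeta> x)"
abbreviation p where "p x a \<equiv> g x a (\<xi> x)"
abbreviation q where "q x a \<equiv> g x a (\<zeta> x)"

text \<open>One half of \<open>geodesic_coeff\<close> determines \<open>c\<close>; the other half
  then gives the symmetric part of the derivative of \<open>\<eta>\<close>. The antisymmetric part
  is \<open>d\<eta>\<close>, so the whole first derivative is known.\<close>

lemma geodesic_hessian:
  assumes x: "x \<in> S" and "geodesic_coeff x a b c"
  shows "deriv_at (\<lambda>z. \<eta> z b) x a = \<eta> x (christoffel g x a b)
    + \<kappa> x / 2 * (\<eta> x b * (p x a * B x - q x a * A x) + \<eta> x a * (p x b * B x - q x b * A x)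
      + (p x a * q x b - p x b * q x a))"
proof -
  have G: "g x c w = koszul g x a b w + (\<eta> x b * d\<eta> x a w + \<eta> x a * d\<eta> x b w) / 2" for w
    using assms(2) unfolding geodesic_coeff_def by blast
  \<comment> \<open>The metric turns the form \<open>d\<eta> x a\<close> into
    \<open>\<kappa> x\<close> times the vector with components - \<open>q x a\<close> along
    \<open>\<xi>\<close> and \<open>p x a\<close> along \<open>\<zeta>\<close>.\<close>
  have c: "c = christoffel g x a b + (\<kappa> x / 2) *\<^sub>R (\<eta> x b *\<^sub>R (p x a *\<^sub>R \<zeta> x - q x a *\<^sub>R \<xi> x)
      + \<eta> x a *\<^sub>R (p x b *\<^sub>R \<zeta> x - q x b *\<^sub>R \<xi> x))"
    by (rule g_eqI[OF x]; unfold G)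
      (simp_all add: g_simps[OF x] frame_simps[OF x] d\<eta>_frame[OF x] g_christoffel[OF x] field_simps)
  \<comment> \<open>Symmetric part plus half of the antisymmetrized derivative.\<close>
  have "deriv_at (\<lambda>z. \<eta> z b) x a = \<eta> x c + d\<eta> x a b / 2"
    using assms(2) by (simp add: geodesic_coeff_def d\<eta>_def field_simps)
  then show ?thesis
    unfolding c by (simp add: \<eta>_simps[OF x] d\<eta>_frame[OF x] field_simps)
qed

context
  assumes geodesic: "\<forall>x\<in>S. \<forall>a b. \<exists>c. geodesic_coeff x a b c"
begin

lemma has_derivative_A:
  assumes x: "x \<in> S"
  shows "(A has_derivative (\<lambda>a. B x * \<eta> x a
    + \<kappa> x / 2 * (2 * A x * B x * p x a + ((B x)\<^sup>2 - (A x)\<^sup>2 - 1) * q x a))) (at x)"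
proof (rule has_derivative_eq_rhs[OF has_derivative_\<eta>_field[OF x smooth_\<xi>]], rule ext)
  fix a
  obtain c where "geodesic_coeff x a (\<xi> x) c" using geodesic x by blast
  from geodesic_hessian[OF x this]
  show "deriv_at (\<lambda>z. \<eta> z (\<xi> x)) x a + \<eta> x (deriv_at \<xi> x a) = B x * \<eta> x a
    + \<kappa> x / 2 * (2 * A x * B x * p x a + ((B x)\<^sup>2 - (A x)\<^sup>2 - 1) * q x a)"
    unfolding deriv_frame[OF x] \<eta>_frame[OF x, of a]
    by (simp add: \<eta>_simps[OF x] frame_simps[OF x] power2_eq_square field_simps)
qed

lemma has_derivative_B:
  assumes x: "x \<in> S"
  shows "(B has_derivative (\<lambda>a. - A x * \<eta> x a
    + \<kappa> x / 2 * ((1 + (B x)\<^sup>2 - (A x)\<^sup>2) * p x a - 2 * A x * B x * q x a))) (at x)"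
proof (rule has_derivative_eq_rhs[OF has_derivative_\<eta>_field[OF x smooth_\<zeta>]], rule ext)
  fix a
  obtain c where "geodesic_coeff x a (\<zeta> x) c" using geodesic x by blast
  from geodesic_hessian[OF x this]
  show "deriv_at (\<lambda>z. \<eta> z (\<zeta> x)) x a + \<eta> x (deriv_at \<zeta> x a) = - A x * \<eta> x a
    + \<kappa> x / 2 * ((1 + (B x)\<^sup>2 - (A x)\<^sup>2) * p x a - 2 * A x * B x * q x a)"
    unfolding deriv_frame[OF x] \<eta>_frame[OF x, of a]
    by (simp add: \<eta>_simps[OF x] frame_simps[OF x] power2_eq_square field_simps)
qed

text \<open>The terms \<open>B \<eta>\<close> and - \<open>A \<eta>\<close> in the derivatives of
  \<open>A\<close> and \<open>B\<close> only rotate the pair and cancel in its squared length. What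
  remains is a multiple of \<eta> turned by a right angle.\<close>

lemma has_derivative_norm_\<eta>:
  assumes x: "x \<in> S"
  shows "((\<lambda>z. (A z)\<^sup>2 + (B z)\<^sup>2) has_derivative
    (\<lambda>a. \<kappa> x * (1 + ((A x)\<^sup>2 + (B x)\<^sup>2)) * (B x * p x a - A x * q x a))) (at x)"
proof (rule has_derivative_eq_rhs[OF has_derivative_add[OF has_derivative_power[OF has_derivative_A[OF x]]
        has_derivative_power[OF has_derivative_B[OF x]]]], rule ext)
  fix a
  show "of_nat 2 * (B x * \<eta> x a + \<kappa> x / 2 * (2 * A x * B x * p x a + ((B x)\<^sup>2 - (A x)\<^sup>2 - 1) * q x a)) * A x ^ (2 - 1)
    + of_nat 2 * (- A x * \<eta> x a + \<kappa> x / 2 * ((1 + (B x)\<^sup>2 - (A x)\<^sup>2) * p x a - 2 * A x * B x * q x a)) * B x ^ (2 - 1)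
    = \<kappa> x * (1 + ((A x)\<^sup>2 + (B x)\<^sup>2)) * (B x * p x a - A x * q x a)"
    unfolding \<eta>_frame[OF x, of a] by (simp add: power2_eq_square field_simps)
qed

text \<open>A squared length confined to 0 and 1 is either 0 throughout, and then
  \<open>\<eta>\<close> and the curvature vanish, or locally constant 1 near some point, where its
  derivative would have to vanish.\<close>

lemma generic_point:
  assumes "S \<noteq> {}" and curv: "\<And>x. x \<in> S \<Longrightarrow> gauss_curvature g x \<noteq> 0"
  shows "\<exists>x\<in>S. (A x)\<^sup>2 + (B x)\<^sup>2 \<noteq> 0 \<and> (A x)\<^sup>2 + (B x)\<^sup>2 \<noteq> 1"
proof (rule ccontr)
  define m where "m x = (A x)\<^sup>2 + (B x)\<^sup>2" for x
  assume "\<not> ?thesis"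
  then have m01: "m x = 0 \<or> m x = 1" if "x \<in> S" for x
    using that by (auto simp: m_def)
  have \<kappa>: "\<kappa> x \<noteq> 0" if "x \<in> S" for x
    using curv[OF that] gauss_curvature_eq_0[OF that] by blast
  show False
  proof (cases "\<forall>x\<in>S. m x = 0")
    case True
    then have "A x = 0" "B x = 0" if "x \<in> S" for x
      using that by (auto simp: m_def sum_power2_eq_zero_iff)
    then have "\<eta> x a = 0" if "x \<in> S" for x a
      using \<eta>_frame[OF that, of a] that by simp
    then have "deriv_at (\<lambda>z. \<eta> z b) x a = deriv_at (\<lambda>z. 0) x a" if "x \<in> S" for x a b
      by (intro fun_cong[OF deriv_at_cong_open[OF open_S that]])
    then have "\<kappa> x = 0" if "x \<in> S" for x
      using that by (simp add: \<kappa>_def d\<eta>_def)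
    with \<kappa> assms(1) show False by blast
  next
    case False
    then obtain x where x: "x \<in> S" "m x = 1" using m01 by blast
    have "smooth_on S m"
      unfolding m_def by (intro smooth_intros open_S smooth_\<eta>_field smooth_\<xi> smooth_\<zeta>)
    \<comment> \<open>The threshold separates the two possible values, so the points of value 1 form
      an open set.\<close>
    then have "open (S \<inter> m -` {1/2<..})"
      by (intro continuous_open_preimage smooth_on_continuous open_S) auto
    moreover have "x \<in> S \<inter> m -` {1/2<..}" using x by simp
    ultimately have "(m has_derivative (\<lambda>h. 0)) (at x)"
    proof (rule iffD2[OF has_derivative_cong_open])
      show "m z = 1" if "z \<in> S \<inter> m -` {1/2<..}" for z
        using m01[of z] that by auto
    qed (rule has_derivative_const)
    from has_derivative_unique[OF this has_derivative_norm_\<eta>[OF x(1), folded m_def]]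
    have "0 = \<kappa> x * (1 + m x) * (B x * p x a - A x * q x a)" for a
      by (rule fun_cong)
    \<comment> \<open>In the direction dual to the form on the right-hand side the derivative is a
      product of nonzero factors.\<close>
    from this[of "B x *\<^sub>R \<xi> x - A x *\<^sub>R \<zeta> x"] have "0 = \<kappa> x * (1 + m x) * m x"
      by (simp add: g_simps[OF x(1)] frame_simps[OF x(1)] m_def power2_eq_square algebra_simps)
    with x \<kappa>[OF x(1)] show False by simp
  qed
qed

end

end

section \<open>Potentials and separation of variables on rectangles\<close>

text \<open>The Poincare lemma on a box around the point, for the form \<open>P\<close> ds +
  \<open>Q\<close> dt.\<close>

lemma closed_form_potential:
  fixes P Q :: "plane \<Rightarrow> real"
  assumes S: "open S" "x0 \<in> S" and P: "smooth_on S P" and Q: "smooth_on S Q"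
    and closed: "\<And>x. x \<in> S \<Longrightarrow> deriv_at P x (0, 1) = deriv_at Q x (1, 0)"
  obtains N u where "open N" "x0 \<in> N" "N \<subseteq> S"
    "\<And>x. x \<in> N \<Longrightarrow> (u has_derivative (\<lambda>h. fst h * P x + snd h * Q x)) (at x)"
proof -
  obtain a b where ab: "cbox a b \<subseteq> S" "x0 \<in> box a b"
    using open_contains_cbox[OF S] by metis
  obtain a1 a2 b1 b2 where ab12: "a = (a1, a2)" "b = (b1, b2)" by (metis surj_pair)
  have inS: "(s, t) \<in> S" if "a1 \<le> s" "s \<le> b1" "a2 \<le> t" "t \<le> b2" for s t
    using ab(1) that by (auto simp: ab12 cbox_Pair_eq)
  define I J where "I = {a1<..<b1}" and "J = {a2<..<b2}"
  have contP: "continuous_on S P" and contQ: "continuous_on S Q"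
    using P Q by (auto intro: smooth_on_continuous)
  \<comment> \<open>Integration along the bottom edge and then upwards: the derivative in
    \<open>t\<close> is immediate, the one in \<open>s\<close> is where closedness enters.\<close>
  define U where "U s t = integral {a1..s} (\<lambda>r. P (r, a2)) + integral {a2..t} (\<lambda>r. Q (s, r))" for s t
  have Us: "((\<lambda>s. U s t) has_derivative (\<lambda>h. h * P (s, t))) (at s within I)"
    if s: "s \<in> I" and t: "t \<in> J" for s t
  proof -
    have "continuous_on {a1..b1} (\<lambda>r. P (r, a2))"
      using s t by (intro continuous_on_compose2[OF contP] continuous_intros) (auto simp: I_def J_def inS)
    from integral_has_real_derivative[OF this, of s]
    have 1: "((\<lambda>s. integral {a1..s} (\<lambda>r. P (r, a2))) has_real_derivative P (s, a2)) (at s within I)"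
      using s by (auto simp: I_def intro: DERIV_subset)
    have d: "((\<lambda>s. Q (s, r)) has_real_derivative deriv_at Q (s, r) (1, 0)) (at s within I)"
      if "s \<in> I" "r \<in> cbox a2 t" for s r
    proof -
      have "(s, r) \<in> S" using that t by (intro inS) (auto simp: I_def J_def)
      then have dd: "Q differentiable at ((0, r) + s *\<^sub>R (1, 0))"
        using smooth_on_differentiable[OF Q] by simp
      from has_vector_derivative_along[OF this]
      have "((\<lambda>s. Q (s, r)) has_real_derivative deriv_at Q (s, r) (1, 0)) (at s)"
        by (simp add: has_real_derivative_iff_has_vector_derivative)
      then show ?thesis by (rule has_field_derivative_at_within)
    qed
    have "((\<lambda>s. integral (cbox a2 t) (\<lambda>r. Q (s, r))) has_real_derivative
        integral (cbox a2 t) (\<lambda>r. deriv_at Q (s, r) (1, 0))) (at s within I)"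
    proof (rule leibniz_rule_field_derivative[OF d _ _ s])
      show "(\<lambda>r. Q (s, r)) integrable_on cbox a2 t" if "s \<in> I" for s
        using that t by (intro integrable_continuous continuous_on_compose2[OF contQ] continuous_intros)
          (auto simp: I_def J_def inS)
      have "continuous_on S (\<lambda>x. deriv_at Q x (1, 0))"
        by (intro smooth_on_continuous smooth_on_deriv_at S Q)
      then show "continuous_on (I \<times> cbox a2 t) (\<lambda>(s, r). deriv_at Q (s, r) (1, 0))"
        using t unfolding split_beta prod.collapse
        by (elim continuous_on_subset) (auto simp: I_def J_def inS)
    qed (auto simp: I_def)
    \<comment> \<open>By closedness the integrand is the derivative of \<open>P\<close> in the
      second variable. The value \<open>P (s, a2)\<close> subtracted here is the one contributed by
      the bottom edge.\<close>
    moreover have "((\<lambda>r. deriv_at Q (s, r) (1, 0)) has_integral P (s, t) - P (s, a2)) {a2..t}"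
    proof (rule fundamental_theorem_of_calculus)
      show "a2 \<le> t" using t by (simp add: J_def)
      fix r assume "r \<in> {a2..t}"
      then have "(s, r) \<in> S" using s t by (intro inS) (auto simp: I_def J_def)
      then have "P differentiable at ((s, 0) + r *\<^sub>R (0, 1))"
        using smooth_on_differentiable[OF P] by simp
      from has_vector_derivative_along[OF this]
      show "((\<lambda>r. P (s, r)) has_vector_derivative deriv_at Q (s, r) (1, 0)) (at r within {a2..t})"
        using closed[OF \<open>(s, r) \<in> S\<close>] by (simp add: has_vector_derivative_at_within)
    qed
    ultimately have "((\<lambda>s. integral {a2..t} (\<lambda>r. Q (s, r))) has_real_derivative P (s, t) - P (s, a2)) (at s within I)"
      by (simp add: integral_unique)
    from DERIV_add[OF 1 this] show ?thesis
      unfolding U_def has_field_derivative_def by (simp add: mult_commute_abs)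
  qed
  \<comment> \<open>This partial derivative is stated as a bounded linear function because total
    differentiability requires it to be continuous in the point.\<close>
  have Ut: "((\<lambda>t. U s t) has_derivative blinfun_apply (blinfun_scaleR_left (Q (s, t)))) (at t within J)"
    if s: "s \<in> I" and t: "t \<in> J" for s t
  proof -
    have "continuous_on {a2..b2} (\<lambda>r. Q (s, r))"
      using s by (intro continuous_on_compose2[OF contQ] continuous_intros) (auto simp: I_def inS)
    from integral_has_real_derivative[OF this, of t]
    have "((\<lambda>t. integral {a2..t} (\<lambda>r. Q (s, r))) has_real_derivative Q (s, t)) (at t within J)"
      using t by (auto simp: J_def intro: DERIV_subset)
    from DERIV_add[OF DERIV_const this] show ?thesis
      unfolding U_def has_field_derivative_def by (simp add: mult_commute_abs)
  qed
  have IJ: "open (I \<times> J)" by (auto simp: I_def J_def intro: open_Times)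
  have "((\<lambda>(s, t). U s t) has_derivative (\<lambda>h. fst h * P x + snd h * Q x)) (at x)" if x: "x \<in> I \<times> J" for x
  proof -
    obtain s t where st: "x = (s, t)" "s \<in> I" "t \<in> J" using x by auto
    have sub: "I \<times> J \<subseteq> S" by (auto simp: I_def J_def inS)
    have "isCont Q (s, t)"
      using continuous_on_eq_continuous_at[OF S(1)] contQ sub x st(1) by blast
    then have "isCont (\<lambda>x. blinfun_scaleR_left (Q x)) (s, t)"
      by (rule bounded_linear.continuous[OF bounded_linear_blinfun_scaleR_left])
    then have c: "continuous (at (s, t) within I \<times> J) (\<lambda>(s, t). blinfun_scaleR_left (Q (s, t)))"
      unfolding split_beta prod.collapse by (rule continuous_at_imp_continuous_at_within)
    have "((\<lambda>(s, t). U s t) has_derivative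
        (\<lambda>(h, k). h * P (s, t) + blinfun_apply (blinfun_scaleR_left (Q (s, t))) k)) (at (s, t) within I \<times> J)"
      by (rule has_derivative_partialsI[OF Us[OF st(2,3)] Ut c st(3)]) (auto simp: J_def)
    then show ?thesis
      using at_within_open[OF x IJ] by (simp add: st(1) case_prod_unfold)
  qed
  moreover have "x0 \<in> I \<times> J" using ab(2) by (cases x0) (auto simp: ab12 mem_box Basis_prod_def I_def J_def)
  moreover have "I \<times> J \<subseteq> S" by (auto simp: I_def J_def inS)
  ultimately show thesis using IJ that by blast
qed

lemma independent_of_fst:
  fixes F :: "plane \<Rightarrow> real"
  assumes "convex I" and "\<And>y. y \<in> I \<times> J \<Longrightarrow> (F has_derivative (\<lambda>h. snd h * F' y)) (at y)"
    and "s \<in> I" "s' \<in> I" "t \<in> J"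
  shows "F (s, t) = F (s', t)"
proof -
  have "((\<lambda>s. F (s, t)) has_real_derivative 0) (at s within I)" if "s \<in> I" for s
  proof -
    have "((\<lambda>s. (s, t)) has_derivative (\<lambda>h. (h, 0))) (at s within I)"
      by (auto intro!: derivative_eq_intros)
    from has_derivative_compose[OF this assms(2)] that assms(5) show ?thesis
      by (simp add: has_field_derivative_def mult_zero_left[abs_def])
  qed
  from has_field_derivative_zero_constant[OF assms(1) this] assms(3,4) show ?thesis by auto
qed

lemma independent_of_snd:
  fixes F :: "plane \<Rightarrow> real"
  assumes "convex J" and "\<And>y. y \<in> I \<times> J \<Longrightarrow> (F has_derivative (\<lambda>h. fst h * F' y)) (at y)"
    and "s \<in> I" "t \<in> J" "t' \<in> J"
  shows "F (s, t) = F (s, t')"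
proof -
  have "((\<lambda>t. F (s, t)) has_real_derivative 0) (at t within J)" if "t \<in> J" for t
  proof -
    have "((\<lambda>t. (s, t)) has_derivative (\<lambda>h. (0, h))) (at t within J)"
      by (auto intro!: derivative_eq_intros)
    from has_derivative_compose[OF this assms(2)] that assms(3) show ?thesis
      by (simp add: has_field_derivative_def mult_zero_left[abs_def])
  qed
  from has_field_derivative_zero_constant[OF assms(1) this] assms(4,5) show ?thesis by auto
qed

lemma has_real_derivative_fst:
  fixes F :: "plane \<Rightarrow> real"
  assumes "(F has_derivative (\<lambda>h. fst h * d)) (at (s, t))"
  shows "((\<lambda>s. F (s, t)) has_real_derivative d) (at s)"
proof -
  have "((\<lambda>s. (s, t)) has_derivative (\<lambda>h. (h, 0))) (at s)"
    by (auto intro!: derivative_eq_intros)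
  from has_derivative_compose[OF this assms] show ?thesis
    by (simp add: has_field_derivative_def mult.commute[of _ d])
qed

lemma has_real_derivative_snd:
  fixes F :: "plane \<Rightarrow> real"
  assumes "(F has_derivative (\<lambda>h. snd h * d)) (at (s, t))"
  shows "((\<lambda>t. F (s, t)) has_real_derivative d) (at t)"
proof -
  have "((\<lambda>t. (s, t)) has_derivative (\<lambda>h. (0, h))) (at t)"
    by (auto intro!: derivative_eq_intros)
  from has_derivative_compose[OF this assms] show ?thesis
    by (simp add: has_field_derivative_def mult.commute[of _ d])
qed

lemma DERIV_unique_open:
  assumes "open I" "s \<in> I" "\<And>s. s \<in> I \<Longrightarrow> f s = h s"
    and "(f has_real_derivative c) (at s)" "(h has_real_derivative d) (at s)"
  shows "c = (d::real)"
  using DERIV_unique[OF assms(4)] has_field_derivative_transform_within_open[OF assms(5,1,2)] assms(3)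
  by simp

lemma cos_sin_double_arctan:
  "cos (- 2 * arctan r) = (1 - r\<^sup>2) / (1 + r\<^sup>2)" "sin (- 2 * arctan r) = - 2 * r / (1 + r\<^sup>2)"
proof -
  have pos: "1 + r\<^sup>2 > 0" by (simp add: add_pos_nonneg)
  have c: "(cos (arctan r))\<^sup>2 = 1 / (1 + r\<^sup>2)"
    using pos by (simp add: cos_arctan power_divide)
  have s: "sin (arctan r) = r * cos (arctan r)"
    by (simp add: sin_arctan cos_arctan)
  have "cos (- 2 * arctan r) = (cos (arctan r))\<^sup>2 - (sin (arctan r))\<^sup>2"
    by (simp add: cos_double)
  also have "\<dots> = (1 - r\<^sup>2) * (cos (arctan r))\<^sup>2" by (simp add: s algebra_simps)
  finally show "cos (- 2 * arctan r) = (1 - r\<^sup>2) / (1 + r\<^sup>2)" by (simp add: c)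
  have "sin (- 2 * arctan r) = - 2 * r * (cos (arctan r))\<^sup>2"
    by (simp add: sin_double s power2_eq_square)
  then show "sin (- 2 * arctan r) = - 2 * r / (1 + r\<^sup>2)" by (simp add: c)
qed

text \<open>The rate \<open>a\<close> of rotation is a function of \<open>v\<close> alone since it is determined by \<open>C\<close> and \<open>s\<close>, and a
  function of \<open>u\<close> alone since it is determined by \<open>L\<close> and its derivative; hence it is constant.\<close>

lemma separated_system:
  fixes L K C s :: "plane \<Rightarrow> real"
  assumes I: "open I" "convex I" "u0 \<in> I" and J: "open J" "convex J" "v0 \<in> J"
    and a: "\<And>y. a y = - 2 * (L y)\<^sup>2 / (1 + (L y)\<^sup>2) - K y * ((L y)\<^sup>2 - 1) / (1 + (L y)\<^sup>2)"
    and dL: "\<And>y. y \<in> I \<times> J \<Longrightarrow> (L has_derivative (\<lambda>h. fst h * (K y / 2 * (1 + (L y)\<^sup>2)))) (at y)"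
    and dC: "\<And>y. y \<in> I \<times> J \<Longrightarrow> (C has_derivative (\<lambda>h. snd h * (- s y * a y))) (at y)"
    and ds: "\<And>y. y \<in> I \<times> J \<Longrightarrow> (s has_derivative (\<lambda>h. snd h * (C y * a y))) (at y)"
    and L: "\<And>y. y \<in> I \<times> J \<Longrightarrow> (L y)\<^sup>2 \<noteq> 1"
    and Cs: "\<And>y. y \<in> I \<times> J \<Longrightarrow> (C y)\<^sup>2 + (s y)\<^sup>2 = 1"
  shows "\<exists>\<alpha> a0 \<omega>0. \<forall>u\<in>I. \<forall>v\<in>J. cos (\<alpha> u) \<noteq> 0 \<and>
    (\<alpha> has_real_derivative 1 - (a0 + 1) / cos (\<alpha> u)) (at u) \<and>
    \<alpha> u = - 2 * arctan (L (u, v)) \<and>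
    C (u, v) = cos (a0 * v + \<omega>0) \<and> s (u, v) = sin (a0 * v + \<omega>0)"
proof -
  have pos: "1 + r\<^sup>2 \<noteq> 0" for r :: real by (smt (verit) zero_le_power2)
  have Lv: "L (u, v) = L (u, v')" if "u \<in> I" "v \<in> J" "v' \<in> J" for u v v'
    by (rule independent_of_snd[OF J(2) dL that])
  have Cu: "C (u, v) = C (u', v)" if "u \<in> I" "u' \<in> I" "v \<in> J" for u u' v
    by (rule independent_of_fst[OF I(2) dC that])
  have su: "s (u, v) = s (u', v)" if "u \<in> I" "u' \<in> I" "v \<in> J" for u u' v
    by (rule independent_of_fst[OF I(2) ds that])
  have Kv: "K (u, v) = K (u, v0)" if "u \<in> I" "v \<in> J" for u v
  proof -
    have "K (u, v) / 2 * (1 + (L (u, v))\<^sup>2) = K (u, v0) / 2 * (1 + (L (u, v0))\<^sup>2)"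
      by (rule DERIV_unique_open[OF I(1) that(1) Lv[OF _ that(2) J(3)]
            has_real_derivative_fst[OF dL] has_real_derivative_fst[OF dL]])
        (use that J(3) in auto)
    then show ?thesis unfolding Lv[OF that J(3)] using pos by simp
  qed
  have av: "a (u, v) = a (u, v0)" if "u \<in> I" "v \<in> J" for u v
    unfolding a using Lv[OF that J(3)] Kv[OF that] by simp
  \<comment> \<open>The functions \<open>C\<close> and \<open>s\<close> do not depend on u, hence
    neither do their derivatives in v; as they never vanish together, the common factor
    \<open>a\<close> can be cancelled from one of them.\<close>
  have au: "a (u, v) = a (u0, v)" if "u \<in> I" "v \<in> J" for u v
  proof -
    have 1: "- s (u, v) * a (u, v) = - s (u0, v) * a (u0, v)"
      by (rule DERIV_unique_open[OF J(1) that(2) Cu[OF that(1) I(3)]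
            has_real_derivative_snd[OF dC] has_real_derivative_snd[OF dC]])
        (use that I(3) in auto)
    have 2: "C (u, v) * a (u, v) = C (u0, v) * a (u0, v)"
      by (rule DERIV_unique_open[OF J(1) that(2) su[OF that(1) I(3)]
            has_real_derivative_snd[OF ds] has_real_derivative_snd[OF ds]])
        (use that I(3) in auto)
    have "s (u, v) \<noteq> 0 \<or> C (u, v) \<noteq> 0" using Cs[of "(u, v)"] that by auto
    with 1 2 show ?thesis using Cu[OF that(1) I(3) that(2)] su[OF that(1) I(3) that(2)] by auto
  qed
  define a0 where "a0 = a (u0, v0)"
  have a0: "a (u, v) = a0" if "u \<in> I" "v \<in> J" for u v
    using av[OF that] au[OF that(1) J(3)] by (simp add: a0_def)
  define \<alpha> where "\<alpha> u = - 2 * arctan (L (u, v0))" for u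
  have \<alpha>: "\<alpha> u = - 2 * arctan (L (u, v))" if "u \<in> I" "v \<in> J" for u v
    unfolding \<alpha>_def Lv[OF that J(3)] ..
  have cos\<alpha>: "cos (\<alpha> u) = (1 - (L (u, v0))\<^sup>2) / (1 + (L (u, v0))\<^sup>2)" for u
    unfolding \<alpha>_def cos_sin_double_arctan ..
  have cos\<alpha>_ne: "cos (\<alpha> u) \<noteq> 0" if "u \<in> I" for u
    unfolding cos\<alpha> using L[of "(u, v0)"] that J(3) pos[of "L (u, v0)"] by auto
  have d\<alpha>: "(\<alpha> has_real_derivative 1 - (a0 + 1) / cos (\<alpha> u)) (at u)" if u: "u \<in> I" for u
  proof -
    let ?L = "L (u, v0)" and ?K = "K (u, v0)"
    have y: "(u, v0) \<in> I \<times> J" using u J(3) by simp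
    have "(\<alpha> has_real_derivative - 2 * (inverse (1 + ?L\<^sup>2) * (?K / 2 * (1 + ?L\<^sup>2)))) (at u)"
      unfolding \<alpha>_def
      by (intro DERIV_cmult DERIV_chain2[OF DERIV_arctan] has_real_derivative_fst[OF dL[OF y]])
    moreover have "- 2 * (inverse (1 + ?L\<^sup>2) * (?K / 2 * (1 + ?L\<^sup>2))) = - ?K"
      using pos[of ?L] by (simp add: field_simps)
    moreover have "a0 = (- 2 * ?L\<^sup>2 - ?K * (?L\<^sup>2 - 1)) / (1 + ?L\<^sup>2)"
      using a0[OF u J(3)] unfolding a by (simp add: diff_divide_distrib)
    \<comment> \<open>The formula for \<open>a\<close>, rewritten with the cosine of \<alpha>.
      Together with \<alpha>' = - \<open>?K\<close> it is the differential equation.\<close>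
    then have "a0 + 1 = (1 + ?K) * cos (\<alpha> u)"
      using pos[of ?L] unfolding cos\<alpha> by (simp add: field_simps)
    then have "- ?K = 1 - (a0 + 1) / cos (\<alpha> u)" using cos\<alpha>_ne[OF u] by simp
    ultimately show ?thesis by simp
  qed
  let ?c = "\<lambda>v. C (u0, v)" and ?s = "\<lambda>v. s (u0, v)"
  have dc: "(?c has_real_derivative - ?s v * a0) (at v)" and dss: "(?s has_real_derivative ?c v * a0) (at v)"
    if "v \<in> J" for v
    using has_real_derivative_snd[OF dC, of u0 v] has_real_derivative_snd[OF ds, of u0 v] that I(3)
    by (simp_all add: a0)
  \<comment> \<open>Rotating the pair of \<open>?c\<close> and \<open>?s\<close> back by the angle
    \<open>a0 * v\<close> makes it constant. Working with the pair avoids the choice of a continuous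
    branch of the angle.\<close>
  have "((\<lambda>v. cos (a0 * v) * ?c v + sin (a0 * v) * ?s v) has_real_derivative 0) (at v within J)"
    "((\<lambda>v. cos (a0 * v) * ?s v - sin (a0 * v) * ?c v) has_real_derivative 0) (at v within J)"
    if "v \<in> J" for v
  proof -
    have t: "((\<lambda>v. cos (a0 * v)) has_real_derivative - (sin (a0 * v) * a0)) (at v)"
      "((\<lambda>v. sin (a0 * v)) has_real_derivative cos (a0 * v) * a0) (at v)"
      using DERIV_fun_cos[OF DERIV_cmult_Id, of a0 v] DERIV_fun_sin[OF DERIV_cmult_Id, of a0 v]
      by simp_all
    have "((\<lambda>v. cos (a0 * v) * ?c v + sin (a0 * v) * ?s v) has_real_derivative 0) (at v)"
      using DERIV_add[OF DERIV_mult[OF t(1) dc[OF that]] DERIV_mult[OF t(2) dss[OF that]]]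
      by (simp add: mult_ac)
    then show "((\<lambda>v. cos (a0 * v) * ?c v + sin (a0 * v) * ?s v) has_real_derivative 0) (at v within J)"
      by (rule has_field_derivative_at_within)
    have "((\<lambda>v. cos (a0 * v) * ?s v - sin (a0 * v) * ?c v) has_real_derivative 0) (at v)"
      using DERIV_diff[OF DERIV_mult[OF t(1) dss[OF that]] DERIV_mult[OF t(2) dc[OF that]]]
      by (simp add: mult_ac)
    then show "((\<lambda>v. cos (a0 * v) * ?s v - sin (a0 * v) * ?c v) has_real_derivative 0) (at v within J)"
      by (rule has_field_derivative_at_within)
  qed
  from has_field_derivative_zero_constant[OF J(2) this(1)] has_field_derivative_zero_constant[OF J(2) this(2)]
  obtain k l where k: "\<And>v. v \<in> J \<Longrightarrow> cos (a0 * v) * ?c v + sin (a0 * v) * ?s v = k"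
    and l: "\<And>v. v \<in> J \<Longrightarrow> cos (a0 * v) * ?s v - sin (a0 * v) * ?c v = l"
    by metis
  have rot: "(cos t * x + sin t * y)\<^sup>2 + (cos t * y - sin t * x)\<^sup>2 = x\<^sup>2 + y\<^sup>2" for t x y :: real
  proof -
    have "(cos t * x + sin t * y)\<^sup>2 + (cos t * y - sin t * x)\<^sup>2 = ((sin t)\<^sup>2 + (cos t)\<^sup>2) * (x\<^sup>2 + y\<^sup>2)"
      by algebra
    then show ?thesis by simp
  qed
  \<comment> \<open>The rotation preserved the length, so the constant pair is a point of the unit
    circle and \<open>\<omega>0\<close> is its angle.\<close>
  have "k\<^sup>2 + l\<^sup>2 = 1"
    unfolding k[OF J(3), symmetric] l[OF J(3), symmetric] rot using Cs[of "(u0, v0)"] I(3) J(3) by simp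
  then obtain \<omega>0 where \<omega>0: "k = cos \<omega>0" "l = sin \<omega>0"
    using sincos_total_2pi by metis
  have inv: "x = cos t * (cos t * x + sin t * y) - sin t * (cos t * y - sin t * x)"
    "y = sin t * (cos t * x + sin t * y) + cos t * (cos t * y - sin t * x)" for t x y :: real
  proof -
    have "cos t * (cos t * x + sin t * y) - sin t * (cos t * y - sin t * x) = ((sin t)\<^sup>2 + (cos t)\<^sup>2) * x"
      "sin t * (cos t * x + sin t * y) + cos t * (cos t * y - sin t * x) = ((sin t)\<^sup>2 + (cos t)\<^sup>2) * y"
      by algebra+
    then show "x = cos t * (cos t * x + sin t * y) - sin t * (cos t * y - sin t * x)"
      "y = sin t * (cos t * x + sin t * y) + cos t * (cos t * y - sin t * x)" by simp_all
  qed
  have "C (u, v) = cos (a0 * v + \<omega>0)" "s (u, v) = sin (a0 * v + \<omega>0)" if "u \<in> I" "v \<in> J" for u v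
    using inv[where x = "?c v" and t = "a0 * v" and y = "?s v"] Cu[OF that(1) I(3) that(2)] su[OF that(1) I(3) that(2)]
    unfolding k[OF that(2)] l[OF that(2)] \<omega>0
    by (simp_all add: cos_add sin_add)
  with cos\<alpha>_ne d\<alpha> \<alpha> show ?thesis by (intro exI[of _ \<alpha>] exI[of _ a0] exI[of _ \<omega>0]) blast
qed

section \<open>Adapted coordinates of a totally geodesic field\<close>

locale generic_geodesic_frame = orthonormal_frame +
  assumes geodesic: "\<forall>x\<in>S. \<forall>a b. \<exists>c. geodesic_coeff x a b c"
    and generic: "x \<in> S \<Longrightarrow> (A x)\<^sup>2 + (B x)\<^sup>2 \<noteq> 0" "x \<in> S \<Longrightarrow> (A x)\<^sup>2 + (B x)\<^sup>2 \<noteq> 1"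
begin

text \<open>The forms \<open>\<omega>1\<close> and \<open>\<omega>2\<close> will be \<open>du\<close> and \<open>dv\<close>, with dual frame \<open>E1\<close>, \<open>E2\<close>. The factor of \<open>\<eta>\<close> in
  \<open>\<omega>2\<close> is \<open>1 / (len * sin \<alpha>)\<close> for \<open>\<alpha> = - 2 arctan len\<close>.\<close>

definition m :: "plane \<Rightarrow> real" where "m x = (A x)\<^sup>2 + (B x)\<^sup>2"

definition len :: "plane \<Rightarrow> real" where "len x = sqrt (m x)"

text \<open>The form \<eta> turned by a right angle: it has the same length, and N \<and> \<eta> is
  \<open>m\<close> times the area form.\<close>

definition N :: "plane \<Rightarrow> plane \<Rightarrow> real" where "N x a = B x * p x a - A x * q x a"

definition \<omega>1 :: "plane \<Rightarrow> plane \<Rightarrow> real" where "\<omega>1 x a = N x a / len x"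

definition \<omega>2 :: "plane \<Rightarrow> plane \<Rightarrow> real" where "\<omega>2 x a = - (1 + m x) / (2 * m x) * \<eta> x a"

definition E1 :: "plane \<Rightarrow> plane" where
  "E1 x = (1 / len x) *\<^sub>R (B x *\<^sub>R \<xi> x - A x *\<^sub>R \<zeta> x)"

definition E2 :: "plane \<Rightarrow> plane" where
  "E2 x = (- 2 / (1 + m x)) *\<^sub>R (A x *\<^sub>R \<xi> x + B x *\<^sub>R \<zeta> x)"

lemma m_pos: "x \<in> S \<Longrightarrow> m x > 0"
  using generic(1)[of x] by (simp add: m_def order.not_eq_order_implies_strict)

lemma len_pos: "x \<in> S \<Longrightarrow> len x > 0"
  using m_pos by (simp add: len_def)

lemma len_sq: "x \<in> S \<Longrightarrow> len x * len x = m x"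
  using m_pos[of x] by (simp add: len_def)

lemma smooth_A: "smooth_on S A" and smooth_B: "smooth_on S B"
  by (intro smooth_\<eta>_field smooth_\<xi> smooth_\<zeta>)+

lemma smooth_m: "smooth_on S m"
  unfolding m_def by (intro smooth_intros open_S smooth_A smooth_B)

lemma smooth_len: "smooth_on S len"
  unfolding len_def by (intro smooth_on_sqrt open_S smooth_m m_pos)

lemma smooth_\<omega>1: "smooth_on S (\<lambda>x. \<omega>1 x a)"
  unfolding \<omega>1_def N_def
  using len_pos by (intro smooth_on_divide smooth_on_diff smooth_on_mult open_S smooth_A smooth_B smooth_len
      smooth_g_fields smooth_\<xi> smooth_\<zeta> smooth_on_const) force

lemma smooth_\<omega>2: "smooth_on S (\<lambda>x. \<omega>2 x a)"
  unfolding \<omega>2_def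
  using m_pos by (intro smooth_on_divide smooth_on_add smooth_on_minus smooth_on_mult open_S smooth_m
      smooth_\<eta> smooth_on_const) force

lemma smooth_E1: "smooth_on S E1"
  unfolding E1_def
  using len_pos by (intro smooth_on_divide smooth_on_diff smooth_on_scaleR open_S smooth_A smooth_B smooth_len
      smooth_\<xi> smooth_\<zeta> smooth_on_const) force

lemma smooth_E2: "smooth_on S E2"
  unfolding E2_def
  using m_pos by (intro smooth_on_divide smooth_on_add smooth_on_scaleR open_S smooth_A smooth_B smooth_m
      smooth_\<xi> smooth_\<zeta> smooth_on_const) (smt (verit))

lemma coframe_values:
  assumes x: "x \<in> S"
  shows "p x (E1 x) = B x / len x" "q x (E1 x) = - A x / len x"
    "p x (E2 x) = - 2 * A x / (1 + m x)" "q x (E2 x) = - 2 * B x / (1 + m x)"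
  by (simp_all add: E1_def E2_def g_simps[OF x] frame_simps[OF x])

lemma dual_values:
  assumes x: "x \<in> S"
  shows "\<omega>1 x (E1 x) = 1" "\<omega>1 x (E2 x) = 0" "\<omega>2 x (E1 x) = 0" "\<omega>2 x (E2 x) = 1"
proof -
  have ne: "m x \<noteq> 0" "1 + m x \<noteq> 0" "len x \<noteq> 0" using m_pos[OF x] len_pos[OF x] by auto
  have mm: "B x * B x + A x * A x = m x" by (simp add: m_def power2_eq_square)
  show "\<omega>1 x (E1 x) = 1"
    using ne mm len_sq[OF x] by (simp add: \<omega>1_def N_def coframe_values[OF x] add_divide_distrib[symmetric])
  show "\<omega>1 x (E2 x) = 0" by (simp add: \<omega>1_def N_def coframe_values[OF x])
  show "\<omega>2 x (E1 x) = 0"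
    by (simp add: \<omega>2_def \<eta>_frame[OF x, of "E1 x"] coframe_values[OF x])
  have e: "\<eta> x (E2 x) = - 2 * m x / (1 + m x)"
    unfolding \<eta>_frame[OF x, of "E2 x"] coframe_values[OF x] mm[symmetric]
    by (simp add: add_divide_distrib[symmetric] diff_divide_distrib[symmetric] algebra_simps)
  show "\<omega>2 x (E2 x) = 1" unfolding \<omega>2_def e using ne by (simp add: divide_simps)
qed

lemma \<omega>_simps:
  assumes x: "x \<in> S"
  shows "\<omega>1 x (a + b) = \<omega>1 x a + \<omega>1 x b" "\<omega>1 x (r *\<^sub>R a) = r * \<omega>1 x a"
    "\<omega>2 x (a + b) = \<omega>2 x a + \<omega>2 x b" "\<omega>2 x (r *\<^sub>R a) = r * \<omega>2 x a"
  by (simp_all add: \<omega>1_def \<omega>2_def N_def g_simps[OF x] \<eta>_simps[OF x] add_divide_distrib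
      diff_divide_distrib algebra_simps)

lemma coordinate_expand:
  assumes x: "x \<in> S"
  shows "a = \<omega>1 x a *\<^sub>R E1 x + \<omega>2 x a *\<^sub>R E2 x"
proof (rule g_eqI[OF x])
  have ne: "m x \<noteq> 0" "1 + m x \<noteq> 0" "len x \<noteq> 0" using m_pos[OF x] len_pos[OF x] by auto
  have e: "\<omega>1 x a * (k / len x) = N x a * k / m x" "\<omega>2 x a * (- 2 * k / (1 + m x)) = \<eta> x a * k / m x" for k
    using ne by (simp_all add: \<omega>1_def \<omega>2_def len_sq[OF x] mult.assoc divide_simps)
      (simp_all add: len_sq[OF x, symmetric] algebra_simps)
  show "p x a = p x (\<omega>1 x a *\<^sub>R E1 x + \<omega>2 x a *\<^sub>R E2 x)"
    unfolding g_simps[OF x] coframe_values[OF x] e N_def \<eta>_frame[OF x, of a] add_divide_distrib[symmetric]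
    using ne by (simp add: eq_divide_eq) (simp add: m_def power2_eq_square algebra_simps)
  show "q x a = q x (\<omega>1 x a *\<^sub>R E1 x + \<omega>2 x a *\<^sub>R E2 x)"
    unfolding g_simps[OF x] coframe_values[OF x] e N_def \<eta>_frame[OF x, of a] add_divide_distrib[symmetric]
    using ne by (simp add: eq_divide_eq) (simp add: m_def power2_eq_square algebra_simps)
qed

text \<open>The forms N and \<eta> divided by their common length are an orthonormal coframe. The
  coefficient of the second square is the squared sine of 2 arctan \<open>len\<close>.\<close>

lemma metric_coordinates:
  assumes x: "x \<in> S"
  shows "g x a b = \<omega>1 x a * \<omega>1 x b + 4 * m x / (1 + m x)\<^sup>2 * (\<omega>2 x a * \<omega>2 x b)"
proof -
  have ne: "m x \<noteq> 0" "1 + m x \<noteq> 0" "len x \<noteq> 0" using m_pos[OF x] len_pos[OF x] by auto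
  have "\<omega>1 x a * \<omega>1 x b = N x a * N x b / m x"
    by (simp add: \<omega>1_def len_sq[OF x])
  moreover have "4 * m x / (1 + m x)\<^sup>2 * (\<omega>2 x a * \<omega>2 x b) = \<eta> x a * \<eta> x b / m x"
    using ne by (simp add: \<omega>2_def power2_eq_square divide_simps) (simp add: algebra_simps)
  moreover have "N x a * N x b + \<eta> x a * \<eta> x b = m x * g x a b"
    unfolding N_def \<eta>_frame[OF x, of a] \<eta>_frame[OF x, of b] g_expand[OF x, of a b] m_def
    by (simp add: power2_eq_square algebra_simps)
  ultimately show ?thesis using ne by (simp add: add_divide_distrib[symmetric])
qed

lemma has_derivative_m:
  "x \<in> S \<Longrightarrow> (m has_derivative (\<lambda>a. \<kappa> x * (1 + m x) * N x a)) (at x)"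
  unfolding m_def[abs_def] N_def by (rule has_derivative_norm_\<eta>[OF geodesic])

lemma has_derivative_len:
  assumes x: "x \<in> S"
  shows "(len has_derivative (\<lambda>a. \<kappa> x / 2 * (1 + m x) * \<omega>1 x a)) (at x)"
proof -
  have D: "DERIV sqrt (m x) :> inverse (len x) / 2"
    unfolding len_def by (rule DERIV_real_sqrt[OF m_pos[OF x]])
  have "((\<lambda>z. sqrt (m z)) has_derivative (\<lambda>a. (\<kappa> x * (1 + m x) * N x a) * (inverse (len x) / 2))) (at x)"
    by (rule DERIV_compose_FDERIV[OF D has_derivative_m[OF x]])
  moreover have "(\<kappa> x * (1 + m x) * N x a) * (inverse (len x) / 2) = \<kappa> x / 2 * (1 + m x) * \<omega>1 x a" for a
    by (simp add: \<omega>1_def field_simps)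
  ultimately have "((\<lambda>z. sqrt (m z)) has_derivative (\<lambda>a. \<kappa> x / 2 * (1 + m x) * \<omega>1 x a)) (at x)"
    by (simp only:)
  then show ?thesis
    by (rule iffD1[OF has_derivative_cong_open[OF open_S x], rotated]) (simp add: len_def)
qed

text \<open>The form N itself is closed by the structure equations, and dividing by
  \<open>len\<close> preserves this because the differential of \<open>len\<close> is a multiple of
  N.\<close>

lemma closed_\<omega>1:
  assumes x: "x \<in> S"
  shows "deriv_at (\<lambda>z. \<omega>1 z b) x a = deriv_at (\<lambda>z. \<omega>1 z a) x b"
proof -
  have ne: "m x \<noteq> 0" "len x \<noteq> 0" using m_pos[OF x] len_pos[OF x] by auto
  note dA = has_derivative_A[OF geodesic x] and dB = has_derivative_B[OF geodesic x]
  have N: "((\<lambda>z. N z b) has_derivative (\<lambda>a.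
      (B x * (p x (christoffel g x a b) + \<eta> x a * q x b) + (- A x * \<eta> x a
        + \<kappa> x / 2 * ((1 + (B x)\<^sup>2 - (A x)\<^sup>2) * p x a - 2 * A x * B x * q x a)) * p x b)
    - (A x * (q x (christoffel g x a b) - \<eta> x a * p x b) + (B x * \<eta> x a
        + \<kappa> x / 2 * (2 * A x * B x * p x a + ((B x)\<^sup>2 - (A x)\<^sup>2 - 1) * q x a)) * q x b))) (at x)" for b
    unfolding N_def
    by (intro has_derivative_diff has_derivative_mult dA dB deriv_coframe x)
  have sym: "deriv_at (\<lambda>z. N z b) x a = deriv_at (\<lambda>z. N z a) x b"
    unfolding deriv_at_eqI[OF N] christoffel_sym[OF x, of b a] \<eta>_frame[OF x, of a] \<eta>_frame[OF x, of b]
    by (simp add: power2_eq_square field_simps)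
  have N': "((\<lambda>z. N z b) has_derivative deriv_at (\<lambda>z. N z b) x) (at x)" for b
    using N has_deriv_at[OF differentiableI] by blast
  have "((\<lambda>z. \<omega>1 z b) has_derivative
     (\<lambda>a. (deriv_at (\<lambda>z. N z b) x a * len x - N x b * (\<kappa> x / 2 * (1 + m x) * \<omega>1 x a)) / (len x * len x))) (at x)" for b
    unfolding \<omega>1_def[of _ b] using has_derivative_divide'[OF N' has_derivative_len[OF x] ne(2)] by simp
  from deriv_at_eqI[OF this] show ?thesis
    by (simp add: sym \<omega>1_def)
qed

text \<open>The derivative of the factor contributes a multiple of N \<and> \<eta> and the
  derivative of \<eta> a multiple of the area form; the factor is chosen so that they
  cancel.\<close>

lemma closed_\<omega>2:
  assumes x: "x \<in> S"
  shows "deriv_at (\<lambda>z. \<omega>2 z b) x a = deriv_at (\<lambda>z. \<omega>2 z a) x b"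
proof -
  have ne: "m x \<noteq> 0" using m_pos[OF x] by auto
  have d: "deriv_at (\<lambda>z. \<omega>2 z b) x a =
     - (1 + m x) / (2 * m x) * deriv_at (\<lambda>z. \<eta> z b) x a
     + (\<kappa> x * (1 + m x) * N x a) / (2 * m x * m x) * \<eta> x b" for a b
  proof -
    have "((\<lambda>z. 1 + m z) has_derivative (\<lambda>a. \<kappa> x * (1 + m x) * N x a)) (at x)"
      using has_derivative_add[OF has_derivative_const has_derivative_m[OF x], of 1] by simp
    from has_derivative_mult[OF has_derivative_divide'[OF has_derivative_minus[OF this]
        has_derivative_mult_right[OF has_derivative_m[OF x], of 2]] has_derivative_\<eta>[OF x, of b]] ne
    have D: "((\<lambda>z. \<omega>2 z b) has_derivative (\<lambda>a. - (1 + m x) / (2 * m x) * deriv_at (\<lambda>z. \<eta> z b) x a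
      + (- (\<kappa> x * (1 + m x) * N x a) * (2 * m x) - - (1 + m x) * (2 * (\<kappa> x * (1 + m x) * N x a)))
        / (2 * m x * (2 * m x)) * \<eta> x b)) (at x)"
      unfolding \<omega>2_def by simp
    have "(- (\<kappa> x * (1 + m x) * N x a) * (2 * m x) - - (1 + m x) * (2 * (\<kappa> x * (1 + m x) * N x a)))
        / (2 * m x * (2 * m x)) = (\<kappa> x * (1 + m x) * N x a) / (2 * m x * m x)"
      using ne by (simp add: divide_simps) (simp add: algebra_simps)
    then show ?thesis unfolding deriv_at_eqI[OF D] by simp
  qed
  have "deriv_at (\<lambda>z. \<eta> z b) x a - deriv_at (\<lambda>z. \<eta> z a) x b = \<kappa> x * (p x a * q x b - p x b * q x a)"
    using d\<eta>_frame[OF x, of a b] by (simp add: d\<eta>_def)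
  moreover have "N x a * \<eta> x b - N x b * \<eta> x a = m x * (p x a * q x b - p x b * q x a)"
    unfolding N_def \<eta>_frame[OF x, of a] \<eta>_frame[OF x, of b] m_def
    by (simp add: power2_eq_square algebra_simps)
  moreover have "deriv_at (\<lambda>z. \<omega>2 z b) x a - deriv_at (\<lambda>z. \<omega>2 z a) x b =
      - (1 + m x) / (2 * m x) * (deriv_at (\<lambda>z. \<eta> z b) x a - deriv_at (\<lambda>z. \<eta> z a) x b)
      + \<kappa> x * (1 + m x) / (2 * m x * m x) * (N x a * \<eta> x b - N x b * \<eta> x a)"
    unfolding d by (simp add: algebra_simps diff_divide_distrib add_divide_distrib)
  ultimately have "deriv_at (\<lambda>z. \<omega>2 z b) x a - deriv_at (\<lambda>z. \<omega>2 z a) x b =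
      - (1 + m x) / (2 * m x) * (\<kappa> x * (p x a * q x b - p x b * q x a))
      + \<kappa> x * (1 + m x) / (2 * m x * m x) * (m x * (p x a * q x b - p x b * q x a))"
    by (simp only:)
  also have "\<dots> = 0"
    using ne by (simp add: divide_simps) (simp add: algebra_simps)
  finally have "deriv_at (\<lambda>z. \<omega>2 z b) x a - deriv_at (\<lambda>z. \<omega>2 z a) x b = 0" .
  then show ?thesis by simp
qed

text \<open>The rate of rotation of the field relative to the coordinate frame, which is \<open>a\<close> in the end.\<close>

definition rate :: "plane \<Rightarrow> real" where
  "rate x = - 2 * m x / (1 + m x) - \<kappa> x * (m x - 1) / (1 + m x)"

text \<open>The algebra common to the two quotients in the next lemma: \<open>b / l\<close> is the
  component being differentiated, \<open>a / l\<close> the other one up to sign, and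
  \<open>y\<close> the curvature part of the derivative of \<open>b\<close>.\<close>

lemma quotient_identity:
  fixes a b e k l M n y :: real
  assumes "l \<noteq> 0" "l * l = M" "M \<noteq> 0" "y * M = b * (1 + M) * n - a * (M - 1) * e"
  shows "((- a * e + k / 2 * y) * l - b * (k / 2 * (1 + M) * (n / l))) / (l * l)
    = - (a / l) * (e + k * (M - 1) / (2 * M) * e)"
proof -
  have "((- a * e + k / 2 * y) * l - b * (k / 2 * (1 + M) * (n / l))) * l
    = - a * e * M + k / 2 * (y * M - b * (1 + M) * n)"
    using assms(1) by (simp add: assms(2)[symmetric] field_simps)
  also have "\<dots> = - a * (M * e + k * (M - 1) / 2 * e)"
    unfolding assms(4) by (simp add: field_simps)
  also have "\<dots> = - a * M * (e + k * (M - 1) / (2 * M) * e)"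
    using assms(3) by (simp add: field_simps)
  finally have *: "((- a * e + k / 2 * y) * l - b * (k / 2 * (1 + M) * (n / l))) * l
    = - a * M * (e + k * (M - 1) / (2 * M) * e)" .
  have "x / (l * l) = - (a / l) * c" if "x * l = - a * M * c" for x c
  proof -
    have "x = - a * l * c" using that assms(1,2) by (metis mult.assoc mult.commute mult_right_cancel)
    then show ?thesis using assms(1) by simp
  qed
  from this[OF *] show ?thesis .
qed

text \<open>The two quotients are the cosine and the sine of the angle from \<open>E1\<close> to
  \<open>\<xi>\<close>. The equations say that this angle has differential \<open>rate\<close> times
  \<open>\<omega>2\<close>.\<close>

lemma has_derivative_direction:
  assumes x: "x \<in> S"
  shows "((\<lambda>z. B z / len z) has_derivative (\<lambda>a. - (A x / len x) * (rate x * \<omega>2 x a))) (at x)"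
    "((\<lambda>z. A z / len z) has_derivative (\<lambda>a. (B x / len x) * (rate x * \<omega>2 x a))) (at x)"
proof -
  have ne: "m x \<noteq> 0" "len x \<noteq> 0" "1 + m x \<noteq> 0" using m_pos[OF x] len_pos[OF x] by auto
  have e: "rate x = - (2 * m x + \<kappa> x * (m x - 1)) / (1 + m x)"
    using ne by (simp add: rate_def divide_simps)
  have r: "rate x * \<omega>2 x a = \<eta> x a + \<kappa> x * (m x - 1) / (2 * m x) * \<eta> x a" for a
    unfolding e \<omega>2_def using ne by (simp add: divide_simps) (simp add: algebra_simps)
  show "((\<lambda>z. B z / len z) has_derivative (\<lambda>a. - (A x / len x) * (rate x * \<omega>2 x a))) (at x)"
  proof (rule has_derivative_eq_rhs[OF has_derivative_divide'[OF has_derivative_B[OF geodesic x]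
          has_derivative_len[OF x] ne(2)]], rule ext)
    fix a
    show "((- A x * \<eta> x a + \<kappa> x / 2 * ((1 + (B x)\<^sup>2 - (A x)\<^sup>2) * p x a - 2 * A x * B x * q x a)) * len x
        - B x * (\<kappa> x / 2 * (1 + m x) * \<omega>1 x a)) / (len x * len x)
      = - (A x / len x) * (rate x * \<omega>2 x a)"
      unfolding r \<omega>1_def
      by (rule quotient_identity[OF ne(2) len_sq[OF x] ne(1)])
        (simp add: N_def m_def \<eta>_frame[OF x, of a], algebra)
  qed
  show "((\<lambda>z. A z / len z) has_derivative (\<lambda>a. (B x / len x) * (rate x * \<omega>2 x a))) (at x)"
  proof (rule has_derivative_eq_rhs[OF has_derivative_divide'[OF has_derivative_A[OF geodesic x]
          has_derivative_len[OF x] ne(2)]], rule ext)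
    fix a
    \<comment> \<open>The double minus matches the identity with - \<open>B x\<close> and
      \<open>A x\<close> in the places of \<open>A x\<close> and \<open>B x\<close>, a quarter turn
      of the pair.\<close>
    have "((- (- B x) * \<eta> x a + \<kappa> x / 2 * (2 * A x * B x * p x a + ((B x)\<^sup>2 - (A x)\<^sup>2 - 1) * q x a)) * len x
        - A x * (\<kappa> x / 2 * (1 + m x) * \<omega>1 x a)) / (len x * len x)
      = - (- B x / len x) * (rate x * \<omega>2 x a)"
      unfolding r \<omega>1_def
      by (rule quotient_identity[OF ne(2) len_sq[OF x] ne(1)])
        (simp add: N_def m_def \<eta>_frame[OF x, of a], algebra)
    then show "((B x * \<eta> x a + \<kappa> x / 2 * (2 * A x * B x * p x a + ((B x)\<^sup>2 - (A x)\<^sup>2 - 1) * q x a)) * len x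
        - A x * (\<kappa> x / 2 * (1 + m x) * \<omega>1 x a)) / (len x * len x)
      = B x / len x * (rate x * \<omega>2 x a)"
      by (simp only: minus_minus minus_divide_left[symmetric])
  qed
qed

end

context generic_geodesic_frame
begin

section \<open>Potentials as coordinates\<close>

lemma \<omega>_pair:
  assumes "x \<in> S"
  shows "fst h * \<omega>1 x (1, 0) + snd h * \<omega>1 x (0, 1) = \<omega>1 x h"
    "fst h * \<omega>2 x (1, 0) + snd h * \<omega>2 x (0, 1) = \<omega>2 x h"
proof -
  have "h = fst h *\<^sub>R (1, 0) + snd h *\<^sub>R (0, 1)" by (simp add: prod_eq_iff)
  then show "fst h * \<omega>1 x (1, 0) + snd h * \<omega>1 x (0, 1) = \<omega>1 x h"
    "fst h * \<omega>2 x (1, 0) + snd h * \<omega>2 x (0, 1) = \<omega>2 x h"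
    using \<omega>_simps[OF assms] by metis+
qed

lemma potentials:
  assumes x0: "x0 \<in> S"
  obtains T \<Phi> where "open T" "x0 \<in> T" "T \<subseteq> S" "smooth_on T \<Phi>"
    "\<And>x. x \<in> T \<Longrightarrow> (\<Phi> has_derivative (\<lambda>h. (\<omega>1 x h, \<omega>2 x h))) (at x)"
proof -
  obtain N1 u where N1: "open N1" "x0 \<in> N1" "N1 \<subseteq> S" and
    u: "\<And>x. x \<in> N1 \<Longrightarrow> (u has_derivative (\<lambda>h. fst h * \<omega>1 x (1, 0) + snd h * \<omega>1 x (0, 1))) (at x)"
    by (rule closed_form_potential[OF open_S x0 smooth_\<omega>1 smooth_\<omega>1 closed_\<omega>1]) auto
  obtain N2 v where N2: "open N2" "x0 \<in> N2" "N2 \<subseteq> S" and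
    v: "\<And>x. x \<in> N2 \<Longrightarrow> (v has_derivative (\<lambda>h. fst h * \<omega>2 x (1, 0) + snd h * \<omega>2 x (0, 1))) (at x)"
    by (rule closed_form_potential[OF open_S x0 smooth_\<omega>2 smooth_\<omega>2 closed_\<omega>2]) auto
  have d: "((\<lambda>x. (u x, v x)) has_derivative (\<lambda>h. (\<omega>1 x h, \<omega>2 x h))) (at x)" if x: "x \<in> N1 \<inter> N2" for x
  proof -
    have "x \<in> S" using x N1(3) by blast
    with x show ?thesis
      by (intro has_derivative_eq_rhs[OF has_derivative_Pair[OF u v]]) (simp_all only: \<omega>_pair Int_iff)
  qed
  have o: "open (N1 \<inter> N2)" using N1 N2 by auto
  have "smooth_on (N1 \<inter> N2) (\<lambda>x. (u x, v x))"
    by (rule smooth_onI_deriv[OF o d])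
      (use N1 in \<open>auto intro!: smooth_on_Pair o smooth_on_subset[OF smooth_\<omega>1] smooth_on_subset[OF smooth_\<omega>2]\<close>)
  with d o show thesis using N1 N2 by (intro that[of "N1 \<inter> N2" "\<lambda>x. (u x, v x)"]) auto
qed

text \<open>The potentials are inverted locally, and the image is shrunk to a product of intervals
  because the separation of variables moves along coordinate lines.\<close>

lemma coordinate_box:
  assumes x0: "x0 \<in> S"
  obtains T I J \<Phi> \<Theta> where "open T" "x0 \<in> T" "T \<subseteq> S"
    "open I" "convex I" "open J" "convex J" "homeomorphism T (I \<times> J) \<Phi> \<Theta>" "smooth_on T \<Phi>"
    "\<forall>x\<in>T. (\<Phi> has_derivative (\<lambda>h. (\<omega>1 x h, \<omega>2 x h))) (at x)"
    "\<forall>y\<in>I \<times> J.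
      (\<Theta> has_derivative (\<lambda>h. fst h *\<^sub>R E1 (\<Theta> y) + snd h *\<^sub>R E2 (\<Theta> y))) (at y)"
proof -
  obtain T \<Phi> where T: "open T" "x0 \<in> T" "T \<subseteq> S" and \<Phi>: "smooth_on T \<Phi>"
    "\<And>x. x \<in> T \<Longrightarrow> (\<Phi> has_derivative (\<lambda>h. (\<omega>1 x h, \<omega>2 x h))) (at x)"
    using potentials[OF x0] by blast
  have bl: "bounded_linear (\<lambda>h. (\<omega>1 x h, \<omega>2 x h))" if "x \<in> T" for x
    using \<Phi>(2)[OF that] by (rule has_derivative_bounded_linear)
  have bl': "bounded_linear (\<lambda>h. fst h *\<^sub>R E1 x0 + snd h *\<^sub>R E2 x0)"
    by (intro bounded_linear_add bounded_linear_scaleR_const bounded_linear_fst bounded_linear_snd)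
  define F where "F x = Blinfun (\<lambda>h. (\<omega>1 x h, \<omega>2 x h))" for x
  have F: "blinfun_apply (F x) = (\<lambda>h. (\<omega>1 x h, \<omega>2 x h))" if "x \<in> T" for x
    unfolding F_def by (rule bounded_linear_Blinfun_apply[OF bl[OF that]])
  \<comment> \<open>The dual frame inverts the differential explicitly, so the abstract inverse in
    the inverse function theorem becomes a formula in \<open>E1\<close> and
    \<open>E2\<close>.\<close>
  have inverse: "(\<lambda>h. (\<omega>1 x h, \<omega>2 x h)) \<circ> (\<lambda>h. fst h *\<^sub>R E1 x + snd h *\<^sub>R E2 x) = id"
    "(\<lambda>h. fst h *\<^sub>R E1 x + snd h *\<^sub>R E2 x) \<circ> (\<lambda>h. (\<omega>1 x h, \<omega>2 x h)) = id" if "x \<in> T" for x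
    using that T(3) by (auto simp: fun_eq_iff \<omega>_simps dual_values simp flip: coordinate_expand)
  have dF: "(\<Phi> has_derivative blinfun_apply (F x)) (at x)" if "x \<in> T" for x
    using \<Phi>(2) F that by simp
  have contF: "continuous_on T F"
  proof (rule continuous_on_blinfun_componentwise)
    fix i :: plane
    have "continuous_on S (\<lambda>x. (\<omega>1 x i, \<omega>2 x i))"
      by (intro continuous_on_Pair smooth_on_continuous smooth_\<omega>1 smooth_\<omega>2)
    then have "continuous_on T (\<lambda>x. (\<omega>1 x i, \<omega>2 x i))" using T(3) by (rule continuous_on_subset)
    then show "continuous_on T (\<lambda>x. blinfun_apply (F x) i)"
      by (rule continuous_on_eq) (simp add: F)
  qed
  have invF: "Blinfun (\<lambda>h. fst h *\<^sub>R E1 x0 + snd h *\<^sub>R E2 x0) o\<^sub>L F x0 = id_blinfun"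
    using fun_cong[OF inverse(2)[OF T(2)]]
    by (intro blinfun_eqI) (simp add: F T(2) bounded_linear_Blinfun_apply[OF bl'])
  obtain U V \<Theta> \<Theta>' where U: "open U" "U \<subseteq> T" "x0 \<in> U" and V: "open V" "\<Phi> x0 \<in> V"
    and hom: "homeomorphism U V \<Phi> \<Theta>"
    and \<Theta>: "\<And>y. y \<in> V \<Longrightarrow> (\<Theta> has_derivative \<Theta>' y) (at y)"
    "\<And>y. y \<in> V \<Longrightarrow> \<Theta>' y = inv (blinfun_apply (F (\<Theta> y)))"
    by (rule inverse_function_theorem[OF T(1) dF contF T(2) invF]) (assumption, (rule that; simp))
  have \<Theta>V: "\<Theta> y \<in> T" if "y \<in> V" for y using hom U(2) that by (auto simp: homeomorphism_def)
  have d\<Theta>: "(\<Theta> has_derivative (\<lambda>h. fst h *\<^sub>R E1 (\<Theta> y) + snd h *\<^sub>R E2 (\<Theta> y))) (at y)" if "y \<in> V" for y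
  proof -
    have "\<Theta>' y = (\<lambda>h. fst h *\<^sub>R E1 (\<Theta> y) + snd h *\<^sub>R E2 (\<Theta> y))"
      unfolding \<Theta>(2)[OF that] F[OF \<Theta>V[OF that]]
      by (rule inv_unique_comp[OF inverse[OF \<Theta>V[OF that]]])
    with \<Theta>(1)[OF that] show ?thesis by simp
  qed
  obtain A' B' where AB: "open A'" "open B'" "\<Phi> x0 \<in> A' \<times> B'" "A' \<times> B' \<subseteq> V"
    using open_prod_elim[OF V] by blast
  obtain e1 e2 where e: "e1 > 0" "e2 > 0" "ball (fst (\<Phi> x0)) e1 \<subseteq> A'" "ball (snd (\<Phi> x0)) e2 \<subseteq> B'"
    using AB by (metis mem_Times_iff openE)
  define I J where "I = ball (fst (\<Phi> x0)) e1" and "J = ball (snd (\<Phi> x0)) e2"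
  have IJ: "I \<times> J \<subseteq> V" "\<Phi> x0 \<in> I \<times> J" using e AB(4) by (auto simp: I_def J_def mem_Times_iff)
  define T' where "T' = U \<inter> \<Phi> -` (I \<times> J)"
  have oT: "open T'"
    unfolding T'_def using hom
    by (intro continuous_open_preimage U(1) open_Times) (auto simp: homeomorphism_def I_def J_def)
  have "\<Phi> ` T' = I \<times> J"
  proof (intro equalityI subsetI)
    fix y assume y: "y \<in> I \<times> J"
    then have "\<Phi> (\<Theta> y) = y" "\<Theta> y \<in> U"
      using IJ(1) homeomorphism_apply2[OF hom] homeomorphism_image2[OF hom] by blast+
    with y show "y \<in> \<Phi> ` T'"
      by (intro image_eqI[of _ _ "\<Theta> y"]) (simp_all add: T'_def)
  qed (auto simp: T'_def)
  then have hom': "homeomorphism T' (I \<times> J) \<Phi> \<Theta>"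
    by (intro homeomorphism_of_subsets[OF hom]) (use IJ in \<open>auto simp: T'_def\<close>)
  have T': "T' \<subseteq> T" "x0 \<in> T'" using U IJ by (auto simp: T'_def)
  show thesis
  proof (rule that[OF oT T'(2) _ _ _ _ _ hom'])
    show "smooth_on T' \<Phi>" by (rule smooth_on_subset[OF \<Phi>(1) T'(1)])
    show "T' \<subseteq> S" using T' T by blast
    show "\<forall>x\<in>T'. (\<Phi> has_derivative (\<lambda>h. (\<omega>1 x h, \<omega>2 x h))) (at x)"
      using \<Phi>(2) T' by blast
    show "\<forall>y\<in>I \<times> J. (\<Theta> has_derivative (\<lambda>h. fst h *\<^sub>R E1 (\<Theta> y) + snd h *\<^sub>R E2 (\<Theta> y))) (at y)"
      using d\<Theta> IJ by blast
  qed (auto simp: I_def J_def)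
qed

text \<open>The conclusions are phrased through \<open>deriv_at \<Phi>\<close> at points of
  \<open>T\<close>, the shape in which the transition map to the new chart will use them.\<close>

lemma adapted_coordinates:
  assumes x0: "x0 \<in> S"
  obtains T R \<Phi> \<Theta> \<alpha> a \<omega>0 where "open T" "x0 \<in> T" "T \<subseteq> S" "open R"
    "homeomorphism T R \<Phi> \<Theta>" "smooth_on T \<Phi>" "smooth_on R \<Theta>"
    "\<And>x. x \<in> T \<Longrightarrow> cos (\<alpha> (fst (\<Phi> x))) \<noteq> 0"
    "\<And>x. x \<in> T \<Longrightarrow>
      (\<alpha> has_real_derivative 1 - (a + 1) / cos (\<alpha> (fst (\<Phi> x)))) (at (fst (\<Phi> x)))"
    "\<And>x b c. x \<in> T \<Longrightarrow> g x b c = fst (deriv_at \<Phi> x b) * fst (deriv_at \<Phi> x c)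
      + (sin (\<alpha> (fst (\<Phi> x))))\<^sup>2 * (snd (deriv_at \<Phi> x b) * snd (deriv_at \<Phi> x c))"
    "\<And>x. x \<in> T \<Longrightarrow> deriv_at \<Phi> x (\<xi> x) =
      (cos (a * snd (\<Phi> x) + \<omega>0), sin (a * snd (\<Phi> x) + \<omega>0) / sin (\<alpha> (fst (\<Phi> x))))"
proof -
  obtain T I J \<Phi> \<Theta> where T: "open T" "x0 \<in> T" "T \<subseteq> S"
    and IJ: "open I" "convex I" "open J" "convex J"
    and hom: "homeomorphism T (I \<times> J) \<Phi> \<Theta>" and \<Phi>: "smooth_on T \<Phi>"
    and "\<forall>x\<in>T. (\<Phi> has_derivative (\<lambda>h. (\<omega>1 x h, \<omega>2 x h))) (at x)"
    and "\<forall>y\<in>I \<times> J. (\<Theta> has_derivative (\<lambda>h. fst h *\<^sub>R E1 (\<Theta> y) + snd h *\<^sub>R E2 (\<Theta> y))) (at y)"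
    by (rule coordinate_box[OF x0]) blast
  then have d\<Phi>: "\<And>x. x \<in> T \<Longrightarrow> (\<Phi> has_derivative (\<lambda>h. (\<omega>1 x h, \<omega>2 x h))) (at x)"
    and d\<Theta>: "\<And>y. y \<in> I \<times> J \<Longrightarrow>
      (\<Theta> has_derivative (\<lambda>h. fst h *\<^sub>R E1 (\<Theta> y) + snd h *\<^sub>R E2 (\<Theta> y))) (at y)"
    by blast+
  have R: "open (I \<times> J)" by (intro open_Times IJ)
  have \<Theta>T: "\<Theta> y \<in> T" if "y \<in> I \<times> J" for y using hom that by (auto simp: homeomorphism_def)
  then have \<Theta>S: "\<Theta> y \<in> S" if "y \<in> I \<times> J" for y using T(3) that by blast
  \<comment> \<open>Bootstrapping: the partial derivatives of \<open>\<Theta>\<close> are the smooth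
    fields \<open>E1\<close> and \<open>E2\<close> evaluated along \<open>\<Theta>\<close>.\<close>
  have "Ck_on k (I \<times> J) \<Theta>" for k
  proof (induction k)
    case 0
    then show ?case using hom by (simp add: homeomorphism_def)
  next
    case (Suc k)
    have E: "Ck_on k (I \<times> J) (\<lambda>y. E1 (\<Theta> y))" "Ck_on k (I \<times> J) (\<lambda>y. E2 (\<Theta> y))"
      using \<Theta>S smooth_E1 smooth_E2
      by (auto intro!: Ck_on_compose[OF R open_S _ Suc] simp: smooth_on_def)
    show ?case
      by (rule Ck_on_SucI[OF R d\<Theta>])
        (auto intro!: Ck_on_add R Ck_on_bilinear[OF bounded_bilinear_scaleR] Ck_on_const E)
  qed
  then have \<Theta>: "smooth_on (I \<times> J) \<Theta>" by (simp add: smooth_on_def)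
  have chain: "((\<lambda>y. f (\<Theta> y)) has_derivative (\<lambda>h. f' (fst h *\<^sub>R E1 (\<Theta> y) + snd h *\<^sub>R E2 (\<Theta> y)))) (at y)"
    if "y \<in> I \<times> J" "(f has_derivative f') (at (\<Theta> y))" for f f' y
    by (rule has_derivative_compose[OF d\<Theta>[OF that(1)] that(2)])
  have dual: "\<omega>1 (\<Theta> y) (fst h *\<^sub>R E1 (\<Theta> y) + snd h *\<^sub>R E2 (\<Theta> y)) = fst h"
    "\<omega>2 (\<Theta> y) (fst h *\<^sub>R E1 (\<Theta> y) + snd h *\<^sub>R E2 (\<Theta> y)) = snd h" if "y \<in> I \<times> J" for y h
    using \<Theta>S[OF that] by (simp_all add: \<omega>_simps dual_values)
  have l: "(len x)\<^sup>2 = m x" if "x \<in> S" for x using len_sq[OF that] by (simp add: power2_eq_square)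
  define L K C s where "L y = len (\<Theta> y)" and "K y = \<kappa> (\<Theta> y)"
    and "C y = B (\<Theta> y) / len (\<Theta> y)" and "s y = A (\<Theta> y) / len (\<Theta> y)" for y
  define a where "a y = - 2 * (L y)\<^sup>2 / (1 + (L y)\<^sup>2) - K y * ((L y)\<^sup>2 - 1) / (1 + (L y)\<^sup>2)" for y
  have a: "a y = rate (\<Theta> y)" if "y \<in> I \<times> J" for y
    unfolding a_def L_def K_def rate_def l[OF \<Theta>S[OF that]] ..
  have \<Phi>0: "fst (\<Phi> x0) \<in> I" "snd (\<Phi> x0) \<in> J"
    using hom T(2) by (auto simp: homeomorphism_def)
  have "\<exists>\<alpha> a0 \<omega>0. \<forall>u\<in>I. \<forall>v\<in>J. cos (\<alpha> u) \<noteq> 0 \<and>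
    (\<alpha> has_real_derivative 1 - (a0 + 1) / cos (\<alpha> u)) (at u) \<and>
    \<alpha> u = - 2 * arctan (L (u, v)) \<and>
    C (u, v) = cos (a0 * v + \<omega>0) \<and> s (u, v) = sin (a0 * v + \<omega>0)"
  proof (rule separated_system[OF IJ(1,2) \<Phi>0(1) IJ(3,4) \<Phi>0(2) a_def])
    fix y assume y: "y \<in> I \<times> J"
    note x = \<Theta>S[OF y]
    show "(L has_derivative (\<lambda>h. fst h * (K y / 2 * (1 + (L y)\<^sup>2)))) (at y)"
      unfolding L_def K_def l[OF x]
      by (rule has_derivative_eq_rhs[OF chain[OF y has_derivative_len[OF x]]]) (simp add: dual[OF y] mult.commute)
    show "(C has_derivative (\<lambda>h. snd h * (- s y * a y))) (at y)"
      unfolding C_def s_def a[OF y]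
      by (rule has_derivative_eq_rhs[OF chain[OF y has_derivative_direction(1)[OF x]]]) (simp add: dual[OF y] mult_ac)
    show "(s has_derivative (\<lambda>h. snd h * (C y * a y))) (at y)"
      unfolding C_def s_def a[OF y]
      by (rule has_derivative_eq_rhs[OF chain[OF y has_derivative_direction(2)[OF x]]]) (simp add: dual[OF y] mult_ac)
    show "(L y)\<^sup>2 \<noteq> 1" using generic(2)[OF x] by (simp add: L_def l[OF x] m_def)
    have "(B (\<Theta> y))\<^sup>2 + (A (\<Theta> y))\<^sup>2 = m (\<Theta> y)" by (simp add: m_def)
    then show "(C y)\<^sup>2 + (s y)\<^sup>2 = 1"
      using m_pos[OF x] by (simp add: C_def s_def power_divide l[OF x] add_divide_distrib[symmetric])
  qed
  then obtain \<alpha> a0 \<omega>0 where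
    \<alpha>: "\<And>u v. u \<in> I \<Longrightarrow> v \<in> J \<Longrightarrow> cos (\<alpha> u) \<noteq> 0"
      "\<And>u v. u \<in> I \<Longrightarrow> v \<in> J \<Longrightarrow> (\<alpha> has_real_derivative 1 - (a0 + 1) / cos (\<alpha> u)) (at u)"
      "\<And>u v. u \<in> I \<Longrightarrow> v \<in> J \<Longrightarrow> \<alpha> u = - 2 * arctan (L (u, v))"
      and CS: "\<And>u v. u \<in> I \<Longrightarrow> v \<in> J \<Longrightarrow> C (u, v) = cos (a0 * v + \<omega>0)"
      "\<And>u v. u \<in> I \<Longrightarrow> v \<in> J \<Longrightarrow> s (u, v) = sin (a0 * v + \<omega>0)"
    by blast
  have main: "fst (\<Phi> x) \<in> I" "snd (\<Phi> x) \<in> J" "\<Theta> (\<Phi> x) = x" "x \<in> S" if "x \<in> T" for x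
    using hom that T(3) by (auto simp: homeomorphism_def)
  have \<alpha>x: "\<alpha> (fst (\<Phi> x)) = - 2 * arctan (len x)" if "x \<in> T" for x
    using \<alpha>(3)[OF main(1)[OF that] main(2)[OF that]] main(3)[OF that] by (simp add: L_def)
  have sin: "sin (\<alpha> (fst (\<Phi> x))) = - 2 * len x / (1 + m x)" if "x \<in> T" for x
    unfolding \<alpha>x[OF that] cos_sin_double_arctan l[OF main(4)[OF that]] ..
  show thesis
  proof (rule that[OF T R hom \<Phi> \<Theta>, of \<alpha> a0 \<omega>0])
    fix x assume x: "x \<in> T"
    note xS = main(4)[OF x]
    have D: "deriv_at \<Phi> x = (\<lambda>h. (\<omega>1 x h, \<omega>2 x h))" by (rule deriv_at_eqI[OF d\<Phi>[OF x]])
    show "cos (\<alpha> (fst (\<Phi> x))) \<noteq> 0" by (rule \<alpha>(1)[OF main(1)[OF x] main(2)[OF x]])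
    show "(\<alpha> has_real_derivative 1 - (a0 + 1) / cos (\<alpha> (fst (\<Phi> x)))) (at (fst (\<Phi> x)))"
      by (rule \<alpha>(2)[OF main(1)[OF x] main(2)[OF x]])
    show "g x b c = fst (deriv_at \<Phi> x b) * fst (deriv_at \<Phi> x c)
      + (sin (\<alpha> (fst (\<Phi> x))))\<^sup>2 * (snd (deriv_at \<Phi> x b) * snd (deriv_at \<Phi> x c))" for b c
      unfolding D sin[OF x] metric_coordinates[OF xS, of b c]
      by (simp add: power_divide power_mult_distrib l[OF xS])
    have "\<omega>1 x (\<xi> x) = B x / len x" by (simp add: \<omega>1_def N_def frame_simps[OF xS])
    \<comment> \<open>The factor of \<eta> in \<open>\<omega>2\<close> is 1 / (\<open>len\<close>
      sin \<alpha>), and \<open>A x\<close> is the value of \<eta> on \<open>\<xi>\<close>.\<close>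
    moreover have "\<omega>2 x (\<xi> x) = (A x / len x) / sin (\<alpha> (fst (\<Phi> x)))"
      unfolding sin[OF x] using m_pos[OF xS] len_pos[OF xS]
      by (simp add: \<omega>2_def len_sq[OF xS] mult.assoc divide_simps) (simp add: algebra_simps)
    moreover have "C (\<Phi> x) = B x / len x" "s (\<Phi> x) = A x / len x"
      by (simp_all add: C_def s_def main(3)[OF x])
    ultimately show "deriv_at \<Phi> x (\<xi> x) =
      (cos (a0 * snd (\<Phi> x) + \<omega>0), sin (a0 * snd (\<Phi> x) + \<omega>0) / sin (\<alpha> (fst (\<Phi> x))))"
      unfolding D using CS[OF main(1)[OF x] main(2)[OF x]] by (simp only: prod.collapse)
  qed
qed

end

text \<open>In plane coordinates a normal of \<open>\<xi>\<close> is read off from the components of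
  the covector dual to it, which works on the whole of \<open>S\<close> at once.\<close>

lemma orthonormal_complement:
  assumes S: "open S" and g: "riemannian_metric_on S g" and \<xi>: "smooth_on S \<xi>"
    and unit: "\<And>x. x \<in> S \<Longrightarrow> g x (\<xi> x) (\<xi> x) = 1"
  shows "\<exists>\<zeta>. orthonormal_frame S g \<xi> \<zeta>"
proof -
  have smooth: "smooth_on S (\<lambda>x. g x a b)" for a b
    using g unfolding riemannian_metric_on_def by blast
  have bil: "bilinear (g x)" and pos: "\<And>a. a \<noteq> 0 \<Longrightarrow> g x a a > 0" if "x \<in> S" for x
    using g that unfolding riemannian_metric_on_def by blast+
  have field: "smooth_on S (\<lambda>x. g x (u x) (v x))" if "smooth_on S u" "smooth_on S v" for u v
    by (rule smooth_on_bilinear_field[OF S bil smooth that])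
  \<comment> \<open>The components of the covector \<open>g x (\<xi> x)\<close>, exchanged with one
    sign: the covector annihilates \<open>r\<close>, and \<open>r\<close> = 0 would make the
    covector vanish on the unit vector \<open>\<xi> x\<close>.\<close>
  define r where "r x = (- g x (\<xi> x) (0, 1), g x (\<xi> x) (1, 0))" for x
  have expand: "g x (\<xi> x) h = fst h * g x (\<xi> x) (1, 0) + snd h * g x (\<xi> x) (0, 1)" if "x \<in> S" for x h
  proof -
    have l: "linear (g x (\<xi> x))" using bil[OF that] unfolding bilinear_def by blast
    have "h = fst h *\<^sub>R (1, 0) + snd h *\<^sub>R (0, 1)" by (simp add: prod_eq_iff)
    then have "g x (\<xi> x) h = g x (\<xi> x) (fst h *\<^sub>R (1, 0) + snd h *\<^sub>R (0, 1))" by simp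
    then show ?thesis by (simp only: linear_add[OF l] linear_cmul[OF l] real_scaleR_def)
  qed
  have orth: "g x (\<xi> x) (r x) = 0" if "x \<in> S" for x
    unfolding expand[OF that, of "r x"] by (simp add: r_def)
  have "r x \<noteq> 0" if "x \<in> S" for x
    using expand[OF that, of "\<xi> x"] unit[OF that] by (auto simp: r_def zero_prod_def)
  then have rpos: "g x (r x) (r x) > 0" if "x \<in> S" for x using pos[OF that] that by blast
  have r: "smooth_on S r"
    unfolding r_def by (intro smooth_on_Pair smooth_on_minus field S \<xi> smooth_on_const)
  define \<zeta> where "\<zeta> x = (1 / sqrt (g x (r x) (r x))) *\<^sub>R r x" for x
  have "orthonormal_frame S g \<xi> \<zeta>"
  proof
    show "smooth_on S \<zeta>"
      unfolding \<zeta>_def using rpos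
      by (intro smooth_on_scaleR smooth_on_divide smooth_on_sqrt field S r smooth_on_const) force+
    fix x assume x: "x \<in> S"
    show "g x (\<zeta> x) (\<zeta> x) = 1"
      using rpos[OF x] by (simp add: \<zeta>_def bilinear_lmul[OF bil[OF x]] bilinear_rmul[OF bil[OF x]])
    show "g x (\<xi> x) (\<zeta> x) = 0"
      by (simp add: \<zeta>_def bilinear_rmul[OF bil[OF x]] orth[OF x])
  qed (use assms in auto)
  then show ?thesis by blast
qed

section \<open>The normal form is totally geodesic\<close>

locale normal_form_domain =
  fixes S :: "plane set" and g :: "plane metric_field" and \<alpha> :: "real \<Rightarrow> real" and a \<omega>0 :: real
  assumes open_S: "open S" and metric: "riemannian_metric_on S g"
    and cos_\<alpha>: "x \<in> S \<Longrightarrow> cos (\<alpha> (fst x)) \<noteq> 0"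
    and deriv_\<alpha>: "x \<in> S \<Longrightarrow>
      (\<alpha> has_real_derivative 1 - (a + 1) / cos (\<alpha> (fst x))) (at (fst x))"
    and g_form: "x \<in> S \<Longrightarrow>
      g x X Y = fst X * fst Y + (sin (\<alpha> (fst x)))\<^sup>2 * (snd X * snd Y)"
begin

abbreviation f where "f x \<equiv> sin (\<alpha> (fst x))"
abbreviation k where "k x \<equiv> cos (\<alpha> (fst x))"
definition d :: "plane \<Rightarrow> real" where "d x = 1 - (a + 1) / k x"

definition nfield :: "plane \<Rightarrow> plane" where
  "nfield x = (cos (a * snd x + \<omega>0), sin (a * snd x + \<omega>0) / f x)"

definition nnormal :: "plane \<Rightarrow> plane" where
  "nnormal x = (- sin (a * snd x + \<omega>0), cos (a * snd x + \<omega>0) / f x)"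

text \<open>The normal form divides by sin \<alpha> without demanding that it be nonzero; positivity
  of the metric on the second coordinate vector supplies this.\<close>

lemma f_nonzero:
  assumes "x \<in> S"
  shows "f x \<noteq> 0"
proof -
  have "g x (0, 1) (0, 1) > 0"
    using metric assms unfolding riemannian_metric_on_def by (simp add: zero_prod_def)
  then show ?thesis using g_form[OF assms] by auto
qed

lemma k_neq_1: "x \<in> S \<Longrightarrow> k x \<noteq> 1"
  using f_nonzero[of x] sin_squared_eq[of "\<alpha> (fst x)"] by auto

text \<open>The differential equation expresses \<alpha>' smoothly in \<alpha> wherever cos \<alpha>
  is nonzero, so mere differentiability bootstraps to smoothness.\<close>

lemma smooth_\<alpha>: "smooth_on (fst ` S) \<alpha>"
proof (rule smooth_on_real_fun)
  show o: "open (fst ` S)" by (rule open_image_fst[OF open_S])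
  show "(\<alpha> has_real_derivative 1 - (a + 1) / cos (\<alpha> u)) (at u)" if "u \<in> fst ` S" for u
    using that deriv_\<alpha> by auto
  fix j assume j: "Ck_on j (fst ` S) \<alpha>"
  have c: "open {t::real. cos t \<noteq> 0}"
    by (intro open_Collect_neq continuous_intros)
  have "smooth_on {t::real. cos t \<noteq> 0} (\<lambda>t. 1 - (a + 1) / cos t)"
    by (intro smooth_on_diff smooth_on_divide smooth_on_cos smooth_on_ident smooth_on_const c) auto
  then show "Ck_on j (fst ` S) (\<lambda>u. 1 - (a + 1) / cos (\<alpha> u))"
    using Ck_on_compose[OF o c _ j Ck_on_of_smooth] cos_\<alpha> by blast
qed

lemma smooth_coordinates: "smooth_on S fst" "smooth_on S snd" "smooth_on S (\<lambda>x. \<alpha> (fst x))"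
proof -
  show "smooth_on S fst" "smooth_on S snd"
    using smooth_on_fst[OF open_S smooth_on_ident] smooth_on_snd[OF open_S smooth_on_ident] open_S by auto
  then show "smooth_on S (\<lambda>x. \<alpha> (fst x))"
    using smooth_on_compose[OF open_S open_image_fst[OF open_S] subset_refl _ smooth_\<alpha>] by blast
qed

lemma smooth_nfield: "smooth_on S nfield"
  unfolding nfield_def
  by (intro smooth_intros open_S smooth_coordinates f_nonzero)

lemma smooth_nnormal: "smooth_on S nnormal"
  unfolding nnormal_def
  by (intro smooth_intros open_S smooth_coordinates f_nonzero)

lemma frame: "orthonormal_frame S g nfield nnormal"
proof
  fix x assume x: "x \<in> S"
  have [simp]: "f x \<noteq> 0" by (rule f_nonzero[OF x])
  show "g x (nfield x) (nfield x) = 1" "g x (nnormal x) (nnormal x) = 1" "g x (nfield x) (nnormal x) = 0"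
    unfolding g_form[OF x] nfield_def nnormal_def
    by (simp_all add: power2_eq_square) (simp_all add: power2_eq_square[symmetric])
qed (intro open_S metric smooth_nfield smooth_nnormal)+

end

sublocale normal_form_domain \<subseteq> orthonormal_frame S g nfield nnormal
  by (rule frame)

context normal_form_domain
begin

lemma has_derivative_f:
  assumes "x \<in> S"
  shows "(f has_derivative (\<lambda>h. k x * (d x * fst h))) (at x)"
    "(k has_derivative (\<lambda>h. - f x * (d x * fst h))) (at x)"
proof -
  have "((\<lambda>x. \<alpha> (fst x)) has_derivative (\<lambda>h. d x * fst h)) (at x)"
    using has_derivative_compose[OF has_derivative_fst[OF has_derivative_ident], of \<alpha> "(*) (d x)" x UNIV]
      deriv_\<alpha>[OF assms] by (simp add: has_field_derivative_def d_def)
  from has_derivative_sin[OF this] has_derivative_cos[OF this]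
  show "(f has_derivative (\<lambda>h. k x * (d x * fst h))) (at x)"
    "(k has_derivative (\<lambda>h. - f x * (d x * fst h))) (at x)"
    by (simp_all add: mult_ac)
qed

lemma deriv_g_form:
  assumes x: "x \<in> S"
  shows "deriv_at (\<lambda>z. g z b c) x h = 2 * f x * (k x * (d x * fst h)) * (snd b * snd c)"
proof -
  have "((\<lambda>z. fst b * fst c + (f z * f z) * (snd b * snd c)) has_derivative
    (\<lambda>h. 0 + (f x * (k x * (d x * fst h)) + k x * (d x * fst h) * f x) * (snd b * snd c))) (at x)"
    by (intro has_derivative_add has_derivative_const has_derivative_mult_left has_derivative_mult
        has_derivative_f x)
  moreover have "deriv_at (\<lambda>z. g z b c) x = deriv_at (\<lambda>z. fst b * fst c + (f z * f z) * (snd b * snd c)) x"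
    by (rule deriv_at_cong_open[OF open_S x]) (simp add: g_form power2_eq_square)
  ultimately show ?thesis by (simp add: deriv_at_eqI algebra_simps)
qed

lemma koszul_form:
  assumes x: "x \<in> S"
  shows "koszul g x b c w =
    f x * (k x * d x) * ((fst b * snd c + fst c * snd b) * snd w - snd b * snd c * fst w)"
  unfolding koszul_def deriv_g_form[OF x] by (simp add: field_simps)

lemma christoffel_form:
  assumes x: "x \<in> S"
  shows "christoffel g x b c = (- f x * (k x * d x) * (snd b * snd c),
    (k x * d x) / f x * (fst b * snd c + fst c * snd b))"
proof (rule christoffel_eqI)
  show "g x (- f x * (k x * d x) * (snd b * snd c), (k x * d x) / f x * (fst b * snd c + fst c * snd b)) w
    = koszul g x b c w" for w
    unfolding koszul_form[OF x] g_form[OF x] using f_nonzero[OF x]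
    by (simp add: power2_eq_square field_simps)
qed (use bilinear_g[OF x] g_pos[OF x] in \<open>auto simp: less_imp_neq[symmetric]\<close>)

text \<open>The field rotates at rate \<open>a\<close> dv against the coordinate frame, whose own
  connection form is cos \<alpha> \<alpha>' dv. The differential equation turns the sum into (cos
  \<alpha> - 1) dv.\<close>

lemma \<eta>_form:
  assumes x: "x \<in> S"
  shows "\<eta> x h = (k x - 1) * snd h"
proof -
  let ?s = "sin (a * snd x + \<omega>0)" and ?c = "cos (a * snd x + \<omega>0)"
  have fx: "f x \<noteq> 0" by (rule f_nonzero[OF x])
  have t: "((\<lambda>z. a * snd z + \<omega>0) has_derivative (\<lambda>h. a * snd h)) (at x)"
    by (auto intro!: derivative_eq_intros)
  have "(nfield has_derivative (\<lambda>h. (- ?s * (a * snd h),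
      (?c * (a * snd h) * f x - ?s * (k x * (d x * fst h))) / (f x * f x)))) (at x)"
    unfolding nfield_def[abs_def]
    using has_derivative_Pair[OF has_derivative_cos[OF t] has_derivative_divide'[OF has_derivative_sin[OF t]
      has_derivative_f(1)[OF x] fx]] by (simp add: mult_ac)
  from deriv_at_eqI[OF this]
  have "cov nfield x h = (- ?s * (a * snd h),
      (?c * (a * snd h) * f x - ?s * (k x * (d x * fst h))) / (f x * f x)) +
      (- f x * (k x * d x) * (snd h * (?s / f x)),
       (k x * d x) / f x * (fst h * (?s / f x) + ?c * snd h))"
    unfolding cov_def christoffel_form[OF x] by (simp add: nfield_def)
  also have "\<dots> = ((a + k x * d x) * snd h) *\<^sub>R nnormal x"
    using fx by (simp add: nnormal_def divide_simps) (simp add: algebra_simps)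
  finally have "\<eta> x h = (a + k x * d x) * snd h"
    unfolding \<eta>_def by (simp add: g_simps[OF x] frame_simps[OF x])
  moreover have "k x * d x = k x - (a + 1)"
    using cos_\<alpha>[OF x] by (simp add: d_def field_simps)
  ultimately show ?thesis by simp
qed

lemma deriv_\<eta>_form:
  assumes x: "x \<in> S"
  shows "deriv_at (\<lambda>z. \<eta> z b) x h = - f x * (d x * fst h) * snd b"
proof -
  have "deriv_at (\<lambda>z. \<eta> z b) x = deriv_at (\<lambda>z. (k z - 1) * snd b) x"
    by (rule deriv_at_cong_open[OF open_S x]) (rule \<eta>_form)
  also have "\<dots> = (\<lambda>h. (- f x * (d x * fst h) - 0) * snd b)"
    by (intro deriv_at_eqI has_derivative_mult_left has_derivative_diff has_derivative_const has_derivative_f x)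
  finally show ?thesis by simp
qed

lemma totally_geodesic_normal_form: "totally_geodesic_in_param S g nfield"
proof (rule totally_geodesic_in_param_if)
  fix x b c :: plane assume x: "x \<in> S"
  define e where "e = fst b * snd c + fst c * snd b"
  have k1: "1 - k x \<noteq> 0" using k_neq_1[OF x] by simp
  have ff: "(f x)\<^sup>2 = (1 - k x) * (1 + k x)"
    using sin_squared_eq[of "\<alpha> (fst x)"] by (simp add: power2_eq_square algebra_simps)
  \<comment> \<open>The tangential equation forces these components. In the second one, (1 + cos
    \<alpha>) / 2 is divided by the squared sine (1 - cos \<alpha>) (1 + cos \<alpha>); the vertical
    equation then holds because the factor cos \<alpha> - 1 of \<eta> cancels the remaining
    denominator.\<close>
  have "geodesic_coeff x b c (- (d x * f x) * (snd b * snd c), d x * f x * e / (2 * (1 - k x)))"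
    unfolding geodesic_coeff_def d\<eta>_def deriv_\<eta>_form[OF x] koszul_form[OF x] \<eta>_form[OF x]
  proof (intro conjI allI)
    have "(k x - 1) * (d x * f x * e / (2 * (1 - k x))) = - (d x * f x * e / 2)"
      using k1 by (simp add: divide_simps) (simp add: algebra_simps)
    then show "(k x - 1) * snd (- (d x * f x) * (snd b * snd c), d x * f x * e / (2 * (1 - k x))) =
      (- f x * (d x * fst b) * snd c + - f x * (d x * fst c) * snd b) / 2"
      by (simp add: e_def algebra_simps)
    fix w :: plane
    have "(f x)\<^sup>2 * (d x * f x * e / (2 * (1 - k x)) * snd w) = (1 + k x) * (d x * f x * e * snd w) / 2"
      unfolding ff using k1 by (simp add: divide_simps)
    then show "g x (- (d x * f x) * (snd b * snd c), d x * f x * e / (2 * (1 - k x))) w =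
      f x * (k x * d x) * ((fst b * snd c + fst c * snd b) * snd w - snd b * snd c * fst w) +
      ((k x - 1) * snd c * (- f x * (d x * fst b) * snd w - - f x * (d x * fst w) * snd b) +
       (k x - 1) * snd b * (- f x * (d x * fst c) * snd w - - f x * (d x * fst w) * snd c)) / 2"
      unfolding g_form[OF x] fst_conv snd_conv e_def by (simp add: field_simps)
  qed
  then show "\<exists>c'. geodesic_coeff x b c c'" by blast
qed

end

section \<open>Charts\<close>

lemma is_chart_iff:
  "is_chart X c \<longleftrightarrow> openin X (fst c) \<and> open (snd c ` fst c) \<and>
    homeomorphic_map (subtopology X (fst c)) (top_of_set (snd c ` fst c)) (snd c)"
  by (simp add: is_chart_def case_prod_unfold)

lemma chart_topspace: "is_chart X c \<Longrightarrow> fst c \<subseteq> topspace X"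
  by (simp add: is_chart_iff openin_subset)

lemma chart_inj: "is_chart X c \<Longrightarrow> inj_on (snd c) (fst c)"
  using homeomorphic_imp_injective_map[of "subtopology X (fst c)"] chart_topspace[of X c]
  by (auto simp: is_chart_iff topspace_subtopology Int_absorb1)

lemma transition_apply: "is_chart X c \<Longrightarrow> p \<in> fst c \<Longrightarrow> transition c c' (snd c p) = snd c' p"
  using chart_inj[of X c] by (simp add: transition_def inv_into_f_f)

lemma open_chart_image:
  assumes "is_chart X c" "openin X V"
  shows "open (chart_image c V)"
proof -
  have "openin (subtopology X (fst c)) (fst c \<inter> V)"
    using assms(2) by (auto simp: openin_subtopology)
  then have "openin (top_of_set (snd c ` fst c)) (snd c ` (fst c \<inter> V))"
    using assms(1) homeomorphic_imp_open_map unfolding is_chart_iff open_map_def by blast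
  then show ?thesis
    using assms(1) openin_open_eq unfolding is_chart_iff chart_image_def by blast
qed

lemma chart_image_whole: "fst c \<subseteq> V \<Longrightarrow> chart_image c V = snd c ` fst c"
  by (simp add: chart_image_def Int_absorb2)

lemma openin_chart_preimage:
  assumes "is_chart X c" "open N"
  shows "openin X {p \<in> fst c. snd c p \<in> N}"
proof -
  have "continuous_map (subtopology X (fst c)) (top_of_set (snd c ` fst c)) (snd c)"
    using assms(1) homeomorphic_imp_continuous_map unfolding is_chart_iff by blast
  moreover have "openin (top_of_set (snd c ` fst c)) (snd c ` fst c \<inter> N)"
    using assms(2) by (rule openin_open_Int)
  ultimately have "openin (subtopology X (fst c))
      {p \<in> topspace (subtopology X (fst c)). snd c p \<in> snd c ` fst c \<inter> N}"
    by (rule openin_continuous_map_preimage)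
  also have "{p \<in> topspace (subtopology X (fst c)). snd c p \<in> snd c ` fst c \<inter> N} =
      {p \<in> fst c. snd c p \<in> N}"
    using chart_topspace[OF assms(1)] by (auto simp: topspace_subtopology)
  finally show ?thesis
    using assms(1) openin_trans_full unfolding is_chart_iff by blast
qed

lemma smooth_on_deriv_field:
  fixes f :: "'a::euclidean_space \<Rightarrow> 'b::euclidean_space"
  assumes "open S" "smooth_on S f" "smooth_on S u"
  shows "smooth_on S (\<lambda>x. deriv_at f x (u x))"
proof -
  have "smooth_on S (\<lambda>x. \<Sum>b\<in>Basis. (u x \<bullet> b) *\<^sub>R deriv_at f x b)"
    by (intro smooth_on_sum smooth_on_scaleR smooth_on_inner_left smooth_on_deriv_at assms)
  then show ?thesis
    by (rule iffD1[OF smooth_on_cong[OF assms(1)], rotated])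
      (rule deriv_at_euclidean[symmetric], rule smooth_on_differentiable[OF assms(2)])
qed

locale surface =
  fixes M :: "'p topology" and \<A> :: "'p chart set"
  assumes smooth: "smooth_surface M \<A>"
begin

abbreviation charts where "charts \<equiv> smooth_charts M \<A>"

lemma is_chart: "c \<in> charts \<Longrightarrow> is_chart M c"
  by (simp add: smooth_charts_def)

lemma open_overlap: "c \<in> charts \<Longrightarrow> c' \<in> charts \<Longrightarrow> open (chart_image c (fst c'))"
  by (rule open_chart_image[OF is_chart]) (use is_chart is_chart_iff in blast)+

lemma atlas_chart: "d \<in> \<A> \<Longrightarrow> d \<in> charts"
  using smooth by (auto simp: smooth_surface_def smooth_charts_def)

text \<open>Charts of the maximal atlas are compared only with those of \<open>\<A>\<close> by
  definition; near each point the transition factors through a chart of \<open>\<A>\<close>.\<close>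

lemma smooth_transition:
  assumes c: "c \<in> charts" and c': "c' \<in> charts"
  shows "smooth_on (chart_image c (fst c')) (transition c c')"
proof (rule smooth_on_local)
  fix x assume "x \<in> chart_image c (fst c')"
  then obtain q where q: "q \<in> fst c" "q \<in> fst c'" "x = snd c q" by (auto simp: chart_image_def)
  then have "q \<in> topspace M" using chart_topspace[OF is_chart[OF c]] by blast
  then obtain d where d: "d \<in> \<A>" "q \<in> fst d"
    using smooth unfolding smooth_surface_def by blast
  note dc = atlas_chart[OF d(1)]
  let ?T = "chart_image c (fst c' \<inter> fst d)"
  have T: "open ?T"
    by (rule open_chart_image[OF is_chart[OF c]])
      (use is_chart[OF c'] is_chart[OF dc] in \<open>simp add: is_chart_iff openin_Int\<close>)
  have "smooth_on ?T (\<lambda>y. transition d c' (transition c d y))"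
  proof (rule smooth_on_compose[where f = "transition c d" and g = "transition d c'", OF T open_overlap[OF dc c']])
    show "transition c d ` ?T \<subseteq> chart_image d (fst c')"
      by (auto simp: chart_image_def transition_apply[OF is_chart[OF c]])
    have "smooth_on (chart_image c (fst d)) (transition c d)" "smooth_on (chart_image d (fst c')) (transition d c')"
      using c c' d(1) by (auto simp: smooth_charts_def compatible_charts_def)
    then show "smooth_on ?T (transition c d)" "smooth_on (chart_image d (fst c')) (transition d c')"
      by (auto intro: smooth_on_subset simp: chart_image_def)
  qed
  moreover have "transition d c' (transition c d y) = transition c c' y" if "y \<in> ?T" for y
    using that by (auto simp: chart_image_def transition_apply[OF is_chart[OF c]] transition_apply[OF is_chart[OF dc]])
  ultimately have "smooth_on ?T (transition c c')"
    by (rule iffD1[OF smooth_on_cong[OF T], rotated])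
  moreover have "x \<in> ?T" using q d by (auto simp: chart_image_def)
  ultimately show "\<exists>T. open T \<and> x \<in> T \<and> smooth_on T (transition c c')" using T by blast
qed

lemma deriv_transition_compose:
  assumes c: "c \<in> charts" "c' \<in> charts" "c'' \<in> charts" and q: "q \<in> fst c" "q \<in> fst c'" "q \<in> fst c''"
  shows "deriv_at (transition c c'') (snd c q) v =
    deriv_at (transition c' c'') (snd c' q) (deriv_at (transition c c') (snd c q) v)"
proof -
  let ?T = "chart_image c (fst c' \<inter> fst c'')"
  have T: "open ?T"
    by (rule open_chart_image[OF is_chart[OF c(1)]])
      (use is_chart[OF c(2)] is_chart[OF c(3)] in \<open>simp add: is_chart_iff openin_Int\<close>)
  have qT: "snd c q \<in> ?T" "snd c q \<in> chart_image c (fst c')" "snd c' q \<in> chart_image c' (fst c'')"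
    using q by (auto simp: chart_image_def)
  have t: "transition c c' (snd c q) = snd c' q" by (rule transition_apply[OF is_chart[OF c(1)] q(1)])
  have "deriv_at (transition c c'') (snd c q) = deriv_at (\<lambda>y. transition c' c'' (transition c c' y)) (snd c q)"
    by (rule deriv_at_cong_open[OF T qT(1)])
      (auto simp: chart_image_def transition_apply[OF is_chart[OF c(1)]] transition_apply[OF is_chart[OF c(2)]])
  also have "\<dots> = (\<lambda>v. deriv_at (transition c' c'') (snd c' q) (deriv_at (transition c c') (snd c q) v))"
    using has_derivative_compose[OF smooth_on_has_deriv[OF smooth_transition[OF c(1,2)] qT(2)],
        of "transition c' c''" "deriv_at (transition c' c'') (snd c' q)"]
      smooth_on_has_deriv[OF smooth_transition[OF c(2,3)] qT(3)]
    by (intro deriv_at_eqI) (simp add: t)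
  finally show ?thesis by simp
qed

lemma deriv_transition_self:
  assumes c: "c \<in> charts" and x: "x \<in> snd c ` fst c"
  shows "deriv_at (transition c c) x v = v"
proof -
  have "open (snd c ` fst c)" using is_chart[OF c] by (simp add: is_chart_iff)
  then have "deriv_at (transition c c) x = deriv_at (\<lambda>x. x) x"
    by (rule deriv_at_cong_open[OF _ x]) (auto simp: transition_apply[OF is_chart[OF c]])
  then show ?thesis by simp
qed

text \<open>This is how the adapted coordinates become a chart of the maximal atlas: transitions to
  atlas charts are old transitions composed with \<open>\<Phi>\<close> or
  \<open>\<Theta>\<close>.\<close>

lemma compose_chart:
  assumes c: "c \<in> charts" and N: "open N" "N \<subseteq> snd c ` fst c" and R: "open R"
    and hom: "homeomorphism N R \<Phi> \<Theta>" and \<Phi>: "smooth_on N \<Phi>" and \<Theta>: "smooth_on R \<Theta>"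
  shows "({p \<in> fst c. snd c p \<in> N}, \<Phi> \<circ> snd c) \<in> charts" (is "?c \<in> _")
proof -
  let ?D = "{p \<in> fst c. snd c p \<in> N}"
  note ch = is_chart[OF c]
  have D: "openin M ?D" by (rule openin_chart_preimage[OF ch N(1)])
  have img: "snd c ` ?D = N" using N(2) by auto
  then have img': "(\<Phi> \<circ> snd c) ` ?D = R"
    using homeomorphism_image1[OF hom] by (simp only: image_comp[symmetric])
  have "homeomorphic_map (subtopology (subtopology M (fst c)) ?D)
      (subtopology (top_of_set (snd c ` fst c)) N) (snd c)"
  proof (rule homeomorphic_map_subtopologies)
    show "homeomorphic_map (subtopology M (fst c)) (top_of_set (snd c ` fst c)) (snd c)"
      using ch by (simp add: is_chart_iff)
    show "snd c ` (topspace (subtopology M (fst c)) \<inter> ?D) = topspace (top_of_set (snd c ` fst c)) \<inter> N"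
      using N(2) chart_topspace[OF ch] by (auto simp: topspace_subtopology)
  qed
  moreover have "subtopology (subtopology M (fst c)) ?D = subtopology M ?D"
  proof -
    have "fst c \<inter> ?D = ?D" by auto
    then show ?thesis by (simp only: subtopology_subtopology)
  qed
  moreover have "subtopology (top_of_set (snd c ` fst c)) N = top_of_set N"
    using N(2) by (simp add: subtopology_subtopology Int_absorb1)
  ultimately have "homeomorphic_map (subtopology M ?D) (top_of_set N) (snd c)" by simp
  moreover have "homeomorphic_maps (top_of_set N) (top_of_set R) \<Phi> \<Theta>"
    using hom by (auto simp: homeomorphic_maps_def homeomorphism_def continuous_map_in_subtopology)
  then have "homeomorphic_map (top_of_set N) (top_of_set R) \<Phi>"
    unfolding homeomorphic_map_maps by blast
  ultimately have "homeomorphic_map (subtopology M ?D) (top_of_set R) (\<Phi> \<circ> snd c)"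
    by (rule homeomorphic_map_compose)
  then have ic: "is_chart M ?c"
    using D R img' by (simp add: is_chart_iff)
  have "compatible_charts ?c d" if d: "d \<in> \<A>" for d
    unfolding compatible_charts_def
  proof
    note dc = is_chart[OF atlas_chart[OF d]]
    have sm: "smooth_on (chart_image c (fst d)) (transition c d)" "smooth_on (chart_image d (fst c)) (transition d c)"
      using c d by (auto simp: smooth_charts_def compatible_charts_def)
    have o: "open (chart_image ?c (fst d))" "open (chart_image d ?D)"
      using open_chart_image[OF ic] open_chart_image[OF dc D] dc by (auto simp: is_chart_iff)
    have inverse: "\<Theta> (\<Phi> (snd c p)) = snd c p" if "p \<in> ?D" for p
      using that homeomorphism_apply1[OF hom] by auto
    have "smooth_on (chart_image ?c (fst d)) (\<lambda>y. transition c d (\<Theta> y))"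
    proof (rule smooth_on_compose[where f = \<Theta> and g = "transition c d", OF o(1) open_overlap[OF c atlas_chart[OF d]] _ _ sm(1)])
      show "\<Theta> ` chart_image ?c (fst d) \<subseteq> chart_image c (fst d)"
        using inverse by (auto simp: chart_image_def)
      show "smooth_on (chart_image ?c (fst d)) \<Theta>"
        by (rule smooth_on_subset[OF \<Theta>]) (use img' in \<open>auto simp: chart_image_def\<close>)
    qed
    moreover have "transition c d (\<Theta> y) = transition ?c d y" if y: "y \<in> chart_image ?c (fst d)" for y
    proof -
      obtain p where p: "p \<in> ?D" "y = (\<Phi> \<circ> snd c) p" using y by (auto simp: chart_image_def)
      have "transition ?c d (snd ?c p) = snd d p"
        by (rule transition_apply[OF ic]) (use p in simp)
      then show ?thesis using p inverse[OF p(1)] transition_apply[OF ch, of p d] by simp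
    qed
    ultimately show "smooth_on (chart_image ?c (fst d)) (transition ?c d)"
      by (rule iffD1[OF smooth_on_cong[OF o(1)], rotated])
    have "smooth_on (chart_image d ?D) (\<lambda>y. \<Phi> (transition d c y))"
    proof (rule smooth_on_compose[where f = "transition d c" and g = \<Phi>, OF o(2) N(1) _ _ \<Phi>])
      show "transition d c ` chart_image d ?D \<subseteq> N"
        by (auto simp: chart_image_def transition_apply[OF dc])
      show "smooth_on (chart_image d ?D) (transition d c)"
        by (rule smooth_on_subset[OF sm(2)]) (auto simp: chart_image_def)
    qed
    moreover have "\<Phi> (transition d c y) = transition d ?c y" for y
      by (simp add: transition_def)
    ultimately show "smooth_on (chart_image d (fst ?c)) (transition d ?c)" by simp
  qed
  then show ?thesis using ic by (simp add: smooth_charts_def)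
qed

end

lemma totally_geodesic_in_param_cong:
  assumes "\<And>x. x \<in> S \<Longrightarrow> \<xi> x = \<xi>' x" "totally_geodesic_in_param S g \<xi>"
  shows "totally_geodesic_in_param S g \<xi>'"
  using assms(2) unfolding totally_geodesic_in_param_def by (simp add: assms(1) cong: conj_cong)

locale riemannian = surface M \<A> for M :: "'p topology" and \<A> :: "'p chart set" +
  fixes g :: "'p surface_metric"
  assumes riemannian: "riemannian_surface M \<A> g"
begin

lemma metric_on:
  assumes c: "c \<in> charts"
  shows "riemannian_metric_on (snd c ` fst c) (g c)"
  using riemannian c chart_image_whole[OF chart_topspace[OF is_chart[OF c]]]
  unfolding riemannian_surface_def by metis

lemma metric_transition:
  assumes "c \<in> charts" "c' \<in> charts" "x \<in> chart_image c (fst c')"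
  shows "g c x a b = g c' (transition c c' x) (deriv_at (transition c c') x a) (deriv_at (transition c c') x b)"
  using riemannian assms unfolding riemannian_surface_def pullback_metric_def by blast

lemma normal_form_domain:
  assumes c: "c \<in> charts" and form: "metric_form g c \<alpha> a"
  shows "normal_form_domain (snd c ` fst c) (g c) \<alpha> a"
proof
  show "open (snd c ` fst c)" using is_chart[OF c] by (simp add: is_chart_iff)
  show "riemannian_metric_on (snd c ` fst c) (g c)" by (rule metric_on[OF c])
qed (use form in \<open>force simp: metric_form_def\<close>)+

lemma normal_form_imp_totally_geodesic:
  assumes "normal_form_on M \<A> g U \<xi>"
  shows "totally_geodesic_field M \<A> g U \<xi>"
  unfolding totally_geodesic_field_def
proof
  fix q assume "q \<in> U"
  with assms obtain a \<omega>0 c \<alpha> where c: "c \<in> charts" "q \<in> fst c" "fst c \<subseteq> U"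
    and form: "metric_form g c \<alpha> a" "field_form \<xi> c \<alpha> a \<omega>0"
    unfolding normal_form_on_def by blast
  interpret normal_form_domain "snd c ` fst c" "g c" \<alpha> a \<omega>0
    by (rule normal_form_domain[OF c(1) form(1)])
  have "totally_geodesic_in_param (snd c ` fst c) (g c) (\<xi> c)"
    by (rule totally_geodesic_in_param_cong[OF _ totally_geodesic_normal_form])
      (use form(2) in \<open>force simp: field_form_def nfield_def\<close>)
  then show "\<exists>c\<in>charts. q \<in> fst c \<and> fst c \<subseteq> U \<and> totally_geodesic_in_param (chart_image c U) (g c) (\<xi> c)"
    using c chart_image_whole[OF c(3)] by auto
qed

lemma unit_vector_field_subset:
  assumes "unit_vector_field M \<A> g U \<xi>" "V \<subseteq> U"
  shows "unit_vector_field M \<A> g V \<xi>"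
proof -
  have sub: "chart_image c V \<subseteq> chart_image c U" "chart_image c (W \<inter> V) \<subseteq> chart_image c (W \<inter> U)" for c W
    using assms(2) by (auto simp: chart_image_def)
  show ?thesis
    unfolding unit_vector_field_def
  proof (intro conjI ballI)
    show "smooth_on (chart_image c V) (\<xi> c)" if "c \<in> charts" for c
      by (rule smooth_on_subset[OF _ sub(1)]) (use assms(1) that unit_vector_field_def in blast)
    show "g c x (\<xi> c x) (\<xi> c x) = 1" if "c \<in> charts" "x \<in> chart_image c V" for c x
      using assms(1) that sub(1)[of c] unfolding unit_vector_field_def by blast
    show "\<xi> c' (transition c c' x) = deriv_at (transition c c') x (\<xi> c x)"
      if "c \<in> charts" "c' \<in> charts" "x \<in> chart_image c (fst c' \<inter> V)" for c c' x
      using assms(1) that sub(2)[of c "fst c'"] unfolding unit_vector_field_def by blast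
  qed
qed

text \<open>The components in another chart are obtained by pushing forward with the transition map.
  The chain rule for three charts gives the transformation law, and invariance of the metric keeps
  the length 1.\<close>

lemma extend_chart_field:
  assumes c: "c \<in> charts" and v: "smooth_on (snd c ` fst c) v"
    and unit: "\<And>x. x \<in> snd c ` fst c \<Longrightarrow> g c x (v x) (v x) = 1"
  shows "\<exists>\<xi>. unit_vector_field M \<A> g (fst c) \<xi> \<and> (\<forall>x\<in>snd c ` fst c. \<xi> c x = v x)"
proof -
  note ch = is_chart[OF c]
  define \<xi> where "\<xi> c' y = deriv_at (transition c c') (transition c' c y) (v (transition c' c y))" for c' y
  have val: "\<xi> c' (snd c' q) = deriv_at (transition c c') (snd c q) (v (snd c q))"
    if "c' \<in> charts" "q \<in> fst c'" "q \<in> fst c" for c' q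
    using transition_apply[OF is_chart[OF that(1)] that(2)] by (simp add: \<xi>_def)
  have "smooth_on (chart_image c' (fst c)) (\<xi> c')" if c': "c' \<in> charts" for c'
  proof -
    have "smooth_on (chart_image c (fst c')) (\<lambda>x. deriv_at (transition c c') x (v x))"
      by (intro smooth_on_deriv_field open_overlap smooth_transition c c' smooth_on_subset[OF v])
        (auto simp: chart_image_def)
    then show ?thesis
      unfolding \<xi>_def[abs_def]
      by (rule smooth_on_compose[where f = "transition c' c",
            OF open_overlap[OF c' c] open_overlap[OF c c'] _ smooth_transition[OF c' c], rotated])
        (auto simp: chart_image_def transition_apply[OF is_chart[OF c']])
  qed
  moreover have "g c' y (\<xi> c' y) (\<xi> c' y) = 1" if c': "c' \<in> charts" and y: "y \<in> chart_image c' (fst c)" for c' y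
  proof -
    obtain q where q: "q \<in> fst c'" "q \<in> fst c" "y = snd c' q" using y by (auto simp: chart_image_def)
    have "snd c q \<in> chart_image c (fst c')" using q by (auto simp: chart_image_def)
    from metric_transition[OF c c' this, of "v (snd c q)" "v (snd c q)"]
    show ?thesis
      using q unit[of "snd c q"] val[OF c' q(1,2)] transition_apply[OF ch q(2)] by simp
  qed
  moreover have "\<xi> c'' (transition c' c'' x) = deriv_at (transition c' c'') x (\<xi> c' x)"
    if cc: "c' \<in> charts" "c'' \<in> charts" and x: "x \<in> chart_image c' (fst c'' \<inter> fst c)" for c' c'' x
  proof -
    obtain q where q: "q \<in> fst c'" "q \<in> fst c''" "q \<in> fst c" "x = snd c' q"
      using x by (auto simp: chart_image_def)
    show ?thesis
      unfolding q(4) transition_apply[OF is_chart[OF cc(1)] q(1)] val[OF cc(1) q(1,3)] val[OF cc(2) q(2,3)]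
      by (rule deriv_transition_compose[OF c cc q(3,1,2)])
  qed
  ultimately have "unit_vector_field M \<A> g (fst c) \<xi>"
    unfolding unit_vector_field_def by blast
  moreover have "\<xi> c x = v x" if x: "x \<in> snd c ` fst c" for x
  proof -
    obtain q where q: "q \<in> fst c" "x = snd c q" using x by blast
    then show ?thesis
      using val[OF c q(1) q(1)] deriv_transition_self[OF c x, of "v x"] by simp
  qed
  ultimately show ?thesis by blast
qed

text \<open>The analysis takes place in one chart of the domain where the field is known to be
  totally geodesic, near a generic point inside \<open>W\<close>. Allowing every such
  \<open>W\<close> makes the region of normal form dense in \<open>U\<close>.\<close>

lemma totally_geodesic_imp_normal_form:
  assumes curv: "\<And>c x. c \<in> charts \<Longrightarrow> x \<in> snd c ` fst c \<Longrightarrow> gauss_curvature (g c) x \<noteq> 0"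
    and \<xi>: "unit_vector_field M \<A> g U \<xi>" and tg: "totally_geodesic_field M \<A> g U \<xi>"
    and W: "openin M W" "W \<subseteq> U" "W \<noteq> {}"
  shows "\<exists>V. openin M V \<and> V \<subseteq> W \<and> V \<noteq> {} \<and> normal_form_on M \<A> g V \<xi>"
proof -
  obtain q where q: "q \<in> W" using W(3) by blast
  then obtain c where c: "c \<in> charts" "q \<in> fst c" "fst c \<subseteq> U"
    and tgc: "totally_geodesic_in_param (chart_image c U) (g c) (\<xi> c)"
    using tg W(2) unfolding totally_geodesic_field_def by blast
  note ch = is_chart[OF c(1)]
  define S where "S = snd c ` fst c"
  have SU: "chart_image c U = S" by (simp add: S_def chart_image_whole[OF c(3)])
  have S: "open S" using ch by (simp add: is_chart_iff S_def)
  have gS: "riemannian_metric_on S (g c)" using metric_on[OF c(1)] by (simp add: S_def)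
  have \<xi>S: "smooth_on S (\<xi> c)" "\<And>x. x \<in> S \<Longrightarrow> g c x (\<xi> c x) (\<xi> c x) = 1"
    using \<xi> c(1) SU unfolding unit_vector_field_def by blast+
  obtain \<zeta> where fr: "orthonormal_frame S (g c) (\<xi> c) \<zeta>"
    using orthonormal_complement[OF S gS \<xi>S] by blast
  interpret F: orthonormal_frame S "g c" "\<xi> c" \<zeta> by (rule fr)
  have geo: "\<exists>e. F.geodesic_coeff x a b e" if "x \<in> S" for x a b
    by (rule F.totally_geodesic_in_paramD[OF tgc[unfolded SU] that])
  have restrict: "orthonormal_frame T (g c) (\<xi> c) \<zeta>" if T: "open T" "T \<subseteq> S" for T
  proof
    show "riemannian_metric_on T (g c)"
      using gS T(2) smooth_on_subset unfolding riemannian_metric_on_def by blast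
  qed (use T F.smooth_\<xi> F.smooth_\<zeta> F.frame_simps in \<open>auto intro: smooth_on_subset\<close>)
  define S1 where "S1 = chart_image c W"
  have S1: "open S1" "S1 \<subseteq> S" "S1 \<noteq> {}"
    using open_chart_image[OF ch W(1)] q c(2) by (auto simp: S1_def S_def chart_image_def)
  \<comment> \<open>The form \<eta> is built from the metric and the frame but not from the domain,
    so the interpretations over \<open>S\<close>, \<open>S1\<close> and \<open>S2\<close> share the
    same components.\<close>
  interpret F1: orthonormal_frame S1 "g c" "\<xi> c" \<zeta> by (rule restrict[OF S1(1,2)])
  obtain x0 where x0: "x0 \<in> S1" "(F.A x0)\<^sup>2 + (F.B x0)\<^sup>2 \<noteq> 0" "(F.A x0)\<^sup>2 + (F.B x0)\<^sup>2 \<noteq> 1"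
    using F1.generic_point[OF _ S1(3)] geo curv[OF c(1)] S1(2) unfolding S_def[symmetric] by blast
  define m where "m x = (F.A x)\<^sup>2 + (F.B x)\<^sup>2" for x
  \<comment> \<open>The conditions at the generic point are open, so they hold on a neighbourhood
    and the adapted coordinates become available there.\<close>
  define S2 where "S2 = S1 \<inter> m -` (- {0, 1})"
  have "smooth_on S1 m"
    unfolding m_def by (intro smooth_on_add smooth_on_power F1.smooth_\<eta>_field F1.smooth_\<xi> F1.smooth_\<zeta> S1)
  then have S2: "open S2"
    unfolding S2_def by (intro continuous_open_preimage smooth_on_continuous S1) auto
  have S2': "S2 \<subseteq> S" "x0 \<in> S2" using S1 x0 by (auto simp: S2_def m_def)
  interpret F2: orthonormal_frame S2 "g c" "\<xi> c" \<zeta> by (rule restrict[OF S2 S2'(1)])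
  interpret F2: generic_geodesic_frame S2 "g c" "\<xi> c" \<zeta>
    by standard (use geo S2'(1) in \<open>auto simp: S2_def m_def\<close>)
  obtain T R \<Phi> \<Theta> \<alpha> a \<omega>0 where T: "open T" "x0 \<in> T" "T \<subseteq> S2" "open R"
    and hom: "homeomorphism T R \<Phi> \<Theta>" and sm: "smooth_on T \<Phi>" "smooth_on R \<Theta>"
    and \<alpha>: "\<And>x. x \<in> T \<Longrightarrow> cos (\<alpha> (fst (\<Phi> x))) \<noteq> 0"
      "\<And>x. x \<in> T \<Longrightarrow> (\<alpha> has_real_derivative 1 - (a + 1) / cos (\<alpha> (fst (\<Phi> x)))) (at (fst (\<Phi> x)))"
    and gT: "\<And>x b b'. x \<in> T \<Longrightarrow> g c x b b' = fst (deriv_at \<Phi> x b) * fst (deriv_at \<Phi> x b')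
      + (sin (\<alpha> (fst (\<Phi> x))))\<^sup>2 * (snd (deriv_at \<Phi> x b) * snd (deriv_at \<Phi> x b'))"
    and \<xi>T: "\<And>x. x \<in> T \<Longrightarrow> deriv_at \<Phi> x (\<xi> c x) =
      (cos (a * snd (\<Phi> x) + \<omega>0), sin (a * snd (\<Phi> x) + \<omega>0) / sin (\<alpha> (fst (\<Phi> x))))"
    using F2.adapted_coordinates[OF S2'(2)] by blast
  have TS: "T \<subseteq> snd c ` fst c" using T(3) S2'(1) by (simp add: S_def)
  define c' where "c' = ({p \<in> fst c. snd c p \<in> T}, \<Phi> \<circ> snd c)"
  have c': "c' \<in> charts"
    unfolding c'_def by (rule compose_chart[OF c(1) T(1) TS T(4) hom sm])
  have img: "snd c ` fst c' = T" using TS by (auto simp: c'_def)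
  then have img': "snd c' ` fst c' = R"
    using homeomorphism_image1[OF hom] by (simp only: c'_def fst_conv snd_conv image_comp[symmetric])
  have overlap: "chart_image c (fst c') = T"
    using img by (simp add: chart_image_def c'_def Int_absorb1 Collect_subset)
  have tr: "transition c c' x = \<Phi> x" if "x \<in> T" for x
    using that TS transition_apply[OF ch] by (auto simp: c'_def)
  have dtr: "deriv_at (transition c c') x = deriv_at \<Phi> x" if "x \<in> T" for x
    by (rule deriv_at_cong_open[OF T(1) that tr])
  \<comment> \<open>Every pair of vectors in the new chart is thus the image of vectors in the old
    one, where the formula for the metric is known.\<close>
  have surj: "deriv_at \<Phi> x (deriv_at \<Theta> (\<Phi> x) X) = X" if x: "x \<in> T" for x X
  proof -
    have y: "\<Phi> x \<in> R" "\<Theta> (\<Phi> x) = x"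
      using x homeomorphism_image1[OF hom] homeomorphism_apply1[OF hom] by auto
    have "deriv_at (\<lambda>y. \<Phi> (\<Theta> y)) (\<Phi> x) = deriv_at (\<lambda>y. y) (\<Phi> x)"
      by (rule deriv_at_cong_open[OF T(4) y(1)]) (rule homeomorphism_apply2[OF hom])
    moreover have "deriv_at (\<lambda>y. \<Phi> (\<Theta> y)) (\<Phi> x) = (\<lambda>h. deriv_at \<Phi> x (deriv_at \<Theta> (\<Phi> x) h))"
      using has_derivative_compose[OF smooth_on_has_deriv[OF sm(2) y(1)], of \<Phi> "deriv_at \<Phi> x"]
        smooth_on_has_deriv[OF sm(1) x]
      by (intro deriv_at_eqI) (simp add: y(2))
    ultimately show ?thesis by (metis frechet_derivative_ident)
  qed
  have metric: "metric_form g c' \<alpha> a"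
    unfolding metric_form_def img'
  proof safe
    fix u v assume "(u, v) \<in> R"
    then obtain x where x: "x \<in> T" "\<Phi> x = (u, v)"
      using homeomorphism_image1[OF hom] by (metis imageE)
    show "cos (\<alpha> u) = 0 \<Longrightarrow> False" using \<alpha>(1)[OF x(1)] x(2) by simp
    show "(\<alpha> has_real_derivative 1 - (a + 1) / cos (\<alpha> u)) (at u)" using \<alpha>(2)[OF x(1)] x(2) by simp
    fix X Y :: plane
    show "g c' (u, v) X Y = fst X * fst Y + (sin (\<alpha> u))\<^sup>2 * (snd X * snd Y)"
      using metric_transition[OF c(1) c', of x "deriv_at \<Theta> (\<Phi> x) X" "deriv_at \<Theta> (\<Phi> x) Y"]
        gT[OF x(1), of "deriv_at \<Theta> (\<Phi> x) X" "deriv_at \<Theta> (\<Phi> x) Y"] x(1)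
      unfolding overlap dtr[OF x(1)] tr[OF x(1)] surj[OF x(1)] by (simp add: x(2))
  qed
  have field: "field_form \<xi> c' \<alpha> a \<omega>0"
    unfolding field_form_def img'
  proof safe
    fix u v assume "(u, v) \<in> R"
    then obtain x where x: "x \<in> T" "\<Phi> x = (u, v)"
      using homeomorphism_image1[OF hom] by (metis imageE)
    have "x \<in> chart_image c (fst c' \<inter> U)"
      using x(1) overlap c(3) by (auto simp: chart_image_def)
    then have "\<xi> c' (transition c c' x) = deriv_at (transition c c') x (\<xi> c x)"
      using \<xi> c(1) c' unfolding unit_vector_field_def by blast
    then show "\<xi> c' (u, v) = (cos (a * v + \<omega>0), sin (a * v + \<omega>0) / sin (\<alpha> u))"
      unfolding dtr[OF x(1)] tr[OF x(1)] \<xi>T[OF x(1)] by (simp add: x(2))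
  qed
  have "openin M (fst c')" using is_chart[OF c'] by (simp add: is_chart_iff)
  moreover have "fst c' \<subseteq> W"
  proof
    fix p assume "p \<in> fst c'"
    then have p: "p \<in> fst c" "snd c p \<in> T" by (auto simp: c'_def)
    then have "snd c p \<in> chart_image c W" using T(3) by (auto simp: S2_def S1_def)
    then show "p \<in> W" using p(1) chart_inj[OF ch] by (auto simp: chart_image_def inj_on_def)
  qed
  moreover have "fst c' \<noteq> {}" using img T(2) by auto
  moreover have "normal_form_on M \<A> g (fst c') \<xi>"
    unfolding normal_form_on_def using c' metric field by blast
  ultimately show ?thesis by blast
qed

end

text \<open>Existence survives the shrinking from \<open>U\<close> to a generic open subset, so the
  first equivalence follows from the statements about a fixed field. The last part shows that the
  metric form alone suffices, with the phase \<open>\<omega>\<^sub>0\<close> at will.\<close>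

theorem theorem1p1:
  fixes M :: "'p topology" and A :: "'p chart set" and g :: "'p surface_metric"
  assumes "riemannian_surface M A g"
    and "sign_preserving_curvature M A g"
  shows "((\<exists>U \<xi>. openin M U \<and> U \<noteq> {} \<and> unit_vector_field M A g U \<xi> \<and>
              totally_geodesic_field M A g U \<xi>) \<longleftrightarrow>
          (\<exists>U \<xi>. openin M U \<and> U \<noteq> {} \<and> unit_vector_field M A g U \<xi> \<and>
              normal_form_on M A g U \<xi>)) \<and>
         (\<forall>U \<xi>. openin M U \<and> unit_vector_field M A g U \<xi> \<longrightarrow>
            (normal_form_on M A g U \<xi> \<longrightarrow> totally_geodesic_field M A g U \<xi>) \<and>
            (totally_geodesic_field M A g U \<xi> \<longrightarrow>
               (\<forall>W. openin M W \<and> W \<subseteq> U \<and> W \<noteq> {} \<longrightarrow>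
                  (\<exists>V. openin M V \<and> V \<subseteq> W \<and> V \<noteq> {} \<and> normal_form_on M A g V \<xi>)))) \<and>
         (\<forall>c\<in>smooth_charts M A. \<forall>\<alpha> a \<omega>\<^sub>0. metric_form g c \<alpha> a \<longrightarrow>
            (\<exists>\<xi>. unit_vector_field M A g (fst c) \<xi> \<and> field_form \<xi> c \<alpha> a \<omega>\<^sub>0 \<and>
               totally_geodesic_field M A g (fst c) \<xi>))"
proof -
  interpret riemannian M A g
    by standard (use assms(1) riemannian_surface_def in blast)+
  have curv: "gauss_curvature (g c) x \<noteq> 0" if "c \<in> charts" "x \<in> snd c ` fst c" for c x
    using assms(2) that chart_image_whole[OF chart_topspace[OF is_chart[OF that(1)]]]
    unfolding sign_preserving_curvature_def by fastforce
  have field: "\<exists>\<xi>. unit_vector_field M A g (fst c) \<xi> \<and> field_form \<xi> c \<alpha> a \<omega>0 \<and>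
      totally_geodesic_field M A g (fst c) \<xi>"
    if c: "c \<in> charts" and form: "metric_form g c \<alpha> a" for c \<alpha> a \<omega>0
  proof -
    interpret F: normal_form_domain "snd c ` fst c" "g c" \<alpha> a \<omega>0
      by (rule normal_form_domain[OF c form])
    obtain \<xi> where \<xi>: "unit_vector_field M A g (fst c) \<xi>"
      "\<And>x. x \<in> snd c ` fst c \<Longrightarrow> \<xi> c x = F.nfield x"
      using extend_chart_field[OF c F.smooth_nfield F.g_\<xi>\<xi>] by blast
    have f: "field_form \<xi> c \<alpha> a \<omega>0"
      by (simp add: field_form_def case_prod_unfold \<xi>(2) F.nfield_def)
    have "normal_form_on M A g (fst c) \<xi>"
      unfolding normal_form_on_def using c form f by blast
    then show ?thesis using \<xi>(1) f normal_form_imp_totally_geodesic by blast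
  qed
  have normal: "\<exists>V. openin M V \<and> V \<subseteq> W \<and> V \<noteq> {} \<and> normal_form_on M A g V \<xi>"
    if "unit_vector_field M A g U \<xi>" "totally_geodesic_field M A g U \<xi>"
      "openin M W" "W \<subseteq> U" "W \<noteq> {}" for U W \<xi>
    by (rule totally_geodesic_imp_normal_form[OF curv that])
  show ?thesis
  proof (intro conjI iffI allI impI ballI)
    assume "\<exists>U \<xi>. openin M U \<and> U \<noteq> {} \<and> unit_vector_field M A g U \<xi> \<and> totally_geodesic_field M A g U \<xi>"
    then obtain U \<xi> where U: "openin M U" "U \<noteq> {}" "unit_vector_field M A g U \<xi>" "totally_geodesic_field M A g U \<xi>"
      by blast
    obtain V where V: "openin M V" "V \<subseteq> U" "V \<noteq> {}" "normal_form_on M A g V \<xi>"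
      using normal[OF U(3,4,1) subset_refl U(2)] by blast
    with unit_vector_field_subset[OF U(3) V(2)]
    show "\<exists>U \<xi>. openin M U \<and> U \<noteq> {} \<and> unit_vector_field M A g U \<xi> \<and> normal_form_on M A g U \<xi>"
      by blast
  next
    assume "\<exists>U \<xi>. openin M U \<and> U \<noteq> {} \<and> unit_vector_field M A g U \<xi> \<and> normal_form_on M A g U \<xi>"
    then show "\<exists>U \<xi>. openin M U \<and> U \<noteq> {} \<and> unit_vector_field M A g U \<xi> \<and> totally_geodesic_field M A g U \<xi>"
      using normal_form_imp_totally_geodesic by blast
  next
    fix U \<xi> assume "normal_form_on M A g U \<xi>"
    then show "totally_geodesic_field M A g U \<xi>" by (rule normal_form_imp_totally_geodesic)
  next
    fix U W \<xi> assume "openin M U \<and> unit_vector_field M A g U \<xi>" "totally_geodesic_field M A g U \<xi>"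
      "openin M W \<and> W \<subseteq> U \<and> W \<noteq> {}"
    then show "\<exists>V. openin M V \<and> V \<subseteq> W \<and> V \<noteq> {} \<and> normal_form_on M A g V \<xi>"
      using normal by blast
  next
    fix c \<alpha> a \<omega>0 assume "c \<in> charts" "metric_form g c \<alpha> a"
    then show "\<exists>\<xi>. unit_vector_field M A g (fst c) \<xi> \<and> field_form \<xi> c \<alpha> a \<omega>0 \<and>
        totally_geodesic_field M A g (fst c) \<xi>"
      by (rule field)
  qed
qed

end
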